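(* Let $(M^8,g,\rho)$ be a $\mathrm{PSU}(3)$-structure. The following equivalences hold: (1) $(M^8,g,\rho)$ is of type $\mathcal{W}_2\oplus\mathcal{W}_3\oplus\mathcal{W}_4\oplus\mathcal{W}_5\oplus\mathcal{W}_6$ if and only if $\rho\lrcorner\ast d\rho=0$. (2) It is of type $\mathcal{W}_1\oplus\mathcal{W}_3\oplus\mathcal{W}_4\oplus\mathcal{W}_5\oplus\mathcal{W}_6$ if and only if $6\,\delta\rho=(\delta\rho\lrcorner\rho)\lrcorner\rho$. (3) It is of type $\mathcal{W}_1\oplus\mathcal{W}_2\oplus\mathcal{W}_4\oplus\mathcal{W}_5\oplus\mathcal{W}_6$ if and only if $\sigma_-\big(10\,d\rho-\ast(\rho\wedge(\rho\lrcorner\ast d\rho))\big)=0$. (4) It is of type $\mathcal{W}_1\oplus\mathcal{W}_2\oplus\mathcal{W}_3\oplus\mathcal{W}_5\oplus\mathcal{W}_6$ if and only if $\delta\rho\lrcorner\rho=0$, and also if and only if $\rho\lrcorner d\rho=0$. (5) It is of type $\mathcal{W}_1\oplus\mathcal{W}_2\oplus\mathcal{W}_3\oplus\mathcal{W}_4\oplus\mathcal{W}_6$ if and only if $\sigma_-\big(10\ast d\rho-\ast(\rho\wedge(\rho\lrcorner d\rho))\big)=0$. (6) It is of type $\mathcal{W}_2\oplus\mathcal{W}_4\oplus\mathcal{W}_5\oplus\mathcal{W}_6$ if and only if $\sigma_-(d\rho)=0$. (7) It is of type $\mathcal{W}_1\oplus\mathcal{W}_2\oplus\mathcal{W}_3\oplus\mathcal{W}_6$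 if and only if $\sigma_-(\ast d\rho)=0$. (8) It is of type $\mathcal{W}_1\oplus\mathcal{W}_3\oplus\mathcal{W}_5\oplus\mathcal{W}_6$ if and only if $\delta\rho=0$. (9) It is of type $\mathcal{W}_1\oplus\mathcal{W}_2\oplus\mathcal{W}_6$ if and only if $10\ast d\rho=\rho\wedge(\rho\lrcorner\ast d\rho)$. (10) It is of type $\mathcal{W}_2\oplus\mathcal{W}_4\oplus\mathcal{W}_6$ if and only if $10\,d\rho=\rho\wedge(\rho\lrcorner d\rho)$. (11) It is of type $\mathcal{W}_2\oplus\mathcal{W}_6$ if and only if $d\rho=0$. (12) It is of type $\mathcal{W}_6$ if and only if $d\rho=0$ and $\delta\rho=0$.
   Context: Algebraic setting. $\mathbb{R}^8$ is oriented Euclidean space, identified with its dual; $(e_1,\dots,e_8)$ is an oriented orthonormal basis, $e_{i_1\dots i_j}=e_{i_1}\wedge\dots\wedge e_{i_j}$, $\Lambda^k$ the space of $k$-forms. For $\alpha\in\Lambda^k,\beta\in\Lambda^l$ put $\sigma_0(\alpha,\beta)=\alpha\wedge\beta$ and $\sigma_j(\alpha,\beta)=\sum_{i_1<\dots<i_j}(e_{i_1}\lrcorner\cdots\lrcorner e_{i_j}\lrcorner\alpha)\wedge(e_{i_1}\lrcorner\cdots\lrcorner e_{i_j}\lrcorner\beta)$. For $k\le l$ the contraction is $\alpha\lrcorner\beta=\sigma_k(\alpha,\beta)$; $\ast$ is the Hodge operator. Let $$(\star)\quad\rho=e_{246}-e_{235}-e_{145}-e_{136}+(e_{12}+e_{34}-2e_{56})\wedge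 e_7+\sqrt3\,(e_{12}-e_{34})\wedge e_8 ,$$ $\mathrm{PSU}(3)\subset\mathrm{SO}(8)$ its isotropy group, $\sigma_+(\alpha)=\sigma_1(\rho,\alpha)$, $\sigma_-(\alpha)=\sigma_2(\rho,\alpha)$. Modules: $\Lambda^2_8=\sigma_+(\Lambda^1)$, $\Lambda^2_{20}=\{\omega\in\Lambda^2\mid\omega\wedge\ast\rho=0\}$, $\Lambda^3_8=\{\ast(\omega\wedge\rho)\mid\omega\in\Lambda^2_8\}$, $\Lambda^3_{20}=\sigma_+(\Lambda^2_{20})$, $\Lambda^3_{27}=\{T\in\Lambda^3\mid T\wedge\rho=0,\ T\wedge\ast\rho=0\}$, $\Lambda^4_8=\sigma_+(\Lambda^3_8)$, $\Lambda^4_{27}=\sigma_+(\Lambda^3_{27})$. With $\mathfrak{so}(8)=\Lambda^2$ one has $\mathfrak{psu}(3)=\Lambda^2_8$; let $\mathfrak m=\Lambda^2_{20}$ be its orthogonal complement and $\mathrm{pr}_{\mathfrak m}$ the projection. Maps: $\Phi_1(X\otimes\omega)=X\wedge\omega$ and $\Phi_2(X\otimes\omega)=(X\lrcorner\rho)\wedge\omega$ on $\mathbb{R}^8\otimes\mathfrak m$; $\Theta_1(T)=-\frac12\sum_i e_i\otimes\mathrm{pr}_{\mathfrak m}(e_i\lrcorner T)$ for $T\in\Lambda^3$; $\Theta_2(F)=-\sum_i e_i\otimes\mathrm{pr}_{\mathfrak m}((e_i\lrcorner\rho)\lrcorner F)$ for $F\in\Lambda^4$. Put $\mathcal{W}_1=\Theta_1(\Lambda^3_8)$,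 $\mathcal{W}_2=\Theta_1(\Lambda^3_{20})$, $\mathcal{W}_3=\Theta_1(\Lambda^3_{27})$, $\mathcal{W}_4=\Theta_2(\ast\Lambda^4_8)$, $\mathcal{W}_5=\Theta_2(\ast\Lambda^4_{27})$, $\mathcal{W}_6=\mathrm{Ker}(\Phi_1)\cap\mathrm{Ker}(\Phi_2)$; then $\mathbb{R}^8\otimes\mathfrak m=\mathcal{W}_1\oplus\dots\oplus\mathcal{W}_6$. Geometric setting. A $\mathrm{PSU}(3)$-structure $(M^8,g,\rho)$ is an (oriented) Riemannian 8-manifold with a 3-form $\rho$ such that at every point there is an oriented orthonormal frame $(e_1,\dots,e_8)$ (an adapted frame) realizing $(\star)$; the operators $\sigma_j,\sigma_+,\sigma_-,\ast$, the modules $\Lambda^k_i$ and $\mathfrak m$, the maps $\Phi_1,\Phi_2,\Theta_1,\Theta_2$ and the spaces $\mathcal{W}_1,\dots,\mathcal{W}_6$ are all applied pointwise in adapted frames, with $TM^8$ identified with $T^*M^8$ via $g$. Let $\omega^g_{ij}=g(\nabla^g e_i,e_j)$ be the connection forms of the Levi-Civita connection in an adapted frame and $\Omega^g=(\omega^g_{ij})$ the resulting $\mathfrak{so}(8)$-valued 1-form. The intrinsic torsion is $\Gamma=\mathrm{pr}_{\mathfrak m}(\Omega^g)$, a section of $\mathbb{R}^8\otimes\mathfrak m$; it satisfies $\nabla^g_X\rho=\sigma_1(\Gamma(X),\rho)$. The structure is of type $\mathcal{W}_{i_1}\oplus\dots\oplus\mathcal{W}_{i_j}$ if $\Gamma\in\mathcal{W}_{i_1}\oplus\dots\oplus\mathcal{W}_{i_j}$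 everywhere. $d$ and $\delta=-\sum_i e_i\lrcorner\nabla^g_{e_i}$ are the Riemannian differential and co-differential. *)

theory Defs
  imports "HOL-Analysis.Analysis"
begin

section \<open>The exterior algebra of \<open>\<real>\<^sup>8\<close>\<close>

text \<open>
  A form is the vector of its coefficients in the basis \<open>e\<^sub>I\<close>, \<open>I\<close> a set of indices. Indices are the
  elements \<open>0 < 1 < \<dots> < 7\<close> of the type \<^typ>\<open>8\<close>, so that the basis vector number \<open>n\<close> has index
  \<open>n - 1\<close>; \<open>e\<^sub>I\<close> is the wedge product of the \<open>e\<^sub>i\<close>, \<open>i \<in> I\<close>, in increasing order. The inner product
  of \<^typ>\<open>real ^ (8 set)\<close> is the one for which the \<open>e\<^sub>I\<close> are orthonormal.
\<close>

type_synonym form = "real ^ (8 set)"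

lemma of_nat_8_less_iff:
  assumes "i < 8" "j < 8"
  shows "(of_nat i :: 8) < of_nat j \<longleftrightarrow> i < j"
proof -
  have "Rep_bit0 (of_nat n :: 8) = int n" if "n < 8" for n
    using that by (simp add: bit0.of_nat_eq Abs_bit0_inverse)
  with assms show ?thesis by (simp add: less_bit0_def)
qed

definition Lam :: "nat \<Rightarrow> form set" where
  "Lam k = {\<alpha>. \<forall>I. \<alpha> $ I \<noteq> 0 \<longrightarrow> card I = k}"

text \<open>For disjoint \<open>I\<close>, \<open>J\<close>: \<open>e\<^sub>I \<and> e\<^sub>J = shuffle_sign I J \<cdot> e\<^bsub>I \<union> J\<^esub>\<close>.\<close>

definition shuffle_sign :: "8 set \<Rightarrow> 8 set \<Rightarrow> real" where
  "shuffle_sign I J = (-1) ^ card {(i, j). i \<in> I \<and> j \<in> J \<and> j < i}"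

definition wedge :: "form \<Rightarrow> form \<Rightarrow> form"  (infixr "\<and>\<^sub>f" 80) where
  "\<alpha> \<and>\<^sub>f \<beta> = (\<chi> K. \<Sum>I\<in>Pow K. shuffle_sign I (K - I) * \<alpha> $ I * \<beta> $ (K - I))"

definition covec :: "8 \<Rightarrow> form" where
  "covec i = axis {i} 1"

definition e :: "nat \<Rightarrow> form" where
  "e n = covec (of_nat (n - 1))"

text \<open>Contraction of a form by a vector (insertion into the first slot).\<close>

definition ins :: "real^8 \<Rightarrow> form \<Rightarrow> form" where
  "ins v \<alpha> = (\<chi> I. \<Sum>i\<in>-I. v $ i * shuffle_sign {i} I * \<alpha> $ insert i I)"

definition ins_basis :: "8 set \<Rightarrow> form \<Rightarrow> form" where
  "ins_basis S \<alpha> = foldr (\<lambda>i. ins (axis i 1)) (sorted_list_of_set S) \<alpha>"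

definition sigma :: "nat \<Rightarrow> form \<Rightarrow> form \<Rightarrow> form" where
  "sigma j \<alpha> \<beta> = (\<Sum>S | card S = j. ins_basis S \<alpha> \<and>\<^sub>f ins_basis S \<beta>)"

text \<open>The contraction of a \<open>k\<close>-form \<open>\<alpha>\<close> into an \<open>l\<close>-form \<open>\<beta>\<close>, \<open>k \<le> l\<close>; as \<^typ>\<open>form\<close> does not
  record degrees, \<open>k\<close> is an argument.\<close>

abbreviation contr :: "nat \<Rightarrow> form \<Rightarrow> form \<Rightarrow> form" where
  "contr k \<alpha> \<beta> \<equiv> sigma k \<alpha> \<beta>"

text \<open>\<open>\<beta> \<and> hodge \<alpha> = \<langle>\<beta>, \<alpha>\<rangle> e\<^sub>1 \<and> \<dots> \<and> e\<^sub>8\<close> for forms of equal degree.\<close>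

definition hodge :: "form \<Rightarrow> form" where
  "hodge \<alpha> = (\<chi> J. shuffle_sign (- J) J * \<alpha> $ (- J))"

text \<open>\<open>pull E \<alpha>\<close> has the coefficients \<open>\<alpha>(E\<^bsub>i1\<^esub>, \<dots>, E\<^bsub>ik\<^esub>)\<close>, \<open>i1 < \<dots> < ik\<close>. For a frame \<open>E\<close> these are the
  components of \<open>\<alpha>\<close> in the coframe dual to \<open>E\<close>; for the columns \<open>E\<close> of a matrix it is the pull-back
  by that matrix.\<close>

definition pull :: "(8 \<Rightarrow> real^8) \<Rightarrow> form \<Rightarrow> form" where
  "pull E \<alpha> = (\<chi> I. fold (\<lambda>i. ins (E i)) (sorted_list_of_set I) \<alpha> $ {})"


section \<open>The model of PSU(3)\<close>

definition rho0 :: form where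
  "rho0 = e 2 \<and>\<^sub>f e 4 \<and>\<^sub>f e 6 - e 2 \<and>\<^sub>f e 3 \<and>\<^sub>f e 5 - e 1 \<and>\<^sub>f e 4 \<and>\<^sub>f e 5 - e 1 \<and>\<^sub>f e 3 \<and>\<^sub>f e 6
        + (e 1 \<and>\<^sub>f e 2 + e 3 \<and>\<^sub>f e 4 - 2 *\<^sub>R (e 5 \<and>\<^sub>f e 6)) \<and>\<^sub>f e 7
        + sqrt 3 *\<^sub>R ((e 1 \<and>\<^sub>f e 2 - e 3 \<and>\<^sub>f e 4) \<and>\<^sub>f e 8)"

definition sigma_plus :: "form \<Rightarrow> form" where
  "sigma_plus \<alpha> = sigma 1 rho0 \<alpha>"

definition sigma_minus :: "form \<Rightarrow> form" where
  "sigma_minus \<alpha> = sigma 2 rho0 \<alpha>"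

definition Lam2_8 :: "form set" where
  "Lam2_8 = sigma_plus ` Lam 1"

definition Lam2_20 :: "form set" where
  "Lam2_20 = {\<omega> \<in> Lam 2. \<omega> \<and>\<^sub>f hodge rho0 = 0}"

definition Lam3_8 :: "form set" where
  "Lam3_8 = {hodge (\<omega> \<and>\<^sub>f rho0) | \<omega>. \<omega> \<in> Lam2_8}"

definition Lam3_20 :: "form set" where
  "Lam3_20 = sigma_plus ` Lam2_20"

definition Lam3_27 :: "form set" where
  "Lam3_27 = {T \<in> Lam 3. T \<and>\<^sub>f rho0 = 0 \<and> T \<and>\<^sub>f hodge rho0 = 0}"

definition Lam4_8 :: "form set" where
  "Lam4_8 = sigma_plus ` Lam3_8"

definition Lam4_27 :: "form set" where
  "Lam4_27 = sigma_plus ` Lam3_27"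

text \<open>The orthogonal projection of \<open>\<Lambda>\<^sup>2\<close> onto \<open>\<mm> = \<Lambda>\<^sup>2\<^sub>2\<^sub>0\<close>.\<close>

definition pr_m :: "form \<Rightarrow> form" where
  "pr_m \<omega> = (THE \<mu>. \<mu> \<in> Lam2_20 \<and> (\<forall>\<nu>\<in>Lam2_20. orthogonal (\<omega> - \<mu>) \<nu>))"

text \<open>An element \<open>\<Sum>\<^sub>i e\<^sub>i \<otimes> A\<^sub>i\<close> of \<open>\<real>\<^sup>8 \<otimes> \<Lambda>\<^sup>2\<close> is represented by the vector \<open>A\<close> of its components.\<close>

type_synonym tensor = "form ^ 8"

definition Phi1 :: "tensor \<Rightarrow> form" where
  "Phi1 A = (\<Sum>i\<in>UNIV. covec i \<and>\<^sub>f A $ i)"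

definition Phi2 :: "tensor \<Rightarrow> form" where
  "Phi2 A = (\<Sum>i\<in>UNIV. ins (axis i 1) rho0 \<and>\<^sub>f A $ i)"

definition Theta1 :: "form \<Rightarrow> tensor" where
  "Theta1 T = (\<chi> i. - (1/2) *\<^sub>R pr_m (ins (axis i 1) T))"

definition Theta2 :: "form \<Rightarrow> tensor" where
  "Theta2 F = (\<chi> i. - pr_m (contr 2 (ins (axis i 1) rho0) F))"

definition W :: "nat \<Rightarrow> tensor set" where
  "W k = (if k = 1 then Theta1 ` Lam3_8
     else if k = 2 then Theta1 ` Lam3_20
     else if k = 3 then Theta1 ` Lam3_27
     else if k = 4 then Theta2 ` hodge ` Lam4_8
     else if k = 5 then Theta2 ` hodge ` Lam4_27
     else if k = 6 then {A. (\<forall>i. A $ i \<in> Lam2_20) \<and> Phi1 A = 0 \<and> Phi2 A = 0}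
     else {0})"

definition W_sum :: "nat set \<Rightarrow> tensor set" where
  "W_sum J = {\<Sum>k\<in>J. a k | a. \<forall>k\<in>J. a k \<in> W k}"


section \<open>Oriented smooth 8-manifolds and tensor fields in charts\<close>

text \<open>\<open>C\<^sup>k\<close> and \<open>C\<^sup>\<infinity>\<close> maps; the set \<open>S\<close> is meant to be open.\<close>

primrec Ck_on :: "nat \<Rightarrow> 'a::euclidean_space set \<Rightarrow> ('a \<Rightarrow> 'b::real_normed_vector) \<Rightarrow> bool" where
  "Ck_on 0 S f \<longleftrightarrow> continuous_on S f"
| "Ck_on (Suc k) S f \<longleftrightarrow> (\<forall>x\<in>S. f differentiable at x) \<and>
     (\<forall>b\<in>Basis. Ck_on k S (\<lambda>x. frechet_derivative f (at x) b))"

definition smooth_on :: "'a::euclidean_space set \<Rightarrow> ('a \<Rightarrow> 'b::real_normed_vector) \<Rightarrow> bool" where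
  "smooth_on S f \<longleftrightarrow> (\<forall>k. Ck_on k S f)"

text \<open>A chart is a pair of a domain and a coordinate map.\<close>

type_synonym 'a chart = "'a set \<times> ('a \<Rightarrow> real^8)"

definition img :: "'a chart \<Rightarrow> (real^8) set" where
  "img c = snd c ` fst c"

definition overlap :: "'a chart \<Rightarrow> 'a chart \<Rightarrow> (real^8) set" where
  "overlap c c' = snd c ` (fst c \<inter> fst c')"

definition transition :: "'a chart \<Rightarrow> 'a chart \<Rightarrow> real^8 \<Rightarrow> real^8" where
  "transition c c' = snd c' \<circ> inv_into (fst c) (snd c)"

definition jacobian :: "'a chart \<Rightarrow> 'a chart \<Rightarrow> real^8 \<Rightarrow> real^8^8" where
  "jacobian c c' x = matrix (frechet_derivative (transition c c') (at x))"

definition oriented_manifold :: "'a topology \<Rightarrow> 'a chart set \<Rightarrow> bool" where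
  "oriented_manifold M \<A> \<longleftrightarrow>
     Hausdorff_space M \<and> second_countable M \<and>
     (\<Union>c\<in>\<A>. fst c) = topspace M \<and>
     (\<forall>c\<in>\<A>. openin M (fst c) \<and> open (img c) \<and>
        homeomorphic_map (subtopology M (fst c)) (top_of_set (img c)) (snd c)) \<and>
     (\<forall>c\<in>\<A>. \<forall>c'\<in>\<A>. smooth_on (overlap c c') (transition c c') \<and>
        (\<forall>x\<in>overlap c c'. 0 < det (jacobian c c' x)))"

text \<open>Tensor fields are given by their components in every chart, subject to the transformation law.\<close>

definition riemannian_metric :: "'a chart set \<Rightarrow> ('a chart \<Rightarrow> real^8 \<Rightarrow> real^8^8) \<Rightarrow> bool" where
  "riemannian_metric \<A> g \<longleftrightarrow>
     (\<forall>c\<in>\<A>. smooth_on (img c) (g c) \<and>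
        (\<forall>x\<in>img c. transpose (g c x) = g c x \<and> (\<forall>v. v \<noteq> 0 \<longrightarrow> 0 < v \<bullet> (g c x *v v)))) \<and>
     (\<forall>c\<in>\<A>. \<forall>c'\<in>\<A>. \<forall>x\<in>overlap c c'.
        g c x = transpose (jacobian c c' x) ** g c' (transition c c' x) ** jacobian c c' x)"

definition differential_form :: "'a chart set \<Rightarrow> nat \<Rightarrow> ('a chart \<Rightarrow> real^8 \<Rightarrow> form) \<Rightarrow> bool" where
  "differential_form \<A> k \<rho> \<longleftrightarrow>
     (\<forall>c\<in>\<A>. smooth_on (img c) (\<rho> c) \<and> \<rho> c ` img c \<subseteq> Lam k) \<and>
     (\<forall>c\<in>\<A>. \<forall>c'\<in>\<A>. \<forall>x\<in>overlap c c'.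
        \<rho> c x = pull (\<lambda>i. column i (jacobian c c' x)) (\<rho> c' (transition c c' x)))"


section \<open>Levi-Civita connection, differential and co-differential in a chart\<close>

definition pd :: "(real^8 \<Rightarrow> 'b::real_normed_vector) \<Rightarrow> real^8 \<Rightarrow> 8 \<Rightarrow> 'b" where
  "pd f x i = frechet_derivative f (at x) (axis i 1)"

definition christoffel :: "(real^8 \<Rightarrow> real^8^8) \<Rightarrow> real^8 \<Rightarrow> 8 \<Rightarrow> 8 \<Rightarrow> 8 \<Rightarrow> real" where
  "christoffel G x k i j = (1/2) *
     (\<Sum>l\<in>UNIV. matrix_inv (G x) $ k $ l * (pd G x i $ j $ l + pd G x j $ i $ l - pd G x l $ i $ j))"

definition nabla_vec :: "(real^8 \<Rightarrow> real^8^8) \<Rightarrow> (real^8 \<Rightarrow> real^8) \<Rightarrow> real^8 \<Rightarrow> real^8 \<Rightarrow> real^8" where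
  "nabla_vec G Y x v = frechet_derivative Y (at x) v +
     (\<chi> k. \<Sum>i\<in>UNIV. \<Sum>j\<in>UNIV. christoffel G x k i j * v $ i * Y x $ j)"

text \<open>The extension to forms as a derivation, with \<open>\<nabla>\<^sub>v dx\<^sup>k = - \<Sum>\<^sub>i\<^sub>j \<Gamma>\<^sup>k\<^sub>i\<^sub>j v\<^sup>i dx\<^sup>j\<close>.\<close>

definition nabla_form :: "(real^8 \<Rightarrow> real^8^8) \<Rightarrow> (real^8 \<Rightarrow> form) \<Rightarrow> real^8 \<Rightarrow> real^8 \<Rightarrow> form" where
  "nabla_form G \<alpha> x v = frechet_derivative \<alpha> (at x) v -
     (\<Sum>k\<in>UNIV. \<Sum>i\<in>UNIV. \<Sum>j\<in>UNIV.
        (christoffel G x k i j * v $ i) *\<^sub>R (covec j \<and>\<^sub>f ins (axis k 1) (\<alpha> x)))"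

definition ext_d :: "(real^8 \<Rightarrow> form) \<Rightarrow> real^8 \<Rightarrow> form" where
  "ext_d \<alpha> x = (\<Sum>i\<in>UNIV. covec i \<and>\<^sub>f pd \<alpha> x i)"

text \<open>The co-differential; \<open>E\<close> is an orthonormal frame at \<open>x\<close>.\<close>

definition codiff :: "(real^8 \<Rightarrow> real^8^8) \<Rightarrow> (8 \<Rightarrow> real^8) \<Rightarrow> (real^8 \<Rightarrow> form) \<Rightarrow> real^8 \<Rightarrow> form" where
  "codiff G E \<alpha> x = - (\<Sum>i\<in>UNIV. ins (E i) (nabla_form G \<alpha> x (E i)))"

text \<open>The connection with the above Christoffel symbols is torsion-free and metric.\<close>

lemma pd_symmetric:
  assumes "open S" "x \<in> S" "G differentiable at x" and sym: "\<And>y. y \<in> S \<Longrightarrow> transpose (G y) = G y"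
  shows "pd G x l $ i $ j = pd G x l $ j $ i"
proof -
  let ?D = "frechet_derivative G (at x)"
  have D: "(G has_derivative ?D) (at x)"
    using assms(3) frechet_derivative_works by blast
  have comp: "((\<lambda>y. G y $ a $ b) has_derivative (\<lambda>v. ?D v $ a $ b)) (at x)" for a b
    by (rule bounded_linear.has_derivative[OF bounded_linear_vec_nth
          bounded_linear.has_derivative[OF bounded_linear_vec_nth D]])
  have sym': "G y $ i $ j = G y $ j $ i" if "y \<in> S" for y
  proof -
    have "transpose (G y) $ i $ j = G y $ i $ j"
      using sym[OF that] by (rule arg_cong)
    then show ?thesis by (simp add: transpose_def)
  qed
  have "((\<lambda>y. G y $ j $ i) has_derivative (\<lambda>v. ?D v $ i $ j)) (at x)"
    by (rule has_derivative_transform_within_open[OF comp assms(1,2) sym'])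
  then have "(\<lambda>v. ?D v $ i $ j) = (\<lambda>v. ?D v $ j $ i)"
    using comp[of j i] by (rule has_derivative_unique)
  then show ?thesis
    unfolding pd_def by (rule fun_cong)
qed

lemma christoffel_torsion_free:
  assumes "open S" "x \<in> S" "G differentiable at x" "\<And>y. y \<in> S \<Longrightarrow> transpose (G y) = G y"
  shows "christoffel G x k i j = christoffel G x k j i"
  using pd_symmetric[OF assms] by (simp add: christoffel_def algebra_simps)

lemma christoffel_metric:
  assumes "open S" "x \<in> S" "G differentiable at x" "\<And>y. y \<in> S \<Longrightarrow> transpose (G y) = G y"
    and inv: "invertible (G x)"
  shows "pd G x k $ i $ j =
    (\<Sum>l\<in>UNIV. christoffel G x l k i * G x $ l $ j + christoffel G x l k j * G x $ l $ i)"
proof -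
  have sym: "G x $ a $ b = G x $ b $ a" for a b
  proof -
    have "transpose (G x) $ a $ b = G x $ a $ b"
      using assms(4)[OF assms(2)] by (rule arg_cong)
    then show ?thesis by (simp add: transpose_def)
  qed
  have GI: "(\<Sum>l\<in>UNIV. G x $ a $ l * matrix_inv (G x) $ l $ m) = (if a = m then 1 else 0)" for a m
  proof -
    have "G x ** matrix_inv (G x) = mat 1"
      using someI_ex[OF inv[unfolded invertible_def]] unfolding matrix_inv_def by blast
    then have "(G x ** matrix_inv (G x)) $ a $ m = mat 1 $ a $ m"
      by (rule arg_cong)
    then show ?thesis by (simp add: matrix_matrix_mult_def mat_def)
  qed
  have lower: "(\<Sum>l\<in>UNIV. christoffel G x l a b * G x $ l $ c) =
      (1/2) * (pd G x a $ b $ c + pd G x b $ a $ c - pd G x c $ a $ b)" for a b c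
  proof -
    let ?t = "\<lambda>m. pd G x a $ b $ m + pd G x b $ a $ m - pd G x m $ a $ b"
    have "christoffel G x l a b * G x $ l $ c =
        (\<Sum>m\<in>UNIV. (1/2) * (G x $ c $ l * matrix_inv (G x) $ l $ m) * ?t m)" for l
      unfolding christoffel_def sum_distrib_left sum_distrib_right sym[of c l]
      by (intro sum.cong refl) (simp only: mult_ac)
    then have "(\<Sum>l\<in>UNIV. christoffel G x l a b * G x $ l $ c) =
        (\<Sum>l\<in>UNIV. \<Sum>m\<in>UNIV. (1/2) * (G x $ c $ l * matrix_inv (G x) $ l $ m) * ?t m)"
      by (simp only:)
    also have "\<dots> = (\<Sum>m\<in>UNIV. (1/2) * (\<Sum>l\<in>UNIV. G x $ c $ l * matrix_inv (G x) $ l $ m) * ?t m)"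
      by (subst sum.swap) (simp only: sum_distrib_left sum_distrib_right)
    also have "\<dots> = (\<Sum>m\<in>UNIV. if c = m then (1/2) * ?t m else 0)"
      by (intro sum.cong refl) (simp add: GI)
    finally show ?thesis by simp
  qed
  have psym: "pd G x l $ a $ b = pd G x l $ b $ a" for l a b
    by (rule pd_symmetric[OF assms(1-3)]) (rule assms(4))
  show ?thesis
    unfolding sum.distrib lower psym[of k j i] by (simp add: field_simps)
qed


section \<open>PSU(3)-structures and their intrinsic torsion\<close>

text \<open>A frame at a point is given by the chart components \<open>E i\<close> of its vectors.\<close>

definition adapted_frame :: "real^8^8 \<Rightarrow> form \<Rightarrow> (8 \<Rightarrow> real^8) \<Rightarrow> bool" where
  "adapted_frame G \<rho> E \<longleftrightarrow>
     (\<forall>i j. E i \<bullet> (G *v E j) = (if i = j then 1 else 0)) \<and>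
     0 < det (\<chi> k i. E i $ k) \<and>
     pull E \<rho> = rho0"

definition adapted_frame_field ::
  "(real^8 \<Rightarrow> real^8^8) \<Rightarrow> (real^8 \<Rightarrow> form) \<Rightarrow> (real^8) set \<Rightarrow> (8 \<Rightarrow> real^8 \<Rightarrow> real^8) \<Rightarrow> bool" where
  "adapted_frame_field G \<rho> U E \<longleftrightarrow>
     open U \<and> (\<forall>i. smooth_on U (E i)) \<and> (\<forall>x\<in>U. adapted_frame (G x) (\<rho> x) (\<lambda>i. E i x))"

text \<open>As connection forms are taken with respect to adapted frames, these are required to exist as
  smooth frame fields around every point (a reduction of the frame bundle to PSU(3)). For smooth
  \<open>\<rho>\<close> this is the same as requiring an adapted frame at every single point, because
  \<open>SO(8) \<rightarrow> SO(8)/PSU(3)\<close> has smooth local sections.\<close>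

definition psu3_structure :: "'a topology \<Rightarrow> 'a chart set \<Rightarrow>
    ('a chart \<Rightarrow> real^8 \<Rightarrow> real^8^8) \<Rightarrow> ('a chart \<Rightarrow> real^8 \<Rightarrow> form) \<Rightarrow> bool" where
  "psu3_structure M \<A> g \<rho> \<longleftrightarrow>
     oriented_manifold M \<A> \<and> riemannian_metric \<A> g \<and> differential_form \<A> 3 \<rho> \<and>
     (\<forall>c\<in>\<A>. \<forall>x\<in>img c. \<exists>U E. x \<in> U \<and> U \<subseteq> img c \<and> adapted_frame_field (g c) (\<rho> c) U E)"

text \<open>\<open>\<Omega>(E\<^sub>k) = \<Sum>\<^bsub>i<j\<^esub> g(\<nabla>\<^bsub>E\<^sub>k\<^esub> E\<^sub>i, E\<^sub>j) e\<^sub>i \<and> e\<^sub>j\<close>, under the identification of \<open>\<ss>\<oo>(8)\<close> with \<open>\<Lambda>\<^sup>2\<close>.\<close>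

definition connection :: "(real^8 \<Rightarrow> real^8^8) \<Rightarrow> (8 \<Rightarrow> real^8 \<Rightarrow> real^8) \<Rightarrow> real^8 \<Rightarrow> tensor" where
  "connection G E x = (\<chi> k. \<Sum>(i, j) | i < j.
     (nabla_vec G (E i) x (E k x) \<bullet> (G x *v E j x)) *\<^sub>R (covec i \<and>\<^sub>f covec j))"

definition intrinsic_torsion :: "(real^8 \<Rightarrow> real^8^8) \<Rightarrow> (8 \<Rightarrow> real^8 \<Rightarrow> real^8) \<Rightarrow> real^8 \<Rightarrow> tensor" where
  "intrinsic_torsion G E x = (\<chi> k. pr_m (connection G E x $ k))"

definition of_type :: "'a chart set \<Rightarrow> ('a chart \<Rightarrow> real^8 \<Rightarrow> real^8^8) \<Rightarrow>
    ('a chart \<Rightarrow> real^8 \<Rightarrow> form) \<Rightarrow> nat set \<Rightarrow> bool" where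
  "of_type \<A> g \<rho> J \<longleftrightarrow>
     (\<forall>c\<in>\<A>. \<forall>U E. U \<subseteq> img c \<and> adapted_frame_field (g c) (\<rho> c) U E \<longrightarrow>
        (\<forall>x\<in>U. intrinsic_torsion (g c) E x \<in> W_sum J))"

text \<open>\<open>P\<close> holds at every point for the components of \<open>d\<rho>\<close> and \<open>\<delta>\<rho>\<close> in adapted frames; the
  components of \<open>\<rho>\<close> itself are then \<^const>\<open>rho0\<close>.\<close>

definition everywhere :: "'a chart set \<Rightarrow> ('a chart \<Rightarrow> real^8 \<Rightarrow> real^8^8) \<Rightarrow>
    ('a chart \<Rightarrow> real^8 \<Rightarrow> form) \<Rightarrow> (form \<Rightarrow> form \<Rightarrow> bool) \<Rightarrow> bool" where
  "everywhere \<A> g \<rho> P \<longleftrightarrow>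
     (\<forall>c\<in>\<A>. \<forall>x\<in>img c. \<forall>E. adapted_frame (g c x) (\<rho> c x) E \<longrightarrow>
        P (pull E (ext_d (\<rho> c) x)) (pull E (codiff (g c) E (\<rho> c) x)))"

end

theory Submission
  imports Defs
begin

text \<open>
  In an adapted frame field \<open>\<rho>\<close> has constant components, so \<open>\<nabla>\<^sub>X\<rho> = \<sigma>\<^sub>1(\<Omega>(X), \<rho>)\<close>. As \<open>\<Lambda>\<^sup>2\<^sub>8\<close>
  annihilates \<open>\<rho>\<close>, only the intrinsic torsion \<open>\<Gamma>\<close> matters, and \<open>d\<rho>\<close>, \<open>\<delta>\<rho>\<close> are linear images
  \<open>D(\<Gamma>)\<close>, \<open>\<Delta>(\<Gamma>)\<close>. The common kernel of \<open>D\<close> and \<open>\<Delta>\<close> on \<open>\<real>\<^sup>8 \<otimes> \<mm>\<close> is \<open>\<W>\<^sub>6\<close>, because of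
  \<open>D = \<Phi>\<^sub>2 - \<sigma>\<^sub>+\<Phi>\<^sub>1\<close> and \<open>12 \<Phi>\<^sub>1 = \<sigma>\<^sub>+\<Delta> - \<sigma>\<^sub>-D\<close>; on the other summands
  \<open>D \<Theta>\<^sub>1 = \<sigma>\<^sub>+\<close>, \<open>\<Delta> \<Theta>\<^sub>1 = - \<sigma>\<^sub>-\<close>, \<open>D \<Theta>\<^sub>2 = - 18\<close> on \<open>*\<Lambda>\<^sup>4\<^sub>8\<close> and \<open>D \<Theta>\<^sub>2 = - 8\<close> on \<open>*\<Lambda>\<^sup>4\<^sub>2\<^sub>7\<close>. Hence the
  components of \<open>\<Gamma>\<close> can be recovered, one by one, from \<open>\<rho> \<lrcorner> *d\<rho>\<close>, \<open>6 \<delta>\<rho> - (\<delta>\<rho> \<lrcorner> \<rho>) \<lrcorner> \<rho>\<close>,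
  \<open>\<sigma>\<^sub>-(10 d\<rho> - *(\<rho> \<and> (\<rho> \<lrcorner> *d\<rho>)))\<close>, \<open>\<rho> \<lrcorner> d\<rho>\<close> and \<open>\<sigma>\<^sub>-(10 *d\<rho> - *(\<rho> \<and> (\<rho> \<lrcorner> d\<rho>)))\<close>.
  The linear identities between forms that this takes are checked on the basis \<open>e\<^sub>I\<close>.
\<close>

section \<open>Exterior algebra\<close>

text \<open>Irreducibility and Schur's lemma are replaced by explicit operators built from rho.
  \<open>Lam 4\<close> is the sum of rho ^ Lambda^1, of sigma_+ Lambda^3_27 and of the Hodge duals
  of both; the projections, and the scalars by which equivariant maps act on the pieces, appear as
  coefficients of identities on a full space Lambda^k. An identity meant for a submodule is
  therefore stated with correction terms that vanish on it. The two invariants are not independent: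
  the contraction of delta rho into rho equals that of rho into d rho, hence the two forms of (4),
  and only the Lambda^2_20 part of delta rho carries new information. Necessity of each criterion is
  checked on single summands and extends by linearity. Sufficiency is constructive: five summands
  are written down from D and Delta, and the remainder is annihilated by both. The factor sqrt 3 in
  rho obstructs exact evaluation; rescaling e_8 makes rho integral, at the price of a basis vector
  of squared length 3.\<close>

lemma shuffle_sign_Un_left:
  assumes "I \<inter> J = {}"
  shows "shuffle_sign (I \<union> J) K = shuffle_sign I K * shuffle_sign J K"
proof -
  have "{(i, j). i \<in> I \<union> J \<and> j \<in> K \<and> j < i} =
      {(i, j). i \<in> I \<and> j \<in> K \<and> j < i} \<union> {(i, j). i \<in> J \<and> j \<in> K \<and> j < i}"
    by auto
  moreover have "{(i, j). i \<in> I \<and> j \<in> K \<and> j < i} \<inter> {(i, j). i \<in> J \<and> j \<in> K \<and> j < i} = {}"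
    using assms by auto
  ultimately show ?thesis
    by (simp add: shuffle_sign_def card_Un_disjoint power_add)
qed

lemma shuffle_sign_Un_right:
  assumes "J \<inter> K = {}"
  shows "shuffle_sign I (J \<union> K) = shuffle_sign I J * shuffle_sign I K"
proof -
  have "{(i, j). i \<in> I \<and> j \<in> J \<union> K \<and> j < i} =
      {(i, j). i \<in> I \<and> j \<in> J \<and> j < i} \<union> {(i, j). i \<in> I \<and> j \<in> K \<and> j < i}"
    by auto
  moreover have "{(i, j). i \<in> I \<and> j \<in> J \<and> j < i} \<inter> {(i, j). i \<in> I \<and> j \<in> K \<and> j < i} = {}"
    using assms by auto
  ultimately show ?thesis
    by (simp add: shuffle_sign_def card_Un_disjoint power_add)
qed

lemma shuffle_sign_empty [simp]: "shuffle_sign {} J = 1" "shuffle_sign I {} = 1"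
  by (simp_all add: shuffle_sign_def)

lemma shuffle_sign_square [simp]: "shuffle_sign I J * shuffle_sign I J = 1"
  by (simp add: shuffle_sign_def flip: power_add)

lemma shuffle_sign_square_left [simp]: "shuffle_sign I J * (shuffle_sign I J * x) = x"
  by (simp flip: mult.assoc)

lemma shuffle_sign_singletons: "shuffle_sign {i} {j} = (if j < i then -1 else 1)"
proof -
  have "{(a, b). a \<in> {i} \<and> b \<in> {j} \<and> b < a} = (if j < i then {(i, j)} else {})"
    by auto
  then show ?thesis by (simp add: shuffle_sign_def)
qed

text \<open>Each pair formed by \<open>i\<close> and an element of \<open>K\<close> is an inversion
  in exactly one of the two orders.\<close>

lemma shuffle_sign_commute:
  assumes "i \<notin> K"
  shows "shuffle_sign K {i} = (-1) ^ card K * shuffle_sign {i} K"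
  using finite[of K] assms
proof (induction K rule: finite_induct)
  case (insert j K)
  have "shuffle_sign (insert j K) {i} = shuffle_sign {j} {i} * shuffle_sign K {i}"
    using shuffle_sign_Un_left[of "{j}" K "{i}"] insert.hyps by simp
  moreover have "shuffle_sign {i} (insert j K) = shuffle_sign {i} {j} * shuffle_sign {i} K"
    using shuffle_sign_Un_right[of "{j}" K "{i}"] insert.hyps by simp
  ultimately show ?case
    using insert by (auto simp: shuffle_sign_singletons)
qed simp

section \<open>Linearity, coefficients and commutation rules of wedge product and
  contraction\<close>

lemma bilinear_wedge: "bilinear (\<and>\<^sub>f)"
  unfolding bilinear_def
  by (intro conjI allI linearI)
    (simp_all add: vec_eq_iff wedge_def sum.distrib sum_distrib_left distrib_left distrib_right mult_ac)

lemmas wedge_add_left = bilinear_ladd[OF bilinear_wedge]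
  and wedge_add_right = bilinear_radd[OF bilinear_wedge]
  and wedge_diff_left = bilinear_lsub[OF bilinear_wedge]
  and wedge_diff_right = bilinear_rsub[OF bilinear_wedge]
  and wedge_minus_left = bilinear_lneg[OF bilinear_wedge]
  and wedge_minus_right = bilinear_rneg[OF bilinear_wedge]
  and wedge_scaleR_left = bilinear_lmul[OF bilinear_wedge]
  and wedge_scaleR_right = bilinear_rmul[OF bilinear_wedge]
  and wedge_zero_left [simp] = bilinear_lzero[OF bilinear_wedge]
  and wedge_zero_right [simp] = bilinear_rzero[OF bilinear_wedge]

lemma bilinear_ins: "bilinear ins"
  unfolding bilinear_def
  by (intro conjI allI linearI)
    (simp_all add: vec_eq_iff ins_def sum.distrib sum_distrib_left distrib_left distrib_right mult_ac)

lemmas ins_add_right = bilinear_radd[OF bilinear_ins]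
  and ins_diff_left = bilinear_lsub[OF bilinear_ins]
  and ins_diff_right = bilinear_rsub[OF bilinear_ins]
  and ins_minus_right = bilinear_rneg[OF bilinear_ins]
  and ins_scaleR_left = bilinear_lmul[OF bilinear_ins]
  and ins_scaleR_right = bilinear_rmul[OF bilinear_ins]
  and ins_zero_left [simp] = bilinear_lzero[OF bilinear_ins]
  and ins_zero_right [simp] = bilinear_rzero[OF bilinear_ins]

lemma linear_wedge_right: "linear (\<lambda>\<beta>. \<alpha> \<and>\<^sub>f \<beta>)"
  and linear_wedge_left: "linear (\<lambda>\<alpha>. \<alpha> \<and>\<^sub>f \<beta>)"
  and linear_ins: "linear (\<lambda>\<beta>. ins v \<beta>)"
  and linear_ins_left: "linear (\<lambda>v. ins v \<beta>)"
  using bilinear_wedge bilinear_ins by (auto simp: bilinear_def)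

lemmas wedge_sum_right = linear_sum[OF linear_wedge_right]
  and ins_sum_left = linear_sum[OF linear_ins_left]
  and ins_sum_right = linear_sum[OF linear_ins]

lemma ins_axis_nth:
  "ins (axis k 1) \<alpha> $ I = (if k \<in> I then 0 else shuffle_sign {k} I * \<alpha> $ insert k I)"
proof -
  have "ins (axis k 1) \<alpha> $ I =
      (\<Sum>i\<in>-I. if i = k then shuffle_sign {k} I * \<alpha> $ insert k I else 0)"
    unfolding ins_def vec_lambda_beta by (intro sum.cong) (auto simp: axis_def)
  then show ?thesis by simp
qed

lemma ins_eq_sum: "ins v \<alpha> = (\<Sum>k\<in>UNIV. v $ k *\<^sub>R ins (axis k 1) \<alpha>)"
proof -
  have "v = (\<Sum>k\<in>UNIV. v $ k *\<^sub>R axis k 1)"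
    using basis_expansion[of v] by (simp add: scalar_mult_eq_scaleR)
  then have "ins v \<alpha> = ins (\<Sum>k\<in>UNIV. v $ k *\<^sub>R axis k 1) \<alpha>"
    by simp
  then show ?thesis
    by (simp add: ins_sum_left ins_scaleR_left)
qed

lemma covec_wedge_nth:
  "(covec i \<and>\<^sub>f \<beta>) $ K = (if i \<in> K then shuffle_sign {i} (K - {i}) * \<beta> $ (K - {i}) else 0)"
proof -
  have "(covec i \<and>\<^sub>f \<beta>) $ K =
      (\<Sum>I\<in>Pow K. if I = {i} then shuffle_sign {i} (K - {i}) * \<beta> $ (K - {i}) else 0)"
    unfolding wedge_def vec_lambda_beta covec_def by (intro sum.cong) (auto simp: axis_def)
  then show ?thesis by (simp add: sum.delta)
qed

lemma one_wedge [simp]: "axis {} 1 \<and>\<^sub>f \<beta> = \<beta>"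
proof -
  have "(axis {} 1 \<and>\<^sub>f \<beta>) $ K = (\<Sum>I\<in>Pow K. if I = {} then \<beta> $ K else 0)" for K
    unfolding wedge_def vec_lambda_beta by (intro sum.cong) (auto simp: axis_def)
  then show ?thesis by (simp add: vec_eq_iff sum.delta)
qed

lemma wedge_axis:
  "axis I 1 \<and>\<^sub>f axis J 1 = (if I \<inter> J = {} then shuffle_sign I J *\<^sub>R axis (I \<union> J) 1 else 0)"
proof -
  have "(axis I 1 \<and>\<^sub>f axis J 1) $ K =
      (\<Sum>I'\<in>Pow K. if I' = I then shuffle_sign I (K - I) * (axis J 1 :: form) $ (K - I) else 0)" for K
    unfolding wedge_def vec_lambda_beta by (intro sum.cong) (auto simp: axis_def)
  moreover have "I \<subseteq> K \<and> J = K - I \<longleftrightarrow> I \<inter> J = {} \<and> K = I \<union> J" for K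
    by auto
  ultimately show ?thesis
    by (auto simp: vec_eq_iff sum.delta axis_def)
qed

lemma wedge_one [simp]: "\<beta> \<and>\<^sub>f axis {} 1 = \<beta>"
proof -
  have "(\<lambda>\<beta>. \<beta> \<and>\<^sub>f axis {} 1) = (\<lambda>\<beta>. \<beta>)"
    by (rule linear_eq_stdbasis) (auto simp: linear_wedge_left linear_id[unfolded id_def]
        Basis_vec_def wedge_axis)
  then show ?thesis by metis
qed

text \<open>As \<open>form\<close> records no degree, the sign for moving a covector past a form has
  to be an operator on all forms at once.\<close>

definition grade_inv :: "form \<Rightarrow> form" where
  "grade_inv \<alpha> = (\<chi> I. (-1) ^ card I * \<alpha> $ I)"

lemma linear_grade_inv: "linear grade_inv"
  by (rule linearI) (simp_all add: grade_inv_def vec_eq_iff algebra_simps)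

lemma grade_inv_axis: "grade_inv (axis I 1) = (-1) ^ card I *\<^sub>R axis I 1"
  by (simp add: grade_inv_def vec_eq_iff axis_def)

lemma grade_inv_covec_wedge: "grade_inv (covec i \<and>\<^sub>f \<alpha>) = - (covec i \<and>\<^sub>f grade_inv \<alpha>)"
proof -
  have "(-1 :: real) ^ card K = - ((-1) ^ card (K - {i}))" if "i \<in> K" for K
    using card.remove[OF finite that] by simp
  then show ?thesis
    by (simp add: vec_eq_iff grade_inv_def covec_wedge_nth)
qed

lemma grade_inv_ins: "grade_inv (ins v \<alpha>) = - ins v (grade_inv \<alpha>)"
proof -
  have "grade_inv (ins (axis k 1) \<alpha>) = - ins (axis k 1) (grade_inv \<alpha>)" for k
    by (simp add: vec_eq_iff grade_inv_def ins_axis_nth)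
  then show ?thesis
    unfolding ins_eq_sum[of v]
    by (simp add: linear_sum[OF linear_grade_inv] linear_cmul[OF linear_grade_inv] sum_negf)
qed

lemma covec_wedge_assoc: "(covec i \<and>\<^sub>f \<alpha>) \<and>\<^sub>f \<beta> = covec i \<and>\<^sub>f (\<alpha> \<and>\<^sub>f \<beta>)"
proof -
  have "(\<lambda>\<alpha> \<beta>. (covec i \<and>\<^sub>f \<alpha>) \<and>\<^sub>f \<beta>) = (\<lambda>\<alpha> \<beta>. covec i \<and>\<^sub>f (\<alpha> \<and>\<^sub>f \<beta>))"
  proof (rule bilinear_eq_stdbasis)
    show "bilinear (\<lambda>\<alpha> \<beta>. (covec i \<and>\<^sub>f \<alpha>) \<and>\<^sub>f \<beta>)" "bilinear (\<lambda>\<alpha> \<beta>. covec i \<and>\<^sub>f (\<alpha> \<and>\<^sub>f \<beta>))"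
      by (auto simp: bilinear_def wedge_add_left wedge_add_right wedge_scaleR_left wedge_scaleR_right
          intro!: linearI)
    fix a b :: form assume "a \<in> Basis" "b \<in> Basis"
    then obtain I J where "a = axis I 1" "b = axis J 1" by (auto simp: Basis_vec_def)
    moreover have "(covec i \<and>\<^sub>f axis I 1) \<and>\<^sub>f axis J 1 = covec i \<and>\<^sub>f (axis I 1 \<and>\<^sub>f axis J 1)"
      using shuffle_sign_Un_left[of "{i}" I J] shuffle_sign_Un_right[of I J "{i}"]
      by (auto simp: covec_def wedge_axis wedge_scaleR_left wedge_scaleR_right)
    ultimately show "(covec i \<and>\<^sub>f a) \<and>\<^sub>f b = covec i \<and>\<^sub>f (a \<and>\<^sub>f b)" by simp
  qed
  then show ?thesis by metis
qed

lemma wedge_covec_wedge: "\<alpha> \<and>\<^sub>f (covec i \<and>\<^sub>f \<beta>) = covec i \<and>\<^sub>f (grade_inv \<alpha> \<and>\<^sub>f \<beta>)"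
proof -
  have "(\<lambda>\<alpha> \<beta>. \<alpha> \<and>\<^sub>f (covec i \<and>\<^sub>f \<beta>)) = (\<lambda>\<alpha> \<beta>. covec i \<and>\<^sub>f (grade_inv \<alpha> \<and>\<^sub>f \<beta>))"
  proof (rule bilinear_eq_stdbasis)
    show "bilinear (\<lambda>\<alpha> \<beta>. \<alpha> \<and>\<^sub>f (covec i \<and>\<^sub>f \<beta>))" "bilinear (\<lambda>\<alpha> \<beta>. covec i \<and>\<^sub>f (grade_inv \<alpha> \<and>\<^sub>f \<beta>))"
      by (auto simp: bilinear_def wedge_add_left wedge_add_right wedge_scaleR_left wedge_scaleR_right
          linear_add[OF linear_grade_inv] linear_cmul[OF linear_grade_inv] intro!: linearI)
    fix a b :: form assume "a \<in> Basis" "b \<in> Basis"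
    then obtain I J where "a = axis I 1" "b = axis J 1" by (auto simp: Basis_vec_def)
    moreover have "axis I 1 \<and>\<^sub>f (covec i \<and>\<^sub>f axis J 1) = covec i \<and>\<^sub>f (grade_inv (axis I 1) \<and>\<^sub>f axis
        J 1)"
      using shuffle_sign_Un_right[of "{i}" J I] shuffle_sign_Un_right[of I J "{i}"]
          shuffle_sign_commute[of i I]
      by (auto simp: covec_def wedge_axis wedge_scaleR_left wedge_scaleR_right grade_inv_axis
          Un_left_commute)
    ultimately show "a \<and>\<^sub>f (covec i \<and>\<^sub>f b) = covec i \<and>\<^sub>f (grade_inv a \<and>\<^sub>f b)" by simp
  qed
  then show ?thesis by metis
qed

lemma covec_wedge_anticommute: "covec i \<and>\<^sub>f (covec j \<and>\<^sub>f \<alpha>) = - (covec j \<and>\<^sub>f (covec i \<and>\<^sub>f \<alpha>))"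
  using wedge_covec_wedge[of "covec i" j \<alpha>] covec_wedge_assoc[of j "covec i" \<alpha>]
  by (simp add: covec_def grade_inv_axis wedge_minus_left wedge_minus_right)

lemma covec_wedge_self [simp]: "covec i \<and>\<^sub>f (covec i \<and>\<^sub>f \<alpha>) = 0"
  using covec_wedge_anticommute[of i i \<alpha>] by (simp add: eq_neg_iff_add_eq_0 flip: scaleR_2)

text \<open>Contraction is an antiderivation. For basis vectors with \<open>k\<close> and
  \<open>j\<close> distinct, the minus sign comes from this pair being an inversion in only one of
  its two orders; general \<open>v\<close> follows by linearity.\<close>

lemma ins_covec_wedge: "ins v (covec j \<and>\<^sub>f \<beta>) = v $ j *\<^sub>R \<beta> - covec j \<and>\<^sub>f ins v \<beta>"
proof -
  have *: "ins (axis k 1) (covec j \<and>\<^sub>f \<beta>) = (if k = j then \<beta> else 0) - covec j \<and>\<^sub>f ins (axis k 1) \<beta>"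
      for k
  proof (cases "k = j")
    case True
    have "(ins (axis k 1) (covec j \<and>\<^sub>f \<beta>)) $ I = \<beta> $ I - (covec j \<and>\<^sub>f ins (axis k 1) \<beta>) $ I" for I
      using True by (auto simp: ins_axis_nth covec_wedge_nth insert_absorb)
    then show ?thesis using True by (simp add: vec_eq_iff)
  next
    case False
    have "(ins (axis k 1) (covec j \<and>\<^sub>f \<beta>)) $ I = - (covec j \<and>\<^sub>f ins (axis k 1) \<beta>) $ I" for I
    proof (cases "k \<notin> I \<and> j \<in> I")
      case True
      define J where "J = I - {j}"
      have J: "I = insert j J" "j \<notin> J" "k \<notin> J" using True by (auto simp: J_def)
      have "shuffle_sign {k} (insert j J) = shuffle_sign {k} {j} * shuffle_sign {k} J"
        "shuffle_sign {j} (insert k J) = shuffle_sign {j} {k} * shuffle_sign {j} J"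
        using shuffle_sign_Un_right[of "{j}" J "{k}"] shuffle_sign_Un_right[of "{k}" J "{j}"] J by
            simp_all
      then show ?thesis using J False
        by (auto simp: ins_axis_nth covec_wedge_nth shuffle_sign_singletons insert_Diff_if
            insert_commute)
    qed (use False in \<open>auto simp: ins_axis_nth covec_wedge_nth\<close>)
    then show ?thesis using False by (simp add: vec_eq_iff)
  qed
  have "ins v (covec j \<and>\<^sub>f \<beta>) =
      (\<Sum>k\<in>UNIV. (if k = j then v $ j *\<^sub>R \<beta> else 0) - covec j \<and>\<^sub>f (v $ k *\<^sub>R ins (axis k 1) \<beta>))"
    unfolding ins_eq_sum[of v] * by (intro sum.cong) (auto simp: algebra_simps wedge_scaleR_right)
  then show ?thesis
    unfolding ins_eq_sum[of v \<beta>] by (simp add: sum_subtractf wedge_sum_right)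
qed

lemma ins_ins_anticommute: "ins v (ins w \<alpha>) = - ins w (ins v \<alpha>)"
proof -
  have *: "ins (axis k 1) (ins (axis j 1) \<alpha>) = - ins (axis j 1) (ins (axis k 1) \<alpha>)" for k j
  proof (cases "k = j")
    case False
    have "ins (axis k 1) (ins (axis j 1) \<alpha>) $ I = - ins (axis j 1) (ins (axis k 1) \<alpha>) $ I" for I
      using shuffle_sign_Un_right[of "{j}" I "{k}"] shuffle_sign_Un_right[of "{k}" I "{j}"] False
      by (auto simp: ins_axis_nth shuffle_sign_singletons insert_commute)
    then show ?thesis by (simp add: vec_eq_iff)
  qed (simp add: vec_eq_iff ins_axis_nth)
  have "ins v (ins w \<alpha>) = (\<Sum>k\<in>UNIV. \<Sum>j\<in>UNIV. (v $ k * w $ j) *\<^sub>R ins (axis k 1) (ins (axis j 1) \<alpha>))"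
    unfolding ins_eq_sum[of v] ins_eq_sum[of w] by (simp add: ins_sum_right ins_scaleR_right
        scaleR_sum_right)
  also have "\<dots> = - (\<Sum>j\<in>UNIV. \<Sum>k\<in>UNIV. (w $ j * v $ k) *\<^sub>R ins (axis j 1) (ins (axis k 1) \<alpha>))"
    by (subst sum.swap, subst *) (simp add: sum_negf mult.commute)
  also have "\<dots> = - ins w (ins v \<alpha>)"
    unfolding ins_eq_sum[of v] ins_eq_sum[of w] by (simp add: ins_sum_right ins_scaleR_right
        scaleR_sum_right)
  finally show ?thesis .
qed

lemma ins_ins_self [simp]: "ins v (ins v \<alpha>) = 0"
  using ins_ins_anticommute[of v v \<alpha>] by (simp add: eq_neg_iff_add_eq_0 flip: scaleR_2)

lemma linear_hodge: "linear hodge"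
  by (rule linearI) (simp_all add: hodge_def vec_eq_iff algebra_simps)

text \<open>The Hodge operator exchanges exterior multiplication and contraction. This makes it
  computable one wedge factor at a time.\<close>

lemma hodge_covec_wedge: "hodge (covec i \<and>\<^sub>f \<alpha>) = ins (axis i 1) (hodge (grade_inv \<alpha>))"
proof -
  have "hodge (covec i \<and>\<^sub>f \<alpha>) $ J = ins (axis i 1) (hodge (grade_inv \<alpha>)) $ J" for J
  proof (cases "i \<in> J")
    case False
    define K where "K = - J - {i}"
    have K: "- J = insert i K" "i \<notin> K" "K = - insert i J" using False by (auto simp: K_def)
    have "shuffle_sign (insert i K) J = shuffle_sign {i} J * shuffle_sign K J"
      "shuffle_sign K (insert i J) = shuffle_sign K {i} * shuffle_sign K J"
      using shuffle_sign_Un_left[of "{i}" K J] shuffle_sign_Un_right[of "{i}" J K] False K(2) by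
          simp_all
    moreover have "- insert i J = K" using K(3) by simp
    ultimately show ?thesis using False K(1,2)
      by (simp add: hodge_def covec_wedge_nth ins_axis_nth grade_inv_def shuffle_sign_commute)
  qed (simp add: hodge_def covec_wedge_nth ins_axis_nth)
  then show ?thesis by (simp add: vec_eq_iff)
qed

lemma axis_nth_if: "axis i x $ j = (if i = j then x else 0)"
  by (simp add: axis_def)


section \<open>The operators sigma\<close>

lemma ins_basis_empty [simp]: "ins_basis {} \<alpha> = \<alpha>"
  by (simp add: ins_basis_def)

text \<open>The smallest index heads the sorted list and is therefore contracted last, on the
  outside.\<close>

lemma ins_basis_insert:
  assumes "\<And>i. i \<in> S \<Longrightarrow> m < i"
  shows "ins_basis (insert m S) \<alpha> = ins (axis m 1) (ins_basis S \<alpha>)"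
proof -
  have "m \<notin> S" using assms by blast
  then have "sorted_list_of_set (insert m S) = insort m (sorted_list_of_set S)"
    by simp
  also have "\<dots> = m # sorted_list_of_set S"
    using assms by (intro insort_is_Cons) (auto intro: less_imp_le)
  finally have "sorted_list_of_set (insert m S) = m # sorted_list_of_set S" .
  then show ?thesis by (simp add: ins_basis_def)
qed

lemma linear_ins_basis: "linear (ins_basis S)"
proof -
  have "linear (\<lambda>\<alpha>. foldr (\<lambda>i. ins (axis i 1)) xs \<alpha>)" for xs :: "8 list"
    by (induction xs) (auto intro: linear_compose[OF _ linear_ins, unfolded o_def]
        linear_id[unfolded id_def])
  then show ?thesis by (simp add: ins_basis_def[abs_def])
qed

lemma ins_basis_ins:
  "ins_basis S (ins v \<alpha>) = (-1) ^ card S *\<^sub>R ins v (ins_basis S \<alpha>)"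
proof -
  have "foldr (\<lambda>i. ins (axis i 1)) xs (ins v \<alpha>) =
      (-1) ^ length xs *\<^sub>R ins v (foldr (\<lambda>i. ins (axis i 1)) xs \<alpha>)" for xs :: "8 list"
    by (induction xs) (auto simp: ins_scaleR_right ins_minus_right ins_ins_anticommute[of _ v])
  from this[of "sorted_list_of_set S"] show ?thesis
    by (simp add: ins_basis_def)
qed

lemma grade_inv_ins_basis:
  "grade_inv (ins_basis S \<alpha>) = (-1) ^ card S *\<^sub>R ins_basis S (grade_inv \<alpha>)"
proof -
  have "grade_inv (foldr (\<lambda>i. ins (axis i 1)) xs \<alpha>) =
      (-1) ^ length xs *\<^sub>R foldr (\<lambda>i. ins (axis i 1)) xs (grade_inv \<alpha>)" for xs :: "8 list"
    by (induction xs) (auto simp: ins_scaleR_right ins_minus_right grade_inv_ins)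
  from this[of "sorted_list_of_set S"] show ?thesis
    by (simp add: ins_basis_def)
qed

lemma ins_basis_covec_wedge:
  assumes "m \<notin> S"
  shows "ins_basis S (covec m \<and>\<^sub>f \<alpha>) = (-1) ^ card S *\<^sub>R (covec m \<and>\<^sub>f ins_basis S \<alpha>)"
proof -
  have "foldr (\<lambda>i. ins (axis i 1)) xs (covec m \<and>\<^sub>f \<alpha>) =
      (-1) ^ length xs *\<^sub>R (covec m \<and>\<^sub>f foldr (\<lambda>i. ins (axis i 1)) xs \<alpha>)"
    if "m \<notin> set xs" for xs
    using that
    by (induction xs) (auto simp: ins_scaleR_right ins_minus_right ins_covec_wedge axis_def)
  from this[of "sorted_list_of_set S"] show ?thesis
    using assms by (simp add: ins_basis_def)
qed

lemma ins_basis_one: "ins_basis S (axis {} 1) = (if S = {} then axis {} 1 else 0)"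
proof -
  have "foldr (\<lambda>i. ins (axis i 1)) xs (axis {} 1) = (if xs = [] then axis {} 1 else (0 :: form))" for xs
  proof (induction xs)
    case (Cons x xs)
    have "ins (axis x 1) (axis {} 1) = 0"
      by (simp add: vec_eq_iff ins_axis_nth) (simp add: axis_def)
    with Cons show ?case by simp
  qed simp
  then show ?thesis by (simp add: ins_basis_def)
qed

text \<open>Restricting the contracted indices to \<open>A\<close> allows recursion on the number of
  available basis vectors, one level of a trie at a time.\<close>

definition sigma_on :: "8 set \<Rightarrow> nat \<Rightarrow> form \<Rightarrow> form \<Rightarrow> form" where
  "sigma_on A j \<alpha> \<beta> = (\<Sum>S | S \<subseteq> A \<and> card S = j. ins_basis S \<alpha> \<and>\<^sub>f ins_basis S \<beta>)"

lemma sigma_on_UNIV: "sigma_on UNIV j = sigma j"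
  by (simp add: fun_eq_iff sigma_on_def sigma_def)

lemma bilinear_sigma_on: "bilinear (sigma_on A j)"
  unfolding bilinear_def
  by (intro conjI allI linearI)
    (simp_all add: sigma_on_def sum.distrib linear_add[OF linear_ins_basis] linear_cmul[OF
        linear_ins_basis]
      wedge_add_left wedge_add_right wedge_scaleR_left wedge_scaleR_right scaleR_sum_right)

lemmas sigma_on_add_left = bilinear_ladd[OF bilinear_sigma_on]
  and sigma_on_add_right = bilinear_radd[OF bilinear_sigma_on]
  and sigma_on_scaleR_left = bilinear_lmul[OF bilinear_sigma_on]
  and sigma_on_scaleR_right = bilinear_rmul[OF bilinear_sigma_on]
  and sigma_on_minus_left = bilinear_lneg[OF bilinear_sigma_on]
  and sigma_on_zero_left [simp] = bilinear_lzero[OF bilinear_sigma_on]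
  and sigma_on_zero_right [simp] = bilinear_rzero[OF bilinear_sigma_on]

lemma bilinear_sigma: "bilinear (sigma j)"
  using bilinear_sigma_on[of UNIV j] by (simp add: sigma_on_UNIV)

lemmas sigma_add_left = bilinear_ladd[OF bilinear_sigma]
  and sigma_add_right = bilinear_radd[OF bilinear_sigma]
  and sigma_diff_left = bilinear_lsub[OF bilinear_sigma]
  and sigma_diff_right = bilinear_rsub[OF bilinear_sigma]
  and sigma_scaleR_left = bilinear_lmul[OF bilinear_sigma]
  and sigma_scaleR_right = bilinear_rmul[OF bilinear_sigma]
  and sigma_minus_left = bilinear_lneg[OF bilinear_sigma]
  and sigma_minus_right = bilinear_rneg[OF bilinear_sigma]
  and sigma_zero_left [simp] = bilinear_lzero[OF bilinear_sigma]
  and sigma_zero_right [simp] = bilinear_rzero[OF bilinear_sigma]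

lemma linear_sigma_right: "linear (\<lambda>\<beta>. sigma j \<alpha> \<beta>)"
  and linear_sigma_left: "linear (\<lambda>\<alpha>. sigma j \<alpha> \<beta>)"
  using bilinear_sigma by (auto simp: bilinear_def)

lemma sigma_on_one_left: "sigma_on A j (axis {} 1) \<beta> = (if j = 0 then \<beta> else 0)"
proof -
  have "sigma_on A j (axis {} 1) \<beta> = (\<Sum>S | S \<subseteq> A \<and> card S = j. if S = {} then \<beta> else 0)"
    unfolding sigma_on_def by (intro sum.cong) (auto simp: ins_basis_one)
  then show ?thesis by (auto simp: sum.delta)
qed

lemma sigma_on_one_right: "sigma_on A j \<beta> (axis {} 1) = (if j = 0 then \<beta> else 0)"
proof -
  have "sigma_on A j \<beta> (axis {} 1) = (\<Sum>S | S \<subseteq> A \<and> card S = j. if S = {} then \<beta> else 0)"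
    unfolding sigma_on_def by (intro sum.cong) (auto simp: ins_basis_one)
  then show ?thesis by (auto simp: sum.delta)
qed

lemma sigma_on_covec_wedge_left:
  assumes "m \<notin> A"
  shows "sigma_on A j (covec m \<and>\<^sub>f \<alpha>) \<beta> = (-1) ^ j *\<^sub>R (covec m \<and>\<^sub>f sigma_on A j \<alpha> \<beta>)"
proof -
  have "m \<notin> S" if "S \<subseteq> A" for S using that assms by auto
  then show ?thesis
    unfolding sigma_on_def wedge_sum_right scaleR_sum_right
    by (intro sum.cong) (auto simp: ins_basis_covec_wedge wedge_scaleR_left covec_wedge_assoc)
qed

text \<open>No contraction hits the index \<open>m\<close>. The signs (-1)^j from passing
  \<open>m\<close> through the contractions of the right factor and from regrading those of the left
  factor cancel, which leaves \<open>grade_inv\<close> on the left argument.\<close>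

lemma sigma_on_covec_wedge_right:
  assumes "m \<notin> A"
  shows "sigma_on A j \<alpha> (covec m \<and>\<^sub>f \<beta>) = covec m \<and>\<^sub>f sigma_on A j (grade_inv \<alpha>) \<beta>"
proof -
  have "m \<notin> S" if "S \<subseteq> A" for S using that assms by auto
  then show ?thesis
    unfolding sigma_on_def wedge_sum_right
    by (intro sum.cong) (auto simp: ins_basis_covec_wedge wedge_scaleR_right wedge_covec_wedge
        grade_inv_ins_basis wedge_scaleR_left simp flip: power_mult_distrib)
qed

text \<open>Split the index sets by whether they contain \<open>m\<close>. Moving the contraction by
  \<open>m\<close> to the inside produces the same sign in both factors, so it drops out.\<close>

lemma sigma_on_insert:
  assumes "\<And>i. i \<in> A \<Longrightarrow> m < i"
  shows "sigma_on (insert m A) j \<alpha> \<beta> = sigma_on A j \<alpha> \<beta> +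
    (if j = 0 then 0 else sigma_on A (j - 1) (ins (axis m 1) \<alpha>) (ins (axis m 1) \<beta>))"
proof -
  let ?f = "\<lambda>S. ins_basis S \<alpha> \<and>\<^sub>f ins_basis S \<beta>"
  have m: "m \<notin> A" using assms by auto
  have insert: "ins_basis (insert m S) \<gamma> = ins (axis m 1) (ins_basis S \<gamma>)" if "S \<subseteq> A" for S \<gamma>
    by (rule ins_basis_insert) (use that assms in blast)
  have split: "{S. S \<subseteq> insert m A \<and> card S = j} =
      {S. S \<subseteq> A \<and> card S = j} \<union> insert m ` {S. S \<subseteq> A \<and> Suc (card S) = j}"
  proof (intro equalityI subsetI)
    fix S assume S: "S \<in> {S. S \<subseteq> insert m A \<and> card S = j}"
    show "S \<in> {S. S \<subseteq> A \<and> card S = j} \<union> insert m ` {S. S \<subseteq> A \<and> Suc (card S) = j}"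
    proof (cases "m \<in> S")
      case True
      then have "S = insert m (S - {m})" by blast
      moreover have "Suc (card (S - {m})) = j"
        using S card_Suc_Diff1[OF finite True] by blast
      moreover have "S - {m} \<subseteq> A" using S by blast
      ultimately show ?thesis by blast
    qed (use S in auto)
  next
    fix S assume "S \<in> {S. S \<subseteq> A \<and> card S = j} \<union> insert m ` {S. S \<subseteq> A \<and> Suc (card S) = j}"
    moreover have "m \<notin> T" if "T \<subseteq> A" for T using that m by auto
    ultimately show "S \<in> {S. S \<subseteq> insert m A \<and> card S = j}" by auto
  qed
  have "sigma_on (insert m A) j \<alpha> \<beta> = sigma_on A j \<alpha> \<beta> +
      (\<Sum>S\<in>insert m ` {S. S \<subseteq> A \<and> Suc (card S) = j}. ?f S)"
    unfolding sigma_on_def split using m by (intro sum.union_disjoint) auto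
  also have "(\<Sum>S\<in>insert m ` {S. S \<subseteq> A \<and> Suc (card S) = j}. ?f S) =
      (\<Sum>S | S \<subseteq> A \<and> Suc (card S) = j. ?f (insert m S))"
    using m by (intro sum.reindex[unfolded o_def] inj_onI) (auto simp: insert_ident)
  also have "\<dots> = (\<Sum>S | S \<subseteq> A \<and> Suc (card S) = j.
      ins_basis S (ins (axis m 1) \<alpha>) \<and>\<^sub>f ins_basis S (ins (axis m 1) \<beta>))"
    by (intro sum.cong refl) (auto simp: insert ins_basis_ins wedge_scaleR_left wedge_scaleR_right
        simp flip: power_mult_distrib)
  finally show ?thesis
    by (cases j) (simp_all add: sigma_on_def)
qed


section \<open>Binary tries\<close>

text \<open>Forms with rational coefficients in the basis \<open>e\<^sub>1, \<dots>, e\<^sub>7, \<surd>3 e\<^sub>8\<close> (for which \<^const>\<open>rho0\<close>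
  has integral coefficients) are computed with symbolically: \<open>Node s t\<close> at level \<open>d\<close> stands for
  \<open>s + e \<and> t\<close> with \<open>e\<close> the basis vector number \<open>9 - d\<close>.\<close>

datatype trie = Zero | Leaf int | Node trie trie

text \<open>Counting downwards puts the smallest index into the outermost node: wedging with it
  costs no sign, and the recursion for \<open>sigma_on\<close> splits off just this index.\<close>

definition idx :: "nat \<Rightarrow> 8" where
  "idx d = of_nat (7 - d)"

definition wt :: "nat \<Rightarrow> real" where
  "wt d = (if d = 0 then sqrt 3 else 1)"

definition wt2 :: "nat \<Rightarrow> int" where
  "wt2 d = (if d = 0 then 3 else 1)"

lemma wt_square: "wt d * wt d = of_int (wt2 d)"
  by (simp add: wt_def wt2_def)

lemma wt_nonzero [simp]: "wt d \<noteq> 0"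
  by (simp add: wt_def)

text \<open>A node at level 0 has no basis vector left and loses its second component. The
  operations on tries follow this convention, so their soundness needs no well-formedness
  condition.\<close>

primrec form_of :: "nat \<Rightarrow> trie \<Rightarrow> form" where
  "form_of d Zero = 0"
| "form_of d (Leaf c) = of_int c *\<^sub>R axis {} 1"
| "form_of d (Node s t) = (case d of 0 \<Rightarrow> form_of 0 s
     | Suc d' \<Rightarrow> form_of d' s + wt d' *\<^sub>R (covec (idx d') \<and>\<^sub>f form_of d' t))"

lemma idx_less_iff: "i < 8 \<Longrightarrow> j < 8 \<Longrightarrow> idx i < idx j \<longleftrightarrow> j < i"
  unfolding idx_def by (subst of_nat_8_less_iff) auto

lemma idx_eq_iff: "i < 8 \<Longrightarrow> j < 8 \<Longrightarrow> idx i = idx j \<longleftrightarrow> i = j"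
  using idx_less_iff[of i j] idx_less_iff[of j i] by (metis less_irrefl linorder_neqE_nat)

lemma idx_image: "idx ` {..<8} = UNIV"
proof -
  have "card (idx ` {..<8}) = CARD(8)"
    by (subst card_image) (auto intro!: inj_onI simp: idx_eq_iff)
  then show ?thesis by (intro card_subset_eq) auto
qed

lemma ins_form_of_upper: "d \<le> i \<Longrightarrow> i < 8 \<Longrightarrow> ins (axis (idx i) 1) (form_of d t) = 0"
proof (induction t arbitrary: d)
  case (Leaf c)
  have "ins (axis (idx i) 1) (axis {} 1) = 0"
    using ins_basis_one[of "{idx i}"] by (simp add: ins_basis_def)
  then show ?case by (simp add: ins_scaleR_right)
next
  case (Node s t)
  then show ?case
    by (cases d) (auto simp: ins_add_right ins_scaleR_right ins_covec_wedge idx_eq_iff axis_def)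
qed simp

text \<open>Collapsing empty pairs keeps the tries sparse during evaluation.\<close>

fun node :: "trie \<Rightarrow> trie \<Rightarrow> trie" where
  "node Zero Zero = Zero"
| "node s t = Node s t"

lemma form_of_node [simp]: "form_of d (node s t) = form_of d (Node s t)"
  by (cases "(s, t)" rule: node.cases) (auto split: nat.split)

fun trie_add :: "trie \<Rightarrow> trie \<Rightarrow> trie" where
  "trie_add Zero t = t"
| "trie_add s Zero = s"
| "trie_add (Leaf a) (Leaf b) = (let c = a + b in if c = 0 then Zero else Leaf c)"
| "trie_add (Leaf a) (Node s t) = node (trie_add (Leaf a) s) t"
| "trie_add (Node s t) (Leaf a) = node (trie_add s (Leaf a)) t"
| "trie_add (Node s t) (Node s' t') = node (trie_add s s') (trie_add t t')"

lemma form_of_add: "form_of d (trie_add s t) = form_of d s + form_of d t"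
proof (induction s t arbitrary: d rule: trie_add.induct)
  case (3 a b)
  then show ?case by (auto simp: Let_def algebra_simps simp flip: scaleR_add_left of_int_add)
qed (auto simp: wedge_add_right scaleR_add_right split: nat.split)

fun trie_scale :: "int \<Rightarrow> trie \<Rightarrow> trie" where
  "trie_scale k Zero = Zero"
| "trie_scale k (Leaf a) = Leaf (k * a)"
| "trie_scale k (Node s t) = Node (trie_scale k s) (trie_scale k t)"

lemma form_of_scale: "form_of d (trie_scale k t) = of_int k *\<^sub>R form_of d t"
  by (induction t arbitrary: d) (auto simp: wedge_scaleR_right scaleR_add_right split: nat.split)

fun trie_neg :: "trie \<Rightarrow> trie" where
  "trie_neg Zero = Zero"
| "trie_neg (Leaf a) = Leaf (- a)"
| "trie_neg (Node s t) = Node (trie_neg s) (trie_neg t)"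

lemma form_of_neg: "form_of d (trie_neg t) = - form_of d t"
  by (induction t arbitrary: d) (auto simp: wedge_minus_right split: nat.split)

fun trie_inv :: "trie \<Rightarrow> trie" where
  "trie_inv Zero = Zero"
| "trie_inv (Leaf a) = Leaf a"
| "trie_inv (Node s t) = Node (trie_inv s) (trie_neg (trie_inv t))"

lemma form_of_inv: "form_of d (trie_inv t) = grade_inv (form_of d t)"
  by (induction t arbitrary: d)
    (auto simp: linear_0[OF linear_grade_inv] linear_cmul[OF linear_grade_inv] linear_add[OF
        linear_grade_inv]
      grade_inv_axis grade_inv_covec_wedge form_of_neg wedge_minus_right split: nat.split)

text \<open>For arguments s + e ^ t and s' + e ^ t', contracting with e pairs \<open>t\<close> with
  \<open>t'\<close> and yields the squared length of e, which is 3 for the rescaled e_8. Without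
  that contraction the terms containing e twice vanish, and the two mixed ones carry the signs of
  \<open>sigma_on_covec_wedge_left\<close> and \<open>sigma_on_covec_wedge_right\<close>.\<close>

fun trie_sigma :: "nat \<Rightarrow> nat \<Rightarrow> trie \<Rightarrow> trie \<Rightarrow> trie" where
  "trie_sigma d j Zero t = Zero"
| "trie_sigma d j s Zero = Zero"
| "trie_sigma d j (Leaf c) t = (if j = 0 then trie_scale c t else Zero)"
| "trie_sigma d j s (Leaf c) = (if j = 0 then trie_scale c s else Zero)"
| "trie_sigma 0 j (Node s t) (Node s' t') = trie_sigma 0 j s s'"
| "trie_sigma (Suc d) j (Node s t) (Node s' t') = node
     (trie_add (trie_sigma d j s s')
       (if j = 0 then Zero
        else if d = 0 then trie_scale 3 (trie_sigma d (j - 1) t t') else trie_sigma d (j - 1) t t'))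
     (trie_add (if even j then trie_sigma d j t s' else trie_neg (trie_sigma d j t s'))
       (trie_sigma d j (trie_inv s) t'))"

lemma form_of_Node_0: "form_of 0 (Node s t) = form_of 0 s"
  by simp

lemma form_of_sigma:
  "d \<le> 8 \<Longrightarrow> form_of d (trie_sigma d j s t) = sigma_on (idx ` {..<d}) j (form_of d s) (form_of d t)"
proof (induction d j s t rule: trie_sigma.induct)
  case (6 d j s t s' t')
  have d: "d < 8" using 6 by simp
  have less: "idx d < i" if "i \<in> idx ` {..<d}" for i
    using that d by (auto simp: idx_less_iff)
  then have notin: "idx d \<notin> idx ` {..<d}" by blast
  \<comment> \<open>Neither component contains the index of this level, so contraction just strips
    the leading factor.\<close>
  have ins: "ins (axis (idx d) 1) (form_of (Suc d) (Node x y)) = wt d *\<^sub>R form_of d y" for x y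
    using d by (simp add: ins_add_right ins_scaleR_right ins_covec_wedge ins_form_of_upper)
  have IH: "form_of d (trie_sigma d j s s') = sigma_on (idx ` {..<d}) j (form_of d s) (form_of d s')"
    "j \<noteq> 0 \<Longrightarrow> form_of d (trie_sigma d (j - 1) t t') =
       sigma_on (idx ` {..<d}) (j - 1) (form_of d t) (form_of d t')"
    "form_of d (trie_sigma d j t s') = sigma_on (idx ` {..<d}) j (form_of d t) (form_of d s')"
    "form_of d (trie_sigma d j (trie_inv s) t') =
       sigma_on (idx ` {..<d}) j (grade_inv (form_of d s)) (form_of d t')"
    using 6 by (cases "d = 0"; cases "even j"; simp add: form_of_inv)+
  have "sigma_on (idx ` {..<Suc d}) j (form_of (Suc d) (Node s t)) (form_of (Suc d) (Node s' t')) =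
      sigma_on (idx ` {..<d}) j (form_of (Suc d) (Node s t)) (form_of (Suc d) (Node s' t')) +
      (if j = 0 then 0 else of_int (wt2 d) *\<^sub>R sigma_on (idx ` {..<d}) (j - 1) (form_of d t)
          (form_of d t'))"
    unfolding lessThan_Suc image_insert
    by (subst sigma_on_insert, erule less)
      (simp add: ins sigma_on_scaleR_left sigma_on_scaleR_right flip: wt_square del: form_of.simps)
  \<comment> \<open>The summand with the leading covector in both arguments is zero because its
    square vanishes.\<close>
  also have "sigma_on (idx ` {..<d}) j (form_of (Suc d) (Node s t)) (form_of (Suc d) (Node s' t')) =
      sigma_on (idx ` {..<d}) j (form_of d s) (form_of d s') + wt d *\<^sub>R (covec (idx d) \<and>\<^sub>f
      ((-1) ^ j *\<^sub>R sigma_on (idx ` {..<d}) j (form_of d t) (form_of d s') +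
       sigma_on (idx ` {..<d}) j (grade_inv (form_of d s)) (form_of d t')))"
    using notin
    by (simp add: sigma_on_add_left sigma_on_add_right sigma_on_scaleR_left sigma_on_scaleR_right
        sigma_on_covec_wedge_left sigma_on_covec_wedge_right wedge_add_right wedge_scaleR_right
        sigma_on_minus_left wedge_minus_right grade_inv_covec_wedge linear_add linear_cmul
            linear_grade_inv scaleR_add_right)
  finally have rhs: "sigma_on (idx ` {..<Suc d}) j (form_of (Suc d) (Node s t)) (form_of (Suc d)
      (Node s' t')) =
      sigma_on (idx ` {..<d}) j (form_of d s) (form_of d s') + wt d *\<^sub>R (covec (idx d) \<and>\<^sub>f
      ((-1) ^ j *\<^sub>R sigma_on (idx ` {..<d}) j (form_of d t) (form_of d s') +
       sigma_on (idx ` {..<d}) j (grade_inv (form_of d s)) (form_of d t'))) +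
      (if j = 0 then 0 else of_int (wt2 d) *\<^sub>R sigma_on (idx ` {..<d}) (j - 1) (form_of d t)
          (form_of d t'))" .
  let ?A = "trie_add (trie_sigma d j s s')
       (if j = 0 then Zero
        else if d = 0 then trie_scale 3 (trie_sigma d (j - 1) t t') else trie_sigma d (j - 1) t t')"
  let ?B = "trie_add (if even j then trie_sigma d j t s' else trie_neg (trie_sigma d j t s'))
       (trie_sigma d j (trie_inv s) t')"
  have A: "form_of d ?A = sigma_on (idx ` {..<d}) j (form_of d s) (form_of d s') +
      (if j = 0 then 0 else of_int (wt2 d) *\<^sub>R sigma_on (idx ` {..<d}) (j - 1) (form_of d t)
          (form_of d t'))"
    unfolding form_of_add IH(1)
    by (cases "d = 0") (use IH(2) in \<open>simp_all add: form_of_scale wt2_def del: One_nat_def\<close>)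
  have B: "form_of d ?B = (-1) ^ j *\<^sub>R sigma_on (idx ` {..<d}) j (form_of d t) (form_of d s') +
       sigma_on (idx ` {..<d}) j (grade_inv (form_of d s)) (form_of d t')"
    unfolding form_of_add IH(4) by (simp add: IH(3) form_of_neg)
  have "form_of (Suc d) (trie_sigma (Suc d) j (Node s t) (Node s' t')) =
      form_of d ?A + wt d *\<^sub>R (covec (idx d) \<and>\<^sub>f form_of d ?B)"
    by (simp only: trie_sigma.simps form_of_node form_of.simps nat.case)
  then show ?case
    unfolding A B rhs by (simp only: add_ac)
qed (simp_all add: form_of_scale sigma_on_scaleR_left sigma_on_scaleR_right sigma_on_one_left
    sigma_on_one_right form_of_Node_0 del: trie_scale.simps form_of.simps(3))

text \<open>Here \<open>k\<close> counts from the root, so it is the index itself. The sign in the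
  recursion comes from passing the outer basis vector; the weight of the removed vector is left out
  and restored in \<open>form_of_ins\<close>.\<close>

fun trie_ins :: "nat \<Rightarrow> trie \<Rightarrow> trie" where
  "trie_ins k Zero = Zero"
| "trie_ins k (Leaf c) = Zero"
| "trie_ins 0 (Node s t) = node t Zero"
| "trie_ins (Suc k) (Node s t) = node (trie_ins k s) (trie_neg (trie_ins k t))"

lemma form_of_ins:
  "k < d \<Longrightarrow> d \<le> 8 \<Longrightarrow> ins (axis (idx (d - Suc k)) 1) (form_of d t) = wt (d - Suc k) *\<^sub>R form_of d
      (trie_ins k t)"
proof (induction k t arbitrary: d rule: trie_ins.induct)
  case (2 k c)
  have "ins (axis (idx (d - Suc k)) 1) (form_of 0 (Leaf c)) = 0"
    using 2 by (intro ins_form_of_upper) auto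
  then show ?case by simp
next
  case (3 s t)
  then show ?case
    by (cases d) (auto simp: ins_add_right ins_scaleR_right ins_covec_wedge ins_form_of_upper)
next
  case (4 k s t)
  then obtain d' where d: "d = Suc d'" "k < d'" "d' < 8" by (cases d) auto
  have "idx (d' - Suc k) \<noteq> idx d'"
    using d by (subst idx_eq_iff) auto
  then show ?case
    using d 4
    by (auto simp: ins_add_right ins_scaleR_right ins_covec_wedge form_of_neg wedge_scaleR_right
        wedge_minus_right axis_nth_if scaleR_add_right scaleR_diff_right mult.commute)
qed simp

fun trie_vol :: "nat \<Rightarrow> trie" where
  "trie_vol 0 = Leaf 1"
| "trie_vol (Suc d) = Node Zero (trie_vol d)"

lemma form_of_vol: "d \<le> 8 \<Longrightarrow> form_of d (trie_vol d) = (if d = 0 then 1 else sqrt 3) *\<^sub>R axis (idx `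
    {..<d}) 1"
proof (induction d)
  case (Suc d)
  have less: "\<not> i < idx d" if "i \<in> idx ` {..<d}" for i
    using that Suc.prems by (auto simp: idx_less_iff)
  then have none: "{(i, j). i \<in> {idx d} \<and> j \<in> idx ` {..<d} \<and> j < i} = {}"
    by blast
  have "shuffle_sign {idx d} (idx ` {..<d}) = 1"
    unfolding shuffle_sign_def none by simp
  moreover have "idx d \<notin> idx ` {..<d}"
    using Suc.prems by (auto simp: idx_eq_iff)
  ultimately have "covec (idx d) \<and>\<^sub>f axis (idx ` {..<d}) 1 = axis (idx ` {..<Suc d}) 1"
    by (simp add: covec_def wedge_axis lessThan_Suc)
  with Suc show ?case
    by (simp add: wedge_scaleR_right wt_def)
qed simp

text \<open>The recursion follows \<open>hodge_covec_wedge\<close>, the result always being a trie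
  of level 8. The last basis vector contributes its weight once as a wedge factor and once in the
  contraction, which gives 3.\<close>

fun trie_hodge :: "nat \<Rightarrow> trie \<Rightarrow> trie" where
  "trie_hodge d Zero = Zero"
| "trie_hodge d (Leaf c) = trie_scale c (trie_vol 8)"
| "trie_hodge 0 (Node s t) = trie_hodge 0 s"
| "trie_hodge (Suc d) (Node s t) = trie_add (trie_hodge d s)
     (trie_scale (if d = 0 then 3 else 1) (trie_ins (7 - d) (trie_hodge d (trie_inv t))))"

lemma hodge_one: "hodge (axis {} 1) = axis UNIV 1"
  by (auto simp: hodge_def vec_eq_iff axis_def)

lemma form_of_hodge: "d \<le> 8 \<Longrightarrow> form_of 8 (trie_hodge d t) = sqrt 3 *\<^sub>R hodge (form_of d t)"
proof (induction d t rule: trie_hodge.induct)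
  case (2 d c)
  then show ?case
    using form_of_vol[of 8]
    by (simp add: form_of_scale linear_cmul[OF linear_hodge] hodge_one idx_image)
next
  case (4 d s t)
  have "ins (axis (idx d) 1) (form_of 8 (trie_hodge d (trie_inv t))) =
      wt d *\<^sub>R form_of 8 (trie_ins (7 - d) (trie_hodge d (trie_inv t)))"
    using form_of_ins[of "7 - d" 8 "trie_hodge d (trie_inv t)"] 4(3) by simp
  with 4 have "wt d *\<^sub>R form_of 8 (trie_ins (7 - d) (trie_hodge d (trie_inv t))) =
      sqrt 3 *\<^sub>R hodge (covec (idx d) \<and>\<^sub>f form_of d t)"
    by (simp add: form_of_inv hodge_covec_wedge ins_scaleR_right)
  then have "(wt d * wt d) *\<^sub>R form_of 8 (trie_ins (7 - d) (trie_hodge d (trie_inv t))) =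
      (sqrt 3 * wt d) *\<^sub>R hodge (covec (idx d) \<and>\<^sub>f form_of d t)"
    by (metis (no_types, lifting) mult.commute scaleR_scaleR)
  moreover have "real_of_int (if d = 0 then 3 else 1) = wt d * wt d"
    by (simp add: wt_def)
  ultimately show ?case
    using 4 by (simp only: trie_hodge.simps form_of_add form_of_scale)
      (simp add: linear_add[OF linear_hodge] linear_cmul[OF linear_hodge] scaleR_add_right)
qed (auto simp: linear_0[OF linear_hodge])

section \<open>Basis tries, and the reduction of linear identities to evaluation\<close>

fun covec_trie :: "nat \<Rightarrow> trie" where
  "covec_trie 0 = Node Zero (Leaf 1)"
| "covec_trie (Suc k) = Node (covec_trie k) Zero"

lemma form_of_covec: "k < d \<Longrightarrow> form_of d (covec_trie k) = wt (d - Suc k) *\<^sub>R covec (idx (d - Suc k))"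
  by (induction k arbitrary: d) (auto split: nat.split)

fun trie_basis :: "nat \<Rightarrow> nat \<Rightarrow> trie list" where
  "trie_basis 0 k = (if k = 0 then [Leaf 1] else [])"
| "trie_basis (Suc d) k = map (\<lambda>t. Node t Zero) (trie_basis d k) @
     (if k = 0 then [] else map (Node Zero) (trie_basis d (k - 1)))"

text \<open>The factor \<open>c\<close> undoes the rescaling of e_8.\<close>

lemma axis_eq_form_of_basis:
  "d \<le> 8 \<Longrightarrow> I \<subseteq> idx ` {..<d} \<Longrightarrow>
    \<exists>t\<in>set (trie_basis d (card I)). \<exists>c. axis I 1 = c *\<^sub>R form_of d t"
proof (induction d arbitrary: I)
  case 0
  then show ?case by (auto intro: exI[of _ 1])
next
  case (Suc d)
  show ?case
  proof (cases "idx d \<in> I")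
    case False
    then have "I \<subseteq> idx ` {..<d}" using Suc.prems by (auto simp: lessThan_Suc)
    then obtain t c where "t \<in> set (trie_basis d (card I))" "axis I 1 = c *\<^sub>R form_of d t"
      using Suc.IH[of I] Suc.prems by auto
    then have "Node t Zero \<in> set (trie_basis (Suc d) (card I))" "axis I 1 = c *\<^sub>R form_of (Suc d)
        (Node t Zero)"
      by auto
    then show ?thesis by blast
  next
    case True
    define J where "J = I - {idx d}"
    have J: "I = insert (idx d) J" "idx d \<notin> J" "J \<subseteq> idx ` {..<d}"
      using True Suc.prems by (auto simp: J_def lessThan_Suc)
    then obtain t c where t: "t \<in> set (trie_basis d (card J))" "axis J 1 = c *\<^sub>R form_of d t"
      using Suc.IH[of J] Suc.prems by auto
    have less: "\<not> i < idx d" if "i \<in> J" for i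
      using that J(3) Suc.prems by (auto simp: idx_less_iff)
    have none: "{(i, j). i \<in> {idx d} \<and> j \<in> J \<and> j < i} = {}"
      using less by auto
    have "shuffle_sign {idx d} J = 1"
      unfolding shuffle_sign_def none by simp
    then have "axis I 1 = covec (idx d) \<and>\<^sub>f axis J 1"
      using J by (simp add: covec_def wedge_axis)
    then have "axis I 1 = (c / wt d) *\<^sub>R form_of (Suc d) (Node Zero t)"
      using t by (simp add: wedge_scaleR_right)
    moreover have "Node Zero t \<in> set (trie_basis (Suc d) (card I))"
      using t J by auto
    ultimately show ?thesis by blast
  qed
qed

lemma linear_eq_0_on_Lam:
  assumes "linear f" "\<And>t. t \<in> set (trie_basis 8 k) \<Longrightarrow> f (form_of 8 t) = 0" "\<alpha> \<in> Lam k"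
  shows "f \<alpha> = 0"
proof -
  have zero: "f (axis I 1) = 0" if I: "card I = k" for I
  proof -
    obtain t c where "t \<in> set (trie_basis 8 k)" "axis I 1 = c *\<^sub>R form_of 8 t"
      using axis_eq_form_of_basis[of 8 I] unfolding I idx_image by auto
    then show ?thesis using assms(1,2) by (simp add: linear_cmul)
  qed
  have "\<alpha> = (\<Sum>I\<in>UNIV. \<alpha> $ I *\<^sub>R axis I 1)"
    using basis_expansion[of \<alpha>] by (simp add: scalar_mult_eq_scaleR)
  then have "f \<alpha> = (\<Sum>I\<in>UNIV. \<alpha> $ I *\<^sub>R f (axis I 1))"
    by (metis (no_types, lifting) assms(1) linear_cmul linear_sum sum.cong)
  also have "\<dots> = 0"
  proof (rule sum.neutral, rule ballI)
    fix I
    show "\<alpha> $ I *\<^sub>R f (axis I 1) = 0"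
      using assms(3) zero[of I] by (cases "\<alpha> $ I = 0") (auto simp: Lam_def)
  qed
  finally show ?thesis .
qed

fun is_zero :: "trie \<Rightarrow> bool" where
  "is_zero Zero = True"
| "is_zero (Leaf c) = (c = 0)"
| "is_zero (Node s t) = (is_zero s \<and> is_zero t)"

lemma form_of_is_zero: "is_zero t \<Longrightarrow> form_of d t = 0"
  by (induction t arbitrary: d) (auto split: nat.split)

text \<open>\<open>T\<close> is a symbolic version of c f. The first premise is a finite evaluation
  over the basis of Lambda^k, the second the soundness of \<open>T\<close>; the nonzero
  \<open>c\<close> absorbs denominators and powers of sqrt 3.\<close>

lemma linear_eq_0_by_computation:
  assumes "list_all (\<lambda>t. is_zero (T t)) (trie_basis 8 k)"
    and "\<And>t. form_of 8 (T t) = c *\<^sub>R f (form_of 8 t)" "c \<noteq> 0" "linear f" "\<alpha> \<in> Lam k"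
  shows "f \<alpha> = 0"
  using assms(4) _ assms(5)
proof (rule linear_eq_0_on_Lam)
  fix t assume "t \<in> set (trie_basis 8 k)"
  then have "form_of 8 (T t) = 0"
    using assms(1) by (simp add: list_all_iff form_of_is_zero)
  then show "f (form_of 8 t) = 0"
    using assms(2)[of t] assms(3) by simp
qed

section \<open>Computing with rho\<close>

text \<open>A literal, so that later evaluations need not build it; \<open>form_of_rho\<close>
  certifies it.\<close>

definition rho_trie :: trie where
  "rho_trie =
     Node (Node (Node (Node (Node Zero (Node Zero (Node Zero (Leaf (-2))))) Zero) (Node Zero
     (Node (Node (Node (Node Zero (Leaf (-1))) (Leaf 1)) Zero) Zero))) (Node (Node Zero (Node
     (Node Zero (Leaf 1)) Zero)) (Node (Node Zero (Leaf (-1))) Zero))) (Node (Node (Node Zero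
     (Node Zero (Leaf (-1)))) (Node (Node (Node Zero (Leaf (-1))) Zero) Zero)) (Node (Node
     (Node (Node (Node (Node Zero (Leaf 1)) (Leaf 1)) Zero) Zero) Zero) Zero))"

lemma sigma_0: "sigma 0 \<alpha> \<beta> = \<alpha> \<and>\<^sub>f \<beta>"
proof -
  have "{S :: 8 set. card S = 0} = {{}}" by auto
  then show ?thesis by (simp add: sigma_def)
qed

lemma form_of_sigma_8: "form_of 8 (trie_sigma 8 j s t) = sigma j (form_of 8 s) (form_of 8 t)"
  using form_of_sigma[of 8 j s t] by (simp add: idx_image sigma_on_UNIV)

definition weight :: "nat \<Rightarrow> real" where
  "weight k = (if k = 7 then sqrt 3 else 1)"

lemma weight_nonzero [simp]: "weight k \<noteq> 0"
  by (simp add: weight_def)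

lemma form_of_covec_8:
  assumes "k < 8"
  shows "form_of 8 (covec_trie k) = weight k *\<^sub>R covec (of_nat k)"
proof -
  have "idx (8 - Suc k) = of_nat k" "wt (8 - Suc k) = weight k"
    using assms by (auto simp: idx_def wt_def weight_def)
  then show ?thesis
    using form_of_covec[OF assms] by simp
qed

text \<open>\<open>trie_ins\<close> represents contraction divided by the weight. Multiplying by the
  squared weight gives the same factor \<open>weight k\<close> as in \<open>covec_trie k\<close>, so
  that terms of both kinds can be compared in one identity.\<close>

definition trie_ins_weighted :: "nat \<Rightarrow> trie \<Rightarrow> trie" where
  "trie_ins_weighted k t = trie_scale (if k = 7 then 3 else 1) (trie_ins k t)"

lemma ins_form_of_8:
  assumes "k < 8"
  shows "ins (axis (of_nat k) 1) (form_of 8 t) = weight k *\<^sub>R form_of 8 (trie_ins k t)"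
proof -
  have "idx (8 - Suc k) = of_nat k" "wt (8 - Suc k) = weight k"
    using assms by (auto simp: idx_def wt_def weight_def)
  then show ?thesis
    using form_of_ins[OF assms, of t] by simp
qed

lemma form_of_ins_weighted:
  assumes "k < 8"
  shows "form_of 8 (trie_ins_weighted k t) = weight k *\<^sub>R ins (axis (of_nat k) 1) (form_of 8 t)"
  using assms by (simp add: trie_ins_weighted_def ins_form_of_8 form_of_scale weight_def)

lemma wedge_wedge_e: "e i \<and>\<^sub>f e j \<and>\<^sub>f e k = (e i \<and>\<^sub>f e j) \<and>\<^sub>f e k"
  by (simp add: e_def covec_wedge_assoc)

lemma form_of_rho: "form_of 8 rho_trie = rho0"
proof -
  let ?E = "\<lambda>k. covec_trie (k - 1)"
  let ?w = "\<lambda>i j k. trie_sigma 8 0 (trie_sigma 8 0 (?E i) (?E j)) (?E k)"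
  \<comment> \<open>The sqrt 3 of the last two monomials is contained in
    \<open>?E 8\<close>.\<close>
  let ?R = "foldr trie_add [?w 2 4 6, trie_neg (?w 2 3 5), trie_neg (?w 1 4 5), trie_neg (?w 1 3 6),
      ?w 1 2 7, ?w 3 4 7, trie_scale (-2) (?w 5 6 7), ?w 1 2 8, trie_neg (?w 3 4 8)] Zero"
  have "is_zero (trie_add (trie_neg rho_trie) ?R)"
    by code_simp
  then have "form_of 8 (trie_add (trie_neg rho_trie) ?R) = 0"
    by (rule form_of_is_zero)
  then have "form_of 8 rho_trie = form_of 8 ?R"
    by (simp add: form_of_add form_of_neg)
  also have "\<dots> = rho0"
    by (simp add: form_of_add form_of_neg form_of_scale form_of_sigma_8 form_of_covec_8 weight_def
        sigma_0 rho0_def wedge_wedge_e e_def[symmetric] wedge_add_left wedge_diff_left wedge_scaleR_left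
        wedge_scaleR_right scaleR_diff_right del: covec_trie.simps form_of.simps)
      (simp add: e_def)
  finally show ?thesis .
qed


lemma ins_rho_8: "k < 8 \<Longrightarrow> ins (axis (of_nat k) 1) rho0 = weight k *\<^sub>R form_of 8 (trie_ins k rho_trie)"
  using ins_form_of_8[of k rho_trie] by (simp add: form_of_rho)

lemma idx_UNIV_cases: obtains k where "k < 8" "i = (of_nat k :: 8)"
proof -
  have "i \<in> idx ` {..<8}" by (simp add: idx_image)
  then obtain d where "d < 8" "i = idx d" by auto
  then show thesis using that[of "7 - d"] by (simp add: idx_def)
qed

lemma sum_UNIV_8: "(\<Sum>i\<in>UNIV. f i) = (\<Sum>k<8. f (of_nat k :: 8))"
proof -
  have "inj_on (of_nat :: nat \<Rightarrow> 8) {..<8}"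
    using of_nat_8_less_iff by (intro inj_onI) (metis lessThan_iff linorder_neqE_nat order_less_irrefl)
  moreover have "UNIV = (of_nat :: nat \<Rightarrow> 8) ` {..<8}"
    using idx_UNIV_cases by blast
  ultimately have "(\<Sum>k<8. f (of_nat k :: 8)) = sum f UNIV"
    by (metis (no_types, lifting) sum.reindex_cong)
  then show ?thesis by simp
qed

definition trie_sum :: "(nat \<Rightarrow> trie) \<Rightarrow> trie" where
  "trie_sum f = foldr trie_add (map f [0..<8]) Zero"

lemma form_of_sum: "form_of 8 (trie_sum f) = (\<Sum>k<8. form_of 8 (f k))"
proof -
  have "form_of 8 (foldr trie_add (map f xs) Zero) = (\<Sum>k\<leftarrow>xs. form_of 8 (f k))" for xs
    by (induction xs) (simp_all add: form_of_add)
  from this[of "[0..<8]"] show ?thesis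
    by (simp add: trie_sum_def interv_sum_list_conv_sum_set_nat atLeast0LessThan)
qed

lemma linear_eq_by_computation:
  assumes "\<alpha> \<in> Lam k" "list_all (\<lambda>t. is_zero (T t)) (trie_basis 8 k)"
    and "\<And>t. form_of 8 (T t) = c *\<^sub>R (f (form_of 8 t) - g (form_of 8 t))" "c \<noteq> 0"
    and "linear f" "linear g"
  shows "f \<alpha> = g \<alpha>"
proof -
  have "f \<alpha> - g \<alpha> = 0"
    by (rule linear_eq_0_by_computation[OF assms(2,3,4) linear_compose_sub[OF assms(5,6)] assms(1)])
  then show ?thesis by simp
qed

text \<open>For identities involving a basis vector e_i: one evaluation per index, with the weight
  of that vector as common factor.\<close>

lemma linear_eq_by_computation_indexed:
  fixes i :: 8
  assumes "\<alpha> \<in> Lam k" "list_all (\<lambda>m. list_all (\<lambda>t. is_zero (T m t)) (trie_basis 8 k)) [0..<8]"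
    and "\<And>m t. m < 8 \<Longrightarrow>
      form_of 8 (T m t) = weight m *\<^sub>R (f (of_nat m) (form_of 8 t) - g (of_nat m) (form_of 8 t))"
    and "\<And>i. linear (f i)" "\<And>i. linear (g i)"
  shows "f i \<alpha> = g i \<alpha>"
proof -
  obtain m where m: "m < 8" "i = of_nat m" by (rule idx_UNIV_cases)
  show ?thesis
    unfolding m
    by (rule linear_eq_by_computation[OF assms(1) _ assms(3)[OF m(1)] weight_nonzero assms(4,5)])
      (use assms(2) m(1) in \<open>simp add: list_all_iff\<close>)
qed

section \<open>Symbolic versions of the operators, with the rules that prove them linear and
  sound\<close>

lemma linear_ident: "linear (\<lambda>x. x)"
  by (rule linear_id[unfolded id_def])

lemmas linear_wedge_left' = linear_compose[OF _ linear_wedge_left, unfolded o_def]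
  and linear_wedge_right' = linear_compose[OF _ linear_wedge_right, unfolded o_def]
  and linear_sigma_left' = linear_compose[OF _ linear_sigma_left, unfolded o_def]
  and linear_sigma_right' = linear_compose[OF _ linear_sigma_right, unfolded o_def]
  and linear_hodge' = linear_compose[OF _ linear_hodge, unfolded o_def]
  and linear_ins' = linear_compose[OF _ linear_ins, unfolded o_def]

lemma linear_sum_intro:
  assumes "\<And>i. i \<in> A \<Longrightarrow> linear (f i)"
  shows "linear (\<lambda>x. \<Sum>i\<in>A. f i x)"
  using assms by (auto intro: linear_compose_sum)

lemmas linear_intros = linear_ident linear_compose_add linear_compose_sub linear_compose_neg
  linear_compose_scale_right linear_zero linear_wedge_left' linear_wedge_right' linear_sigma_left'
  linear_sigma_right' linear_hodge' linear_ins' linear_sum_intro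

definition trie_plus :: "trie \<Rightarrow> trie" where
  "trie_plus t = trie_sigma 8 1 rho_trie t"

definition trie_minus :: "trie \<Rightarrow> trie" where
  "trie_minus t = trie_sigma 8 2 rho_trie t"

definition trie_contr :: "nat \<Rightarrow> trie \<Rightarrow> trie" where
  "trie_contr j t = trie_sigma 8 j t rho_trie"

definition trie_rho_contr :: "trie \<Rightarrow> trie" where
  "trie_rho_contr t = trie_sigma 8 3 rho_trie t"

definition trie_wedge :: "trie \<Rightarrow> trie \<Rightarrow> trie" where
  "trie_wedge s t = trie_sigma 8 0 s t"

text \<open>\<open>trie_star\<close> represents \<open>\<surd>3\<close> times the Hodge operator, which keeps the coefficients integral. The
  factor \<open>c\<close> in the computations below collects these powers of \<open>\<surd>3\<close>.\<close>

abbreviation trie_star :: "trie \<Rightarrow> trie" where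
  "trie_star t \<equiv> trie_hodge 8 t"

lemma form_of_star: "form_of 8 (trie_star t) = sqrt 3 *\<^sub>R hodge (form_of 8 t)"
  by (rule form_of_hodge) simp

lemma form_of_ops:
  "form_of 8 (trie_plus t) = sigma_plus (form_of 8 t)"
  "form_of 8 (trie_minus t) = sigma_minus (form_of 8 t)"
  "form_of 8 (trie_contr j t) = sigma j (form_of 8 t) rho0"
  "form_of 8 (trie_rho_contr t) = sigma 3 rho0 (form_of 8 t)"
  "form_of 8 (trie_wedge s t) = form_of 8 s \<and>\<^sub>f form_of 8 t"
  by (simp_all add: trie_plus_def trie_minus_def trie_contr_def trie_rho_contr_def trie_wedge_def
      form_of_sigma_8 form_of_rho sigma_0 sigma_plus_def sigma_minus_def)

lemmas form_of_simps = form_of_add form_of_neg form_of_scale form_of_rho form_of_ops form_of_star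

lemma linear_sigma_plus: "linear sigma_plus" and linear_sigma_minus: "linear sigma_minus"
  unfolding sigma_plus_def[abs_def] sigma_minus_def[abs_def] by (rule linear_sigma_right)+

lemmas linear_sigma_plus' = linear_compose[OF _ linear_sigma_plus, unfolded o_def]
  and linear_sigma_minus' = linear_compose[OF _ linear_sigma_minus, unfolded o_def]

lemmas linear_pushes = wedge_add_left wedge_add_right wedge_diff_left wedge_diff_right
  wedge_minus_left wedge_minus_right wedge_scaleR_left wedge_scaleR_right
  sigma_add_left sigma_add_right sigma_diff_left sigma_diff_right
  sigma_minus_left sigma_minus_right sigma_scaleR_left sigma_scaleR_right
  ins_add_right ins_diff_right ins_minus_right ins_scaleR_right
  linear_add[OF linear_hodge] linear_diff[OF linear_hodge] linear_neg[OF linear_hodge]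
  linear_cmul[OF linear_hodge] linear_0[OF linear_hodge]
  linear_add[OF linear_sigma_plus] linear_diff[OF linear_sigma_plus] linear_neg[OF linear_sigma_plus]
  linear_cmul[OF linear_sigma_plus] linear_0[OF linear_sigma_plus]
  linear_add[OF linear_sigma_minus] linear_diff[OF linear_sigma_minus] linear_neg[OF linear_sigma_minus]
  linear_cmul[OF linear_sigma_minus] linear_0[OF linear_sigma_minus]
  scaleR_add_right scaleR_diff_right

lemmas linear_intros' = linear_intros linear_sigma_plus' linear_sigma_minus'

text \<open>On 4-forms sigma_- annihilates rho ^ Lambda^1 and the dual of sigma_+ Lambda^3. The
  subtracted term is 10 times the component of F in the dual of rho ^ Lambda^1, since contracting
  rho into rho ^ X gives 10 X. What remains is the sigma_+ Lambda^3_27 component: on sigma_+ T the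
  value is 160 T, as sigma_- sigma_+ is 16 there.\<close>

definition excess :: "form \<Rightarrow> form" where
  "excess F = sigma_minus (10 *\<^sub>R F - hodge (rho0 \<and>\<^sub>f contr 3 rho0 (hodge F)))"

text \<open>The factor 30 is 3 * 10: the subtracted term passes through \<open>trie_star\<close>
  twice.\<close>

definition trie_excess :: "trie \<Rightarrow> trie" where
  "trie_excess t = trie_minus (trie_add (trie_scale 30 t)
     (trie_neg (trie_star (trie_wedge rho_trie (trie_rho_contr (trie_star t))))))"

lemma form_of_excess: "form_of 8 (trie_excess t) = 3 *\<^sub>R excess (form_of 8 t)"
  by (simp add: trie_excess_def excess_def form_of_simps linear_pushes)

lemma linear_excess: "linear excess"
  unfolding excess_def[abs_def] by (intro linear_intros')

lemmas linear_excess' = linear_compose[OF _ linear_excess, unfolded o_def]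
  and excess_scaleR = linear_cmul[OF linear_excess]

section \<open>Linear identities for the operators built from rho\<close>

lemma contr_2_contr_1:
  assumes "X \<in> Lam 1"
  shows "contr 2 (contr 1 X rho0) rho0 = 6 *\<^sub>R X"
  by (rule linear_eq_by_computation[OF assms,
        where T = "\<lambda>t. trie_add (trie_contr 2 (trie_contr 1 t)) (trie_scale (-6) t)" and c = "1"],
      code_simp, simp_all add: form_of_simps form_of_excess excess_scaleR linear_pushes
          linear_intros' linear_excess')

text \<open>Identifies Lambda^2_20 with the kernel of contraction into rho.\<close>

lemma wedge_hodge_rho:
  assumes "\<omega> \<in> Lam 2"
  shows "\<omega> \<and>\<^sub>f hodge rho0 = hodge (contr 2 \<omega> rho0)"
  by (rule linear_eq_by_computation[OF assms,
        where T = "\<lambda>t. trie_add (trie_wedge t (trie_star rho_trie)) (trie_neg (trie_star (trie_contr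
            2 t)))" and c = "sqrt 3"],
      code_simp, simp_all add: form_of_simps form_of_excess excess_scaleR linear_pushes
          linear_intros' linear_excess')

text \<open>The forms X contracted into rho make up psu(3), the isotropy algebra of rho.\<close>

lemma rho_invariant:
  assumes "X \<in> Lam 1"
  shows "sigma 1 (contr 1 X rho0) rho0 = 0"
  by (rule linear_eq_by_computation[OF assms,
        where T = "\<lambda>t. trie_contr 1 (trie_contr 1 t)" and c = "1"],
      code_simp, simp_all add: form_of_simps form_of_excess excess_scaleR linear_pushes
          linear_intros' linear_excess')

lemma contr_1_summand:
  assumes "\<omega> \<in> Lam 0"
  shows "contr 1 (covec i \<and>\<^sub>f \<omega>) rho0 = ins (axis i 1) rho0 \<and>\<^sub>f \<omega>"
  by (rule linear_eq_by_computation_indexed[OF assms,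
        where T = "\<lambda>m t. trie_add (trie_contr 1 (trie_wedge (covec_trie m) t))
          (trie_neg (trie_wedge (trie_ins_weighted m rho_trie) t))"],
      code_simp, simp_all add: form_of_simps form_of_covec_8 form_of_ins_weighted linear_pushes
          linear_intros' mult_ac)

text \<open>The second term on the left vanishes for \<omega> in the module m; it extends the
  identity to all 2-forms. Summation over i expresses Phi_1 through D and Delta.\<close>

lemma Phi1_summand:
  assumes "\<omega> \<in> Lam 2"
  shows "12 *\<^sub>R (covec i \<and>\<^sub>f \<omega>) - 2 *\<^sub>R (covec i \<and>\<^sub>f contr 1 (contr 2 \<omega> rho0) rho0) =
    - sigma_minus (covec i \<and>\<^sub>f sigma 1 \<omega> rho0) - sigma_plus (ins (axis i 1) (sigma 1 \<omega> rho0))"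
  by (rule linear_eq_by_computation_indexed[OF assms,
        where T = "\<lambda>m t. trie_add (trie_scale 12 (trie_wedge (covec_trie m) t)) (trie_add
            (trie_scale (-2) (trie_wedge (covec_trie m) (trie_contr 1 (trie_contr 2 t)))) (trie_add
            (trie_minus (trie_wedge (covec_trie m) (trie_contr 1 t))) (trie_plus (trie_ins_weighted
            m (trie_contr 1 t)))))"],
      code_simp, simp_all add: form_of_simps form_of_covec_8 form_of_ins_weighted linear_pushes
          linear_intros' mult_ac)

lemma Phi2_summand:
  assumes "\<omega> \<in> Lam 2"
  shows "covec i \<and>\<^sub>f sigma 1 \<omega> rho0 =
    ins (axis i 1) rho0 \<and>\<^sub>f \<omega> - sigma_plus (covec i \<and>\<^sub>f \<omega>)"
  by (rule linear_eq_by_computation_indexed[OF assms,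
        where T = "\<lambda>m t. trie_add (trie_wedge (covec_trie m) (trie_contr 1 t)) (trie_add (trie_neg
            (trie_wedge (trie_ins_weighted m rho_trie) (t))) (trie_plus (trie_wedge (covec_trie m)
            t)))"],
      code_simp, simp_all add: form_of_simps form_of_covec_8 form_of_ins_weighted linear_pushes
          linear_intros' mult_ac)

text \<open>Summed over i, this is the relation between delta rho and d rho behind the two criteria
  of (4).\<close>

lemma contr_2_summand:
  assumes "\<omega> \<in> Lam 2"
  shows "contr 2 (ins (axis i 1) (sigma 1 \<omega> rho0)) rho0 =
    - contr 3 rho0 (covec i \<and>\<^sub>f sigma 1 \<omega> rho0)"
  by (rule linear_eq_by_computation_indexed[OF assms,
        where T = "\<lambda>m t. trie_add (trie_contr 2 (trie_ins_weighted m (trie_contr 1 t)))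
            (trie_rho_contr (trie_wedge (covec_trie m) (trie_contr 1 t)))"],
      code_simp, simp_all add: form_of_simps form_of_covec_8 form_of_ins_weighted linear_pushes
          linear_intros' mult_ac)

lemma sum_covec_sigma_ins:
  assumes "T \<in> Lam 3"
  shows "(\<Sum>i\<in>UNIV. covec i \<and>\<^sub>f sigma 1 (ins (axis i 1) T) rho0) = - 2 *\<^sub>R sigma_plus T"
  by (rule linear_eq_by_computation[OF assms,
        where T = "\<lambda>t. trie_add (trie_sum (\<lambda>m. trie_wedge (covec_trie m) (trie_contr 1 (trie_ins m
            t)))) (trie_scale 2 (trie_plus t))" and c = "1"],
      code_simp, simp_all add: form_of_simps form_of_sum form_of_covec_8 form_of_ins_weighted
        form_of_sigma_8 ins_form_of_8 ins_rho_8 sum_UNIV_8 linear_pushes linear_intros' mult_ac)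

lemma sum_ins_sigma_ins:
  assumes "T \<in> Lam 3"
  shows "(\<Sum>i\<in>UNIV. ins (axis i 1) (sigma 1 (ins (axis i 1) T) rho0)) = - 2 *\<^sub>R sigma_minus T"
  by (rule linear_eq_by_computation[OF assms,
        where T = "\<lambda>t. trie_add (trie_sum (\<lambda>m. trie_ins_weighted m (trie_contr 1 (trie_ins m t))))
            (trie_scale 2 (trie_minus t))" and c = "1"],
      code_simp, simp_all add: form_of_simps form_of_sum form_of_covec_8 form_of_ins_weighted
        form_of_sigma_8 ins_form_of_8 ins_rho_8 sum_UNIV_8 linear_pushes linear_intros' mult_ac)

text \<open>Up to sign this is D Theta_2. On rho ^ X only the last term contributes, with factor 6
  by \<open>plus_minus_hodge_rho_wedge\<close>; on the dual of sigma_+ T with T in Lambda^3_27 again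
  only the last, with factor 16. Hence -(24 - 6) = -18 and -(24 - 16) = -8.\<close>

lemma sum_covec_sigma_contr:
  assumes "F \<in> Lam 4"
  shows "(\<Sum>i\<in>UNIV. covec i \<and>\<^sub>f sigma 1 (contr 2 (ins (axis i 1) rho0) F) rho0) =
    24 *\<^sub>R F - 2 *\<^sub>R sigma_plus (sigma_minus F) - hodge (sigma_plus (sigma_minus (hodge F)))"
  by (rule linear_eq_by_computation[OF assms,
        where T = "\<lambda>t. trie_add (trie_scale 3 (trie_sum (\<lambda>m. trie_wedge (covec_trie m) (trie_contr 1
            (trie_sigma 8 2 (trie_ins m rho_trie) t))))) (trie_add (trie_scale (-72) t) (trie_add
            (trie_scale 6 (trie_plus (trie_minus t))) (trie_star (trie_plus (trie_minus (trie_star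
            t))))))" and c = "3"],
      code_simp, simp_all add: form_of_simps form_of_sum form_of_covec_8 form_of_ins_weighted
        form_of_sigma_8 ins_form_of_8 ins_rho_8 sum_UNIV_8 linear_pushes linear_intros' mult_ac)

lemma sum_ins_sigma_contr:
  assumes "F \<in> Lam 4"
  shows "(\<Sum>i\<in>UNIV. ins (axis i 1) (sigma 1 (contr 2 (ins (axis i 1) rho0) F) rho0)) =
    - 3 *\<^sub>R contr 1 (contr 3 rho0 F) rho0"
  by (rule linear_eq_by_computation[OF assms,
        where T = "\<lambda>t. trie_add (trie_sum (\<lambda>m. trie_ins_weighted m (trie_contr 1 (trie_sigma 8 2
            (trie_ins m rho_trie) t)))) (trie_scale 3 (trie_contr 1 (trie_rho_contr t)))" and c =
            "1"],
      code_simp, simp_all add: form_of_simps form_of_sum form_of_covec_8 form_of_ins_weighted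
        form_of_sigma_8 ins_form_of_8 ins_rho_8 sum_UNIV_8 linear_pushes linear_intros' mult_ac)

text \<open>Resolution of the identity into the projections to the four summands of Lambda^4. The
  common denominator is 160 because \<open>excess\<close> scales by 160 and contraction with rho by
  10 = 160 / 16.\<close>

lemma Lam4_decomposition:
  assumes "F \<in> Lam 4"
  shows "160 *\<^sub>R F = sigma_plus (excess F) + hodge (sigma_plus (excess (hodge F))) +
    16 *\<^sub>R (rho0 \<and>\<^sub>f contr 3 rho0 F + hodge (rho0 \<and>\<^sub>f contr 3 rho0 (hodge F)))"
  by (rule linear_eq_by_computation[OF assms,
        where T = "\<lambda>t. trie_add (trie_scale (-1440) t) (trie_add (trie_scale 3 (trie_plus
            (trie_excess t))) (trie_add (trie_star (trie_plus (trie_excess (trie_star t))))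
            (trie_add (trie_scale 144 (trie_wedge rho_trie (trie_rho_contr t))) (trie_scale 48
            (trie_star (trie_wedge rho_trie (trie_rho_contr (trie_star t))))))))" and c = "-9"],
      code_simp, simp_all add: form_of_simps form_of_excess excess_scaleR linear_pushes
          linear_intros' linear_excess')

lemma hodge_plus_Lam3_8:
  assumes "X \<in> Lam 1"
  shows "hodge (sigma_plus (hodge (sigma_plus X \<and>\<^sub>f rho0))) = 6 *\<^sub>R (rho0 \<and>\<^sub>f X)"
  by (rule linear_eq_by_computation[OF assms,
        where T = "\<lambda>t. trie_add (trie_star (trie_plus (trie_star (trie_wedge (trie_plus t)
            rho_trie)))) (trie_scale (-18) (trie_wedge rho_trie t))" and c = "3"],
      code_simp, simp_all add: form_of_simps form_of_excess excess_scaleR linear_pushes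
          linear_intros' linear_excess')

text \<open>On Lambda^2_20 the correction vanishes and sigma_+ is inverted by sigma_- / 12.\<close>

lemma minus_plus_Lam2:
  assumes "\<omega> \<in> Lam 2"
  shows "sigma_minus (sigma_plus \<omega>) = 12 *\<^sub>R \<omega> - 2 *\<^sub>R contr 1 (contr 2 \<omega> rho0) rho0"
  by (rule linear_eq_by_computation[OF assms,
        where T = "\<lambda>t. trie_add (trie_minus (trie_plus t)) (trie_add (trie_scale (-12) t)
            (trie_scale 2 (trie_contr 1 (trie_contr 2 t))))" and c = "1"],
      code_simp, simp_all add: form_of_simps form_of_excess excess_scaleR linear_pushes
          linear_intros' linear_excess')

lemma minus_Lam3_8:
  assumes "X \<in> Lam 1"
  shows "sigma_minus (hodge (sigma_plus X \<and>\<^sub>f rho0)) = 0"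
  by (rule linear_eq_by_computation[OF assms,
        where T = "\<lambda>t. trie_minus (trie_star (trie_wedge (trie_plus t) rho_trie))" and c = "sqrt 3"],
      code_simp, simp_all add: form_of_simps form_of_excess excess_scaleR linear_pushes
          linear_intros' linear_excess')

lemma contr_3_rho_wedge:
  assumes "X \<in> Lam 1"
  shows "contr 3 rho0 (rho0 \<and>\<^sub>f X) = 10 *\<^sub>R X"
  by (rule linear_eq_by_computation[OF assms,
        where T = "\<lambda>t. trie_add (trie_rho_contr (trie_wedge rho_trie t)) (trie_scale (-10) t)" and c
            = "1"],
      code_simp, simp_all add: form_of_simps form_of_excess excess_scaleR linear_pushes
          linear_intros' linear_excess')

lemma minus_rho_wedge:
  assumes "X \<in> Lam 1"
  shows "sigma_minus (rho0 \<and>\<^sub>f X) = 0"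
  by (rule linear_eq_by_computation[OF assms,
        where T = "\<lambda>t. trie_minus (trie_wedge rho_trie t)" and c = "1"],
      code_simp, simp_all add: form_of_simps form_of_excess excess_scaleR linear_pushes
          linear_intros' linear_excess')

lemma plus_plus_Lam2:
  assumes "\<omega> \<in> Lam 2"
  shows "sigma_plus (sigma_plus \<omega>) = 0"
  by (rule linear_eq_by_computation[OF assms,
        where T = "\<lambda>t. trie_plus (trie_plus t)" and c = "1"],
      code_simp, simp_all add: form_of_simps form_of_excess excess_scaleR linear_pushes
          linear_intros' linear_excess')

text \<open>On 3-forms sigma_- factors through the wedge product with rho, hence vanishes on
  Lambda^3_27.\<close>

lemma minus_Lam3:
  assumes "T \<in> Lam 3"
  shows "4 *\<^sub>R sigma_minus T = - hodge (sigma_plus (hodge (T \<and>\<^sub>f rho0)) \<and>\<^sub>f rho0)"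
  by (rule linear_eq_by_computation[OF assms,
        where T = "\<lambda>t. trie_add (trie_scale 12 (trie_minus t)) (trie_star (trie_wedge (trie_plus
            (trie_star (trie_wedge t rho_trie))) (rho_trie)))" and c = "3"],
      code_simp, simp_all add: form_of_simps form_of_excess excess_scaleR linear_pushes
          linear_intros' linear_excess')

lemma minus_hodge_plus:
  assumes "T \<in> Lam 3"
  shows "sigma_minus (hodge (sigma_plus T)) = 0"
  by (rule linear_eq_by_computation[OF assms,
        where T = "\<lambda>t. trie_minus (trie_star (trie_plus t))" and c = "sqrt 3"],
      code_simp, simp_all add: form_of_simps form_of_excess excess_scaleR linear_pushes
          linear_intros' linear_excess')

lemma contr_3_hodge_plus:
  assumes "T \<in> Lam 3"
  shows "contr 3 rho0 (hodge (sigma_plus T)) = - contr 2 (hodge (T \<and>\<^sub>f rho0)) rho0"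
  by (rule linear_eq_by_computation[OF assms,
        where T = "\<lambda>t. trie_add (trie_rho_contr (trie_star (trie_plus t))) (trie_contr 2 (trie_star
            (trie_wedge t rho_trie)))" and c = "sqrt 3"],
      code_simp, simp_all add: form_of_simps form_of_excess excess_scaleR linear_pushes
          linear_intros' linear_excess')

lemma plus_minus_hodge_rho_wedge:
  assumes "X \<in> Lam 1"
  shows "sigma_plus (sigma_minus (hodge (rho0 \<and>\<^sub>f X))) = 6 *\<^sub>R hodge (rho0 \<and>\<^sub>f X)"
  by (rule linear_eq_by_computation[OF assms,
        where T = "\<lambda>t. trie_add (trie_plus (trie_minus (trie_star (trie_wedge rho_trie t))))
            (trie_scale (-6) (trie_star (trie_wedge rho_trie t)))" and c = "sqrt 3"],
      code_simp, simp_all add: form_of_simps form_of_excess excess_scaleR linear_pushes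
          linear_intros' linear_excess')

text \<open>Makes this contraction a function of sigma_- F: vanishing of sigma_- F already forces
  the vector component of the dual to vanish.\<close>

lemma contr_3_hodge:
  assumes "F \<in> Lam 4"
  shows "6 *\<^sub>R contr 3 rho0 (hodge F) = - contr 2 (hodge (sigma_minus F \<and>\<^sub>f rho0)) rho0"
  by (rule linear_eq_by_computation[OF assms,
        where T = "\<lambda>t. trie_add (trie_scale 6 (trie_rho_contr (trie_star t))) (trie_contr 2
            (trie_star (trie_wedge (trie_minus t) rho_trie)))" and c = "sqrt 3"],
      code_simp, simp_all add: form_of_simps form_of_excess excess_scaleR linear_pushes
          linear_intros' linear_excess')

lemma excess_wedge_rho:
  assumes "F \<in> Lam 4"
  shows "excess F \<and>\<^sub>f rho0 = 0"
  by (rule linear_eq_by_computation[OF assms,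
        where T = "\<lambda>t. trie_wedge (trie_excess t) rho_trie" and c = "3"],
      code_simp, simp_all add: form_of_simps form_of_excess excess_scaleR linear_pushes
          linear_intros' linear_excess')

lemma excess_wedge_hodge_rho:
  assumes "F \<in> Lam 4"
  shows "excess F \<and>\<^sub>f hodge rho0 = 0"
  by (rule linear_eq_by_computation[OF assms,
        where T = "\<lambda>t. trie_wedge (trie_excess t) (trie_star rho_trie)" and c = "3 * sqrt 3"],
      code_simp, simp_all add: form_of_simps form_of_excess excess_scaleR linear_pushes
          linear_intros' linear_excess')

text \<open>All corrections contain T ^ rho, T ^ hodge rho or sigma_- T and disappear on
  Lambda^3_27, which leaves the factor 16.\<close>

lemma minus_plus_Lam3:
  assumes "T \<in> Lam 3"
  shows "sigma_minus (sigma_plus T) = 16 *\<^sub>R T + hodge (hodge (T \<and>\<^sub>f hodge rho0) \<and>\<^sub>f hodge rho0)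
    - sigma_plus (sigma_minus T) + hodge (hodge (T \<and>\<^sub>f rho0) \<and>\<^sub>f rho0)"
  by (rule linear_eq_by_computation[OF assms,
        where T = "\<lambda>t. trie_add (trie_scale 9 (trie_minus (trie_plus t))) (trie_add (trie_scale
            (-144) t) (trie_add (trie_neg (trie_star (trie_wedge (trie_star (trie_wedge t (trie_star
            rho_trie))) (trie_star rho_trie)))) (trie_add (trie_scale 9 (trie_plus (trie_minus t)))
            (trie_scale (-3) (trie_star (trie_wedge (trie_star (trie_wedge t rho_trie))
            (rho_trie)))))))" and c = "9"],
      code_simp, simp_all add: form_of_simps form_of_excess excess_scaleR linear_pushes
          linear_intros' linear_excess')

lemma contr_3_hodge_rho_wedge:
  assumes "X \<in> Lam 1"
  shows "contr 3 rho0 (hodge (rho0 \<and>\<^sub>f X)) = 0"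
  by (rule linear_eq_by_computation[OF assms,
        where T = "\<lambda>t. trie_rho_contr (trie_star (trie_wedge rho_trie t))" and c = "sqrt 3"],
      code_simp, simp_all add: form_of_simps form_of_excess excess_scaleR linear_pushes
          linear_intros' linear_excess')

lemma hodge_hodge_Lam4:
  assumes "F \<in> Lam 4"
  shows "hodge (hodge F) = F"
  by (rule linear_eq_by_computation[OF assms,
        where T = "\<lambda>t. trie_add (trie_star (trie_star t)) (trie_scale (-3) t)" and c = "3"],
      code_simp, simp_all add: form_of_simps form_of_excess excess_scaleR linear_pushes
          linear_intros' linear_excess')

section \<open>Degrees\<close>

declare One_nat_def [simp del]

lemma subspace_Lam: "subspace (Lam k)"
  unfolding Lam_def by (intro subspaceI) (auto, metis add_cancel_left_left)

lemmas Lam_zero = subspace_0[OF subspace_Lam]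
  and Lam_add = subspace_add[OF subspace_Lam]
  and Lam_diff = subspace_diff[OF subspace_Lam]
  and Lam_scaleR = subspace_scale[OF subspace_Lam]
  and Lam_minus = subspace_neg[OF subspace_Lam]
  and Lam_sum = subspace_sum[OF subspace_Lam]

lemma axis_Lam: "card I = k \<Longrightarrow> axis I c \<in> Lam k"
  by (auto simp: Lam_def axis_def split: if_splits)

lemma covec_Lam: "covec i \<in> Lam 1"
  by (simp add: covec_def axis_Lam)

lemma wedge_Lam:
  assumes "\<alpha> \<in> Lam k" "\<beta> \<in> Lam l" "m = k + l"
  shows "\<alpha> \<and>\<^sub>f \<beta> \<in> Lam m"
  unfolding Lam_def
proof (intro CollectI allI impI)
  fix K assume "(\<alpha> \<and>\<^sub>f \<beta>) $ K \<noteq> 0"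
  then obtain I where I: "I \<subseteq> K" "\<alpha> $ I \<noteq> 0" "\<beta> $ (K - I) \<noteq> 0"
    unfolding wedge_def vec_lambda_beta by (auto elim: sum.not_neutral_contains_not_neutral)
  then have "card I = k" "card (K - I) = l" using assms by (auto simp: Lam_def)
  then show "card K = m"
    using card_Diff_subset[of I K] card_mono[of K I] I(1) assms(3) by simp
qed

lemma ins_axis_Lam:
  assumes "\<alpha> \<in> Lam (Suc k)"
  shows "ins (axis i 1) \<alpha> \<in> Lam k"
  unfolding Lam_def
proof (intro CollectI allI impI)
  fix I assume "ins (axis i 1) \<alpha> $ I \<noteq> 0"
  then have "i \<notin> I" "\<alpha> $ insert i I \<noteq> 0" by (auto simp: ins_axis_nth split: if_splits)
  then show "card I = k" using assms by (auto simp: Lam_def)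
qed

lemma ins_basis_Lam:
  assumes "\<alpha> \<in> Lam (card S + k)"
  shows "ins_basis S \<alpha> \<in> Lam k"
proof -
  have "foldr (\<lambda>i. ins (axis i 1)) xs \<alpha> \<in> Lam k" if "\<alpha> \<in> Lam (length xs + k)" for xs :: "8 list" and k
    using that
  proof (induction xs arbitrary: k)
    case (Cons x xs)
    then show ?case using Cons.IH[of "Suc k"] by (auto intro: ins_axis_Lam)
  qed simp
  from this[of "sorted_list_of_set S" k] show ?thesis
    using assms by (simp add: ins_basis_def)
qed

lemma sigma_Lam:
  assumes "\<alpha> \<in> Lam k" "\<beta> \<in> Lam l" "j \<le> k" "j \<le> l" "m = k + l - 2 * j"
  shows "sigma j \<alpha> \<beta> \<in> Lam m"
  unfolding sigma_def
proof (intro Lam_sum)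
  fix S :: "8 set" assume "S \<in> {S. card S = j}"
  then show "ins_basis S \<alpha> \<and>\<^sub>f ins_basis S \<beta> \<in> Lam m"
    using assms by (intro wedge_Lam[of _ "k - j" _ "l - j"] ins_basis_Lam) auto
qed

lemma hodge_Lam:
  assumes "\<alpha> \<in> Lam k" "l = 8 - k"
  shows "hodge \<alpha> \<in> Lam l"
  unfolding Lam_def
proof (intro CollectI allI impI)
  fix J assume "hodge \<alpha> $ J \<noteq> 0"
  then have "card (- J) = k" using assms by (auto simp: hodge_def Lam_def)
  moreover have "card J \<le> CARD(8)" by (rule card_mono) auto
  moreover have "card (- J) = CARD(8) - card J"
    by (simp add: Compl_eq_Diff_UNIV card_Diff_subset)
  ultimately show "card J = l" using assms(2) by simp
qed

lemma rho0_Lam: "rho0 \<in> Lam 3"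
proof -
  have "e i \<and>\<^sub>f e j \<and>\<^sub>f e k \<in> Lam 3" for i j k
    unfolding e_def by (intro wedge_Lam[of _ 1 _ 2] wedge_Lam[of _ 1 _ 1] covec_Lam) auto
  moreover have "(e i \<and>\<^sub>f e j) \<and>\<^sub>f e k \<in> Lam 3" for i j k
    unfolding e_def by (intro wedge_Lam[of _ 2 _ 1] wedge_Lam[of _ 1 _ 1] covec_Lam) auto
  ultimately show ?thesis
    unfolding rho0_def wedge_add_left wedge_diff_left wedge_scaleR_left
    by (intro Lam_add Lam_diff Lam_scaleR) auto
qed

lemma sigma_plus_Lam: "\<alpha> \<in> Lam k \<Longrightarrow> 1 \<le> k \<Longrightarrow> l = Suc k \<Longrightarrow> sigma_plus \<alpha> \<in> Lam l"
  unfolding sigma_plus_def by (rule sigma_Lam[OF rho0_Lam]) auto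

lemma sigma_minus_Lam: "\<alpha> \<in> Lam k \<Longrightarrow> 2 \<le> k \<Longrightarrow> l = k - 1 \<Longrightarrow> sigma_minus \<alpha> \<in> Lam l"
  unfolding sigma_minus_def by (rule sigma_Lam[OF rho0_Lam]) auto

lemma contr_rho0_Lam:
  assumes "\<alpha> \<in> Lam k" "k \<le> 3" "l = 3 - k"
  shows "contr k \<alpha> rho0 \<in> Lam l"
  by (rule sigma_Lam[OF assms(1) rho0_Lam]) (use assms in auto)

lemma contr_2_rho0_Lam: "\<omega> \<in> Lam 2 \<Longrightarrow> contr 2 \<omega> rho0 \<in> Lam 1"
  by (rule contr_rho0_Lam) linarith+

lemma contr_1_rho0_Lam: "X \<in> Lam 1 \<Longrightarrow> contr 1 X rho0 \<in> Lam 2"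
  by (rule contr_rho0_Lam) linarith+

lemma contr_3_rho0_Lam: "\<alpha> \<in> Lam 4 \<Longrightarrow> contr 3 rho0 \<alpha> \<in> Lam 1"
  by (rule sigma_Lam[OF rho0_Lam]) auto

lemma hodge_Lam_4: "\<alpha> \<in> Lam 4 \<Longrightarrow> hodge \<alpha> \<in> Lam 4"
  by (rule hodge_Lam) auto

lemma rho0_wedge_Lam_1: "X \<in> Lam 1 \<Longrightarrow> rho0 \<and>\<^sub>f X \<in> Lam 4"
  by (rule wedge_Lam[OF rho0_Lam, of X 1]) simp_all

lemma excess_Lam: "F \<in> Lam 4 \<Longrightarrow> excess F \<in> Lam 3"
  unfolding excess_def
  by (intro sigma_minus_Lam[of _ 4] Lam_diff Lam_scaleR hodge_Lam_4 rho0_wedge_Lam_1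
      contr_3_rho0_Lam) auto

lemma Lam_1_expand:
  assumes "X \<in> Lam 1"
  shows "X = (\<Sum>j\<in>UNIV. X $ {j} *\<^sub>R covec j)"
proof -
  have "X $ K = (\<Sum>j\<in>UNIV. X $ {j} *\<^sub>R covec j) $ K" for K
  proof (cases "\<exists>j. K = {j}")
    case True
    then obtain j where j: "K = {j}" by blast
    have "(\<Sum>i\<in>UNIV. X $ {i} *\<^sub>R covec i) $ K = (\<Sum>i\<in>UNIV. if i = j then X $ {j} else 0)"
      unfolding sum_component j by (intro sum.cong) (auto simp: covec_def axis_def)
    then show ?thesis using j by simp
  next
    case False
    then have "X $ K = 0" using assms card_1_singletonE[of K] by (auto simp: Lam_def)
    moreover have "(\<Sum>i\<in>UNIV. X $ {i} *\<^sub>R covec i) $ K = 0"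
      unfolding sum_component using False by (intro sum.neutral) (auto simp: covec_def axis_def)
    ultimately show ?thesis by simp
  qed
  then show ?thesis by (subst vec_eq_iff) (rule allI)
qed


section \<open>The projection onto m\<close>

lemma wedge_hodge_UNIV: "(\<alpha> \<and>\<^sub>f hodge \<beta>) $ UNIV = \<alpha> \<bullet> \<beta>"
  by (simp add: wedge_def hodge_def inner_vec_def Compl_eq_Diff_UNIV[symmetric])
    (rule sum.cong, simp_all add: mult_ac)

lemma inner_ins_axis: "ins (axis i 1) \<alpha> \<bullet> \<beta> = \<alpha> \<bullet> (covec i \<and>\<^sub>f \<beta>)"
proof -
  have "ins (axis i 1) \<alpha> \<bullet> \<beta> = (\<Sum>I | i \<notin> I. shuffle_sign {i} I * \<alpha> $ insert i I * \<beta> $ I)"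
    unfolding inner_vec_def by (rule sum.mono_neutral_cong_right) (auto simp: ins_axis_nth)
  also have "\<dots> = (\<Sum>K | i \<in> K. shuffle_sign {i} (K - {i}) * \<alpha> $ K * \<beta> $ (K - {i}))"
    by (rule sum.reindex_bij_witness[of _ "\<lambda>K. K - {i}" "insert i"]) (auto simp: insert_absorb)
  also have "\<dots> = \<alpha> \<bullet> (covec i \<and>\<^sub>f \<beta>)"
    unfolding inner_vec_def by (rule sum.mono_neutral_cong_left) (auto simp: covec_wedge_nth)
  finally show ?thesis .
qed

lemma hodge_eq_0_iff: "hodge \<alpha> = 0 \<longleftrightarrow> \<alpha> = 0"
proof
  assume "hodge \<alpha> = 0"
  then have "\<alpha> $ (- J) = 0" for J
    by (auto simp: hodge_def vec_eq_iff shuffle_sign_def)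
  then have "\<alpha> $ K = 0" for K
    using double_complement by metis
  then show "\<alpha> = 0" by (simp add: vec_eq_iff)
qed (simp add: linear_0[OF linear_hodge])

lemma Lam2_20_iff: "\<omega> \<in> Lam2_20 \<longleftrightarrow> \<omega> \<in> Lam 2 \<and> contr 2 \<omega> rho0 = 0"
  by (auto simp: Lam2_20_def wedge_hodge_rho hodge_eq_0_iff)

lemma subspace_Lam2_20: "subspace Lam2_20"
  by (intro subspaceI)
    (auto simp: Lam2_20_iff Lam_zero Lam_add Lam_scaleR sigma_add_left sigma_scaleR_left)

lemma contr_1_covec: "contr 1 (covec i) rho0 = ins (axis i 1) rho0"
  using contr_1_summand[OF axis_Lam[of "{}" 0 1], of i] by simp

text \<open>Contraction is adjoint to exterior multiplication, so the inner product of e_j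
  contracted into rho with \<nu> is the top coefficient of e_j ^ \<nu> ^ hodge rho, which is zero by
  the definition of \<open>Lam2_20\<close>.\<close>

lemma contr_1_orthogonal_Lam2_20:
  assumes "X \<in> Lam 1" "\<nu> \<in> Lam2_20"
  shows "orthogonal (contr 1 X rho0) \<nu>"
proof -
  have "ins (axis j 1) rho0 \<bullet> \<nu> = 0" for j
  proof -
    have "(covec j \<and>\<^sub>f \<nu>) \<and>\<^sub>f hodge rho0 = 0"
      using assms(2) by (simp add: covec_wedge_assoc Lam2_20_def)
    then have "(covec j \<and>\<^sub>f \<nu>) \<bullet> rho0 = 0"
      by (simp flip: wedge_hodge_UNIV)
    then show ?thesis
      using inner_ins_axis[of j rho0 \<nu>] by (simp only: inner_commute)
  qed
  then have "(\<Sum>j\<in>UNIV. X $ {j} *\<^sub>R contr 1 (covec j) rho0) \<bullet> \<nu> = 0"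
    by (simp add: contr_1_covec inner_sum_left)
  moreover have "contr 1 X rho0 = (\<Sum>j\<in>UNIV. X $ {j} *\<^sub>R contr 1 (covec j) rho0)"
    by (subst Lam_1_expand[OF assms(1)]) (simp add: linear_sum[OF linear_sigma_left] sigma_scaleR_left)
  ultimately show ?thesis by (simp add: orthogonal_def)
qed

text \<open>The subtracted term is the projection onto Lambda^2_8; its normalisation 1/6 comes from
  \<open>contr_2_contr_1\<close>.\<close>

lemma pr_m_eq:
  assumes "\<omega> \<in> Lam 2"
  shows "pr_m \<omega> = \<omega> - (1/6) *\<^sub>R contr 1 (contr 2 \<omega> rho0) rho0"
proof -
  let ?\<mu> = "\<omega> - (1/6) *\<^sub>R contr 1 (contr 2 \<omega> rho0) rho0"
  have X: "contr 2 \<omega> rho0 \<in> Lam 1" by (rule contr_2_rho0_Lam[OF assms])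
  then have "contr 1 (contr 2 \<omega> rho0) rho0 \<in> Lam 2" by (rule contr_1_rho0_Lam)
  then have "?\<mu> \<in> Lam2_20"
    using assms X
    by (auto simp: Lam2_20_iff sigma_diff_left sigma_scaleR_left contr_2_contr_1 intro!: Lam_diff
        Lam_scaleR)
  moreover have "orthogonal (\<omega> - ?\<mu>) \<nu>" if "\<nu> \<in> Lam2_20" for \<nu>
    using contr_1_orthogonal_Lam2_20[OF X that] by (simp add: orthogonal_def)
  \<comment> \<open>Uniqueness, as required by the definite description: the difference of two
    candidates lies in the module and is orthogonal to itself.\<close>
  moreover have "\<mu> = ?\<mu>" if "\<mu> \<in> Lam2_20" "\<forall>\<nu>\<in>Lam2_20. orthogonal (\<omega> - \<mu>) \<nu>" for \<mu>
  proof -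
    have "\<mu> - ?\<mu> \<in> Lam2_20" using that(1) calculation(1) subspace_Lam2_20 subspace_diff by blast
    then have "(\<omega> - ?\<mu>) \<bullet> (\<mu> - ?\<mu>) = 0" "(\<omega> - \<mu>) \<bullet> (\<mu> - ?\<mu>) = 0"
      using that(2) calculation(2) by (auto simp: orthogonal_def)
    then have "((\<omega> - ?\<mu>) - (\<omega> - \<mu>)) \<bullet> (\<mu> - ?\<mu>) = 0"
      by (simp only: inner_diff_left)
    moreover have "(\<omega> - ?\<mu>) - (\<omega> - \<mu>) = \<mu> - ?\<mu>" by simp
    ultimately have "(\<mu> - ?\<mu>) \<bullet> (\<mu> - ?\<mu>) = 0" by metis
    then show ?thesis by (simp only: inner_eq_zero_iff right_minus_eq)
  qed
  ultimately show ?thesis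
    unfolding pr_m_def by (intro the_equality) blast+
qed

lemma pr_m_Lam2_20:
  assumes "\<omega> \<in> Lam 2"
  shows "pr_m \<omega> \<in> Lam2_20"
proof -
  have X: "contr 2 \<omega> rho0 \<in> Lam 1" by (rule contr_2_rho0_Lam[OF assms])
  then have "contr 1 (contr 2 \<omega> rho0) rho0 \<in> Lam 2" by (rule contr_1_rho0_Lam)
  then show ?thesis
    using assms X
    by (auto simp: pr_m_eq Lam2_20_iff sigma_diff_left sigma_scaleR_left contr_2_contr_1
        intro!: Lam_diff Lam_scaleR)
qed

text \<open>The part removed by the projection lies in psu(3) and annihilates rho; thus rho sees
  only the intrinsic torsion.\<close>

lemma sigma_1_pr_m:
  assumes "\<omega> \<in> Lam 2"
  shows "sigma 1 (pr_m \<omega>) rho0 = sigma 1 \<omega> rho0"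
  using contr_2_rho0_Lam[OF assms]
  by (simp add: pr_m_eq[OF assms] sigma_diff_left sigma_scaleR_left rho_invariant)

lemma pr_m_zero: "pr_m 0 = 0"
  by (simp add: pr_m_eq Lam_zero)


section \<open>Differential and co-differential of the intrinsic torsion\<close>

text \<open>The values of \<open>d\<rho>\<close> and \<open>\<delta>\<rho>\<close> in an adapted frame when \<open>\<nabla>\<^sub>X\<rho> = \<sigma>\<^sub>1(A(X), \<rho>)\<close>.\<close>

definition torsion_d :: "tensor \<Rightarrow> form" where
  "torsion_d A = (\<Sum>i\<in>UNIV. covec i \<and>\<^sub>f sigma 1 (A $ i) rho0)"

definition torsion_delta :: "tensor \<Rightarrow> form" where
  "torsion_delta A = - (\<Sum>i\<in>UNIV. ins (axis i 1) (sigma 1 (A $ i) rho0))"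

lemma linear_torsion_d: "linear torsion_d"
  by (rule linearI) (simp_all add: torsion_d_def sigma_add_left sigma_scaleR_left wedge_add_right
      wedge_scaleR_right sum.distrib scaleR_sum_right)

lemma linear_torsion_delta: "linear torsion_delta"
  by (rule linearI) (simp_all add: torsion_delta_def sigma_add_left sigma_scaleR_left ins_add_right
      ins_scaleR_right sum.distrib scaleR_sum_right)

definition torsion_space :: "tensor set" where
  "torsion_space = {A. \<forall>i. A $ i \<in> Lam2_20}"

lemma subspace_torsion_space: "subspace torsion_space"
  using subspace_Lam2_20 by (auto simp: torsion_space_def subspace_def)

lemma torsion_spaceD: "A \<in> torsion_space \<Longrightarrow> A $ i \<in> Lam 2"
  "A \<in> torsion_space \<Longrightarrow> contr 2 (A $ i) rho0 = 0"
  by (auto simp: torsion_space_def Lam2_20_iff)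

lemma torsion_d_Lam:
  assumes "A \<in> torsion_space"
  shows "torsion_d A \<in> Lam 4"
  unfolding torsion_d_def
  using assms by (intro Lam_sum wedge_Lam[OF covec_Lam] sigma_Lam[OF _ rho0_Lam]) (auto dest:
      torsion_spaceD)

lemma torsion_delta_Lam:
  assumes "A \<in> torsion_space"
  shows "torsion_delta A \<in> Lam 2"
  unfolding torsion_delta_def
  using assms by (intro Lam_minus Lam_sum ins_axis_Lam sigma_Lam[OF _ rho0_Lam]) (auto dest:
      torsion_spaceD)

lemma contr_2_torsion_delta:
  assumes "A \<in> torsion_space"
  shows "contr 2 (torsion_delta A) rho0 = contr 3 rho0 (torsion_d A)"
  unfolding torsion_delta_def torsion_d_def using assms
  by (simp add: linear_sum[OF linear_sigma_left] linear_sum[OF linear_sigma_right] sigma_minus_left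
      contr_2_summand torsion_spaceD sum_negf)

lemma Phi1_eq:
  assumes "A \<in> torsion_space"
  shows "12 *\<^sub>R Phi1 A = sigma_plus (torsion_delta A) - sigma_minus (torsion_d A)"
proof -
  have "12 *\<^sub>R Phi1 A = (\<Sum>i\<in>UNIV. 12 *\<^sub>R (covec i \<and>\<^sub>f A $ i))"
    by (simp add: Phi1_def scaleR_sum_right)
  also have "\<dots> = (\<Sum>i\<in>UNIV. - sigma_minus (covec i \<and>\<^sub>f sigma 1 (A $ i) rho0)
      - sigma_plus (ins (axis i 1) (sigma 1 (A $ i) rho0)))"
    using Phi1_summand[OF torsion_spaceD(1)[OF assms]] by (intro sum.cong) (auto simp:
        torsion_spaceD assms)
  finally show ?thesis
    by (simp add: torsion_d_def torsion_delta_def linear_sum[OF linear_sigma_plus]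
        linear_sum[OF linear_sigma_minus] linear_neg[OF linear_sigma_plus] sum_subtractf sum_negf)
qed

lemma torsion_d_eq:
  assumes "A \<in> torsion_space"
  shows "torsion_d A = Phi2 A - sigma_plus (Phi1 A)"
  using Phi2_summand[OF torsion_spaceD(1)[OF assms]]
  by (simp add: torsion_d_def Phi1_def Phi2_def linear_sum[OF linear_sigma_plus] sum_subtractf)

text \<open>D and Delta determine Phi_1, and then D determines Phi_2. Conversely, vanishing of Phi_1
  and Phi_2 gives D = 0, so that Delta has no Lambda^2_8 part and is annihilated by sigma_+.\<close>

lemma W_6_iff: "A \<in> W 6 \<longleftrightarrow> A \<in> torsion_space \<and> torsion_d A = 0 \<and> torsion_delta A = 0"
proof -
  have "Phi1 A = 0 \<and> Phi2 A = 0 \<longleftrightarrow> torsion_d A = 0 \<and> torsion_delta A = 0" if A: "A \<in> torsion_space"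
  proof
    assume "torsion_d A = 0 \<and> torsion_delta A = 0"
    then show "Phi1 A = 0 \<and> Phi2 A = 0"
      using Phi1_eq[OF A] torsion_d_eq[OF A] by (simp add: linear_pushes)
  next
    assume Phi: "Phi1 A = 0 \<and> Phi2 A = 0"
    then have d: "torsion_d A = 0" using torsion_d_eq[OF A] by (simp add: linear_pushes)
    have "sigma_plus (torsion_delta A) = 0" using Phi1_eq[OF A] Phi d by (simp add: linear_pushes)
    moreover have "contr 2 (torsion_delta A) rho0 = 0"
      using contr_2_torsion_delta[OF A] d by simp
    \<comment> \<open>On Lambda^2_20 the composition of sigma_- and sigma_+ is multiplication by
      12.\<close>
    ultimately have "12 *\<^sub>R torsion_delta A = 0"
      using minus_plus_Lam2[OF torsion_delta_Lam[OF A]] by (simp add: linear_pushes)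
    then show "torsion_d A = 0 \<and> torsion_delta A = 0" using d by simp
  qed
  then show ?thesis by (auto simp: W_def torsion_space_def)
qed

text \<open>The projection in \<open>Theta1\<close> is invisible by \<open>sigma_1_pr_m\<close>, and
  its factor -1/2 cancels the -2 of the summation identities.\<close>

lemma Theta1_torsion:
  assumes "T \<in> Lam 3"
  shows "Theta1 T \<in> torsion_space" "torsion_d (Theta1 T) = sigma_plus T"
    "torsion_delta (Theta1 T) = - sigma_minus T"
proof -
  have T: "ins (axis i 1) T \<in> Lam 2" for i using ins_axis_Lam[of T 2] assms by simp
  then show "Theta1 T \<in> torsion_space"
    using subspace_Lam2_20 pr_m_Lam2_20
    by (auto simp: torsion_space_def Theta1_def intro!: subspace_neg subspace_scale)
  have *: "sigma 1 (Theta1 T $ i) rho0 = - (1/2) *\<^sub>R sigma 1 (ins (axis i 1) T) rho0" for i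
    using sigma_1_pr_m[OF T] by (simp add: Theta1_def sigma_minus_left sigma_scaleR_left)
  show "torsion_d (Theta1 T) = sigma_plus T"
    using sum_covec_sigma_ins[OF assms]
    by (simp only: torsion_d_def * wedge_scaleR_right flip: scaleR_sum_right) simp
  show "torsion_delta (Theta1 T) = - sigma_minus T"
    using sum_ins_sigma_ins[OF assms]
    by (simp only: torsion_delta_def * ins_scaleR_right flip: scaleR_sum_right) simp
qed

lemma Theta2_torsion:
  assumes "F \<in> Lam 4"
  shows "Theta2 F \<in> torsion_space"
    "torsion_d (Theta2 F) =
      2 *\<^sub>R sigma_plus (sigma_minus F) + hodge (sigma_plus (sigma_minus (hodge F))) - 24 *\<^sub>R F"
    "torsion_delta (Theta2 F) = - 3 *\<^sub>R contr 1 (contr 3 rho0 F) rho0"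
proof -
  have T: "contr 2 (ins (axis i 1) rho0) F \<in> Lam 2" for i
    using ins_axis_Lam[of rho0 2] rho0_Lam assms by (intro sigma_Lam) auto
  then show "Theta2 F \<in> torsion_space"
    using subspace_Lam2_20 pr_m_Lam2_20
    by (auto simp: torsion_space_def Theta2_def intro!: subspace_neg)
  have *: "sigma 1 (Theta2 F $ i) rho0 = - sigma 1 (contr 2 (ins (axis i 1) rho0) F) rho0" for i
    using sigma_1_pr_m[OF T] by (simp add: Theta2_def sigma_minus_left)
  show "torsion_d (Theta2 F) =
      2 *\<^sub>R sigma_plus (sigma_minus F) + hodge (sigma_plus (sigma_minus (hodge F))) - 24 *\<^sub>R F"
    using sum_covec_sigma_contr[OF assms]
    by (simp only: torsion_d_def * wedge_minus_right sum_negf) simp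
  show "torsion_delta (Theta2 F) = - 3 *\<^sub>R contr 1 (contr 3 rho0 F) rho0"
    using sum_ins_sigma_contr[OF assms]
    by (simp only: torsion_delta_def * ins_minus_right sum_negf) simp
qed

section \<open>The decomposition of the torsion space\<close>

lemma minus_eq_0D:
  assumes "F \<in> Lam 4" "sigma_minus F = 0"
  shows "contr 3 rho0 (hodge F) = 0" "excess F = 0"
proof -
  show *: "contr 3 rho0 (hodge F) = 0"
    using contr_3_hodge[OF assms(1)] assms(2) by (simp add: linear_pushes)
  show "excess F = 0"
    unfolding excess_def * using assms(2) by (simp add: linear_pushes)
qed

lemma minus_hodge_eq_0D:
  assumes "F \<in> Lam 4" "sigma_minus (hodge F) = 0"
  shows "contr 3 rho0 F = 0" "excess (hodge F) = 0"
  using minus_eq_0D[OF hodge_Lam_4[OF assms(1)] assms(2)] by (simp_all add: hodge_hodge_Lam4 assms(1))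

text \<open>The hypothesis says that F consists only of its component in the dual of rho ^ Lambda^1,
  so the operators reading off the other three components vanish.\<close>

lemma hodge_eq_rho_wedgeD:
  assumes F: "F \<in> Lam 4" and eq: "10 *\<^sub>R hodge F = rho0 \<and>\<^sub>f contr 3 rho0 (hodge F)"
  shows "contr 3 rho0 F = 0" "excess F = 0" "excess (hodge F) = 0"
proof -
  let ?X = "contr 3 rho0 (hodge F)"
  have X: "?X \<in> Lam 1" by (intro contr_3_rho0_Lam hodge_Lam_4 F)
  have F_eq: "10 *\<^sub>R F = hodge (rho0 \<and>\<^sub>f ?X)"
    by (simp add: linear_pushes hodge_hodge_Lam4 F flip: eq)
  have "10 *\<^sub>R contr 3 rho0 F = contr 3 rho0 (10 *\<^sub>R F)"
    by (simp add: linear_pushes)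
  also have "\<dots> = 0"
    unfolding F_eq by (rule contr_3_hodge_rho_wedge[OF X])
  finally show *: "contr 3 rho0 F = 0" by simp
  show "excess F = 0"
    unfolding excess_def F_eq by (simp add: linear_pushes)
  show "excess (hodge F) = 0"
    unfolding excess_def eq hodge_hodge_Lam4[OF F] * by (simp add: linear_pushes minus_rho_wedge[OF X])
qed

lemma eq_rho_wedgeD:
  assumes F: "F \<in> Lam 4" and eq: "10 *\<^sub>R F = rho0 \<and>\<^sub>f contr 3 rho0 F"
  shows "contr 3 rho0 (hodge F) = 0" "excess F = 0" "excess (hodge F) = 0"
  using hodge_eq_rho_wedgeD[OF hodge_Lam_4[OF F]] eq by (simp_all add: hodge_hodge_Lam4 F)

section \<open>The values of D and Delta on the summands\<close>

lemma Lam3_8E: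
  assumes "T \<in> Lam3_8"
  obtains X where "X \<in> Lam 1" "T = hodge (sigma_plus X \<and>\<^sub>f rho0)"
  using assms by (auto simp: Lam3_8_def Lam2_8_def)

lemma Lam3_8_Lam:
  assumes "X \<in> Lam 1"
  shows "hodge (sigma_plus X \<and>\<^sub>f rho0) \<in> Lam 3"
proof -
  have "sigma_plus X \<in> Lam 2" by (rule sigma_plus_Lam[OF assms]) simp_all
  then have "sigma_plus X \<and>\<^sub>f rho0 \<in> Lam 5" by (rule wedge_Lam[OF _ rho0_Lam]) simp
  then show ?thesis by (rule hodge_Lam) simp
qed

text \<open>Identifies Lambda^4_8 with the dual of rho ^ Lambda^1.\<close>

lemma plus_Lam3_8:
  assumes "X \<in> Lam 1"
  shows "sigma_plus (hodge (sigma_plus X \<and>\<^sub>f rho0)) = 6 *\<^sub>R hodge (rho0 \<and>\<^sub>f X)"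
proof -
  have "sigma_plus (hodge (sigma_plus X \<and>\<^sub>f rho0)) \<in> Lam 4"
    by (rule sigma_plus_Lam[OF Lam3_8_Lam[OF assms]]) simp_all
  then have "sigma_plus (hodge (sigma_plus X \<and>\<^sub>f rho0)) =
      hodge (hodge (sigma_plus (hodge (sigma_plus X \<and>\<^sub>f rho0))))"
    by (rule hodge_hodge_Lam4[symmetric])
  then show ?thesis
    unfolding hodge_plus_Lam3_8[OF assms] by (simp add: linear_pushes)
qed

lemma sigma_plus_Lam_3: "T \<in> Lam 3 \<Longrightarrow> sigma_plus T \<in> Lam 4"
  by (rule sigma_plus_Lam) simp_all

lemma W_1D:
  assumes "A \<in> W 1"
  shows "A \<in> torsion_space" "torsion_delta A = 0" "sigma_minus (hodge (torsion_d A)) = 0"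
    "10 *\<^sub>R hodge (torsion_d A) = rho0 \<and>\<^sub>f contr 3 rho0 (hodge (torsion_d A))"
proof -
  obtain X where X: "X \<in> Lam 1" "A = Theta1 (hodge (sigma_plus X \<and>\<^sub>f rho0))"
    using assms by (auto simp: W_def elim: Lam3_8E)
  note T = Theta1_torsion[OF Lam3_8_Lam[OF X(1)], folded X(2)]
  show "A \<in> torsion_space" by (rule T)
  show "torsion_delta A = 0"
    using T by (simp add: minus_Lam3_8 X)
  have d: "hodge (torsion_d A) = 6 *\<^sub>R (rho0 \<and>\<^sub>f X)"
    using T by (simp add: hodge_plus_Lam3_8 X)
  show "sigma_minus (hodge (torsion_d A)) = 0"
    unfolding d by (simp add: linear_pushes minus_rho_wedge X)
  show "10 *\<^sub>R hodge (torsion_d A) = rho0 \<and>\<^sub>f contr 3 rho0 (hodge (torsion_d A))"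
    unfolding d by (simp add: linear_pushes contr_3_rho_wedge X)
qed

lemma sigma_plus_Lam2_20:
  assumes "\<omega> \<in> Lam2_20"
  shows "sigma_plus \<omega> \<in> Lam 3"
  using assms by (intro sigma_plus_Lam[of _ 2]) (auto simp: Lam2_20_iff)

lemma W_2D:
  assumes "A \<in> W 2"
  shows "A \<in> torsion_space" "torsion_d A = 0"
proof -
  obtain \<omega> where \<omega>: "\<omega> \<in> Lam2_20" "A = Theta1 (sigma_plus \<omega>)"
    using assms by (auto simp: W_def Lam3_20_def)
  note T = Theta1_torsion[OF sigma_plus_Lam2_20[OF \<omega>(1)], folded \<omega>(2)]
  show "A \<in> torsion_space" by (rule T)
  show "torsion_d A = 0"
    using T \<omega> by (simp add: plus_plus_Lam2 Lam2_20_iff)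
qed

lemma Lam3_27D:
  assumes "T \<in> Lam3_27"
  shows "T \<in> Lam 3" "sigma_minus T = 0" "contr 3 rho0 (hodge (sigma_plus T)) = 0"
    "sigma_minus (sigma_plus T) = 16 *\<^sub>R T"
proof -
  show T: "T \<in> Lam 3" using assms by (simp add: Lam3_27_def)
  have "4 *\<^sub>R sigma_minus T = 0"
    using minus_Lam3[OF T] assms by (simp add: Lam3_27_def linear_pushes)
  then show minus: "sigma_minus T = 0" by simp
  show "contr 3 rho0 (hodge (sigma_plus T)) = 0"
    using contr_3_hodge_plus[OF T] assms by (simp add: Lam3_27_def linear_pushes)
  show "sigma_minus (sigma_plus T) = 16 *\<^sub>R T"
    using minus_plus_Lam3[OF T] assms minus by (simp add: Lam3_27_def linear_pushes)
qed

lemma W_3D: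
  assumes "A \<in> W 3"
  shows "A \<in> torsion_space" "torsion_delta A = 0" "sigma_minus (hodge (torsion_d A)) = 0"
    "contr 3 rho0 (hodge (torsion_d A)) = 0"
proof -
  obtain T where T: "T \<in> Lam3_27" "A = Theta1 T"
    using assms by (auto simp: W_def)
  note A = Theta1_torsion[OF Lam3_27D(1)[OF T(1)], folded T(2)]
  show "A \<in> torsion_space" by (rule A)
  show "torsion_delta A = 0" "sigma_minus (hodge (torsion_d A)) = 0"
    "contr 3 rho0 (hodge (torsion_d A)) = 0"
    using A Lam3_27D[OF T(1)] by (simp_all add: minus_hodge_plus)
qed

text \<open>Here -18 = 6 - 24, and -30 = -3 * 10 with the 10 from
  \<open>contr_3_rho_wedge\<close>.\<close>

lemma Theta2_rho_wedge:
  assumes X: "X \<in> Lam 1"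
  shows "Theta2 (rho0 \<and>\<^sub>f X) \<in> torsion_space"
    "torsion_d (Theta2 (rho0 \<and>\<^sub>f X)) = - 18 *\<^sub>R (rho0 \<and>\<^sub>f X)"
    "torsion_delta (Theta2 (rho0 \<and>\<^sub>f X)) = - 30 *\<^sub>R contr 1 X rho0"
proof -
  note A = Theta2_torsion[OF rho0_wedge_Lam_1[OF X]]
  show "Theta2 (rho0 \<and>\<^sub>f X) \<in> torsion_space" by (rule A)
  show "torsion_d (Theta2 (rho0 \<and>\<^sub>f X)) = - 18 *\<^sub>R (rho0 \<and>\<^sub>f X)"
    unfolding A minus_rho_wedge[OF X] plus_minus_hodge_rho_wedge[OF X]
    by (simp add: linear_pushes hodge_hodge_Lam4 rho0_wedge_Lam_1 X flip: scaleR_diff_left)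
  show "torsion_delta (Theta2 (rho0 \<and>\<^sub>f X)) = - 30 *\<^sub>R contr 1 X rho0"
    unfolding A contr_3_rho_wedge[OF X] by (simp add: linear_pushes)
qed

lemma W_4D:
  assumes "A \<in> W 4"
  shows "A \<in> torsion_space" "sigma_minus (torsion_d A) = 0"
    "10 *\<^sub>R torsion_d A = rho0 \<and>\<^sub>f contr 3 rho0 (torsion_d A)"
    "6 *\<^sub>R torsion_delta A = contr 1 (contr 2 (torsion_delta A) rho0) rho0"
proof -
  obtain X where X: "X \<in> Lam 1" "A = Theta2 (hodge (sigma_plus (hodge (sigma_plus X \<and>\<^sub>f rho0))))"
    using assms by (auto simp: W_def Lam4_8_def elim!: Lam3_8E)
  \<comment> \<open>The factor 6 comes from \<open>hodge_plus_Lam3_8\<close>.\<close>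
  define Y where "Y = 6 *\<^sub>R X"
  have Y: "Y \<in> Lam 1" "A = Theta2 (rho0 \<and>\<^sub>f Y)"
    using X by (auto simp: Y_def hodge_plus_Lam3_8 Lam_scaleR linear_pushes)
  note A = Theta2_rho_wedge[OF Y(1), folded Y(2)]
  show "A \<in> torsion_space" by (rule A)
  show "sigma_minus (torsion_d A) = 0"
    "10 *\<^sub>R torsion_d A = rho0 \<and>\<^sub>f contr 3 rho0 (torsion_d A)"
    "6 *\<^sub>R torsion_delta A = contr 1 (contr 2 (torsion_delta A) rho0) rho0"
    unfolding A using Y by (simp_all add: linear_pushes minus_rho_wedge contr_3_rho_wedge
        contr_2_contr_1)
qed

text \<open>The scalar is 16 - 24, with sigma_- sigma_+ T = 16 T on Lambda^3_27.\<close>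

lemma Theta2_hodge_plus:
  assumes T: "T \<in> Lam3_27"
  shows "Theta2 (hodge (sigma_plus T)) \<in> torsion_space"
    "torsion_d (Theta2 (hodge (sigma_plus T))) = - 8 *\<^sub>R hodge (sigma_plus T)"
    "torsion_delta (Theta2 (hodge (sigma_plus T))) = 0"
proof -
  have T3: "T \<in> Lam 3" and sp: "sigma_plus T \<in> Lam 4"
    using Lam3_27D(1)[OF T] by (auto intro: sigma_plus_Lam_3)
  note A = Theta2_torsion[OF hodge_Lam_4[OF sp]]
  show "Theta2 (hodge (sigma_plus T)) \<in> torsion_space" by (rule A)
  show "torsion_d (Theta2 (hodge (sigma_plus T))) = - 8 *\<^sub>R hodge (sigma_plus T)"
    unfolding A hodge_hodge_Lam4[OF sp] minus_hodge_plus[OF T3] Lam3_27D(4)[OF T]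
    by (simp add: linear_pushes flip: scaleR_diff_left)
  show "torsion_delta (Theta2 (hodge (sigma_plus T))) = 0"
    unfolding A Lam3_27D(3)[OF T] by simp
qed

lemma W_5D:
  assumes "A \<in> W 5"
  shows "A \<in> torsion_space" "torsion_delta A = 0" "sigma_minus (torsion_d A) = 0"
proof -
  obtain T where T: "T \<in> Lam3_27" "A = Theta2 (hodge (sigma_plus T))"
    using assms by (auto simp: W_def Lam4_27_def)
  note A = Theta2_hodge_plus[OF T(1), folded T(2)]
  show "A \<in> torsion_space" "torsion_delta A = 0" "sigma_minus (torsion_d A) = 0"
    using A minus_hodge_plus[OF Lam3_27D(1)[OF T(1)]] by (simp_all add: linear_pushes)
qed

lemma excess_Lam3_27:
  assumes "F \<in> Lam 4"
  shows "c *\<^sub>R excess F \<in> Lam3_27"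
  using assms
  by (simp add: Lam3_27_def Lam_scaleR excess_Lam excess_wedge_rho excess_wedge_hodge_rho
      wedge_scaleR_left)

lemma Theta_zero: "Theta1 0 = 0" "Theta2 0 = 0"
  by (simp_all add: Theta1_def Theta2_def pr_m_zero vec_eq_iff)

text \<open>Five summands are synthesised so that their D and Delta add up to those of
  \<open>A\<close>; the remainder lies in W_6, whence 6 in \<open>J\<close>. For each index missing
  from \<open>J\<close>, the corresponding hypothesis makes the synthesised summand zero.\<close>

lemma W_sumI:
  assumes A: "A \<in> torsion_space" and J: "J \<subseteq> {1..6}" "6 \<in> J"
    and "1 \<in> J \<or> contr 3 rho0 (hodge (torsion_d A)) = 0"
    and "2 \<in> J \<or> 6 *\<^sub>R torsion_delta A = contr 1 (contr 2 (torsion_delta A) rho0) rho0"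
    and "3 \<in> J \<or> excess (torsion_d A) = 0"
    and "4 \<in> J \<or> contr 3 rho0 (torsion_d A) = 0"
    and "5 \<in> J \<or> excess (hodge (torsion_d A)) = 0"
  shows "A \<in> W_sum J"
proof -
  define F where "F = torsion_d A"
  define \<delta> where "\<delta> = torsion_delta A"
  have F: "F \<in> Lam 4" and \<delta>: "\<delta> \<in> Lam 2"
    using A by (simp_all add: F_def \<delta>_def torsion_d_Lam torsion_delta_Lam)
  have ct: "contr 2 \<delta> rho0 = contr 3 rho0 F"
    using contr_2_torsion_delta[OF A] by (simp add: F_def \<delta>_def)
  define X where "X = contr 3 rho0 (hodge F)"
  define Y where "Y = contr 3 rho0 F"
  have X: "X \<in> Lam 1" and Y: "Y \<in> Lam 1"
    by (simp_all add: X_def Y_def contr_3_rho0_Lam hodge_Lam_4 F)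
  \<comment> \<open>Six times the Lambda^2_20 part of \<delta>, because \<open>Y\<close> is also the
    contraction of \<delta> into rho.\<close>
  define \<mu> where "\<mu> = 6 *\<^sub>R \<delta> - contr 1 Y rho0"
  have \<mu>: "\<mu> \<in> Lam2_20"
    using \<delta> Y by (auto simp: Lam2_20_iff \<mu>_def Lam_diff Lam_scaleR contr_1_rho0_Lam linear_pushes
        contr_2_contr_1) (simp add: Y_def ct)
  \<comment> \<open>D multiplies by 6, and the required component of \<open>F\<close> is 1/10 of the
    dual of rho ^ X.\<close>
  define a1 where "a1 = Theta1 (hodge (sigma_plus ((1/60) *\<^sub>R X) \<and>\<^sub>f rho0))"
  \<comment> \<open>Delta Theta_1 sigma_+ is -12 on Lambda^2_20, and the required part of \<delta>
    is \<mu> / 6.\<close>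
  define a2 where "a2 = Theta1 (sigma_plus ((-1/72) *\<^sub>R \<mu>))"
  define a3 where "a3 = Theta1 ((1/160) *\<^sub>R excess F)"
  \<comment> \<open>1080 = 10 * 18 * 6, with 6 from \<open>hodge_plus_Lam3_8\<close> and -18 the
    scalar of D Theta_2. The Lambda^2_8 part of \<delta> then comes out right as well, since 30 /
    180 = 1/6.\<close>
  define a4 where "a4 = Theta2 (hodge (sigma_plus (hodge (sigma_plus ((-1/1080) *\<^sub>R Y) \<and>\<^sub>f rho0))))"
  \<comment> \<open>1280 = 8 * 160, with -8 the scalar of D Theta_2.\<close>
  define a5 where "a5 = Theta2 (hodge (sigma_plus ((-1/1280) *\<^sub>R excess (hodge F))))"
  define a6 where "a6 = A - (a1 + a2 + a3 + a4 + a5)"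
  have X': "(1/60) *\<^sub>R X \<in> Lam 1" and Y': "(-1/1080) *\<^sub>R Y \<in> Lam 1"
    using X Y by (simp_all only: Lam_scaleR)
  have \<mu>': "(-1/72) *\<^sub>R \<mu> \<in> Lam2_20"
    using \<mu> subspace_Lam2_20 by (rule subspace_scale[rotated])
  note E3 = excess_Lam3_27[OF F, of "1/160"] and E5 = excess_Lam3_27[OF hodge_Lam_4[OF F], of "-1/1280"]
  have W: "a1 \<in> W 1" "a2 \<in> W 2" "a3 \<in> W 3" "a4 \<in> W 4" "a5 \<in> W 5"
    using X' Y' \<mu>' E3 E5
    unfolding a1_def a2_def a3_def a4_def a5_def W_def Lam3_8_def Lam2_8_def Lam3_20_def Lam4_8_def
        Lam4_27_def
    by (simp_all, blast+)
  have t1: "torsion_d a1 = (1/10) *\<^sub>R hodge (rho0 \<and>\<^sub>f X)" "torsion_delta a1 = 0"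
    unfolding a1_def Theta1_torsion[OF Lam3_8_Lam[OF X']] plus_Lam3_8[OF X'] minus_Lam3_8[OF X']
    by (simp_all add: linear_pushes)
  have t2: "torsion_d a2 = 0" "torsion_delta a2 = (1/6) *\<^sub>R \<mu>"
    unfolding a2_def Theta1_torsion[OF sigma_plus_Lam2_20[OF \<mu>']]
    using \<mu> by (simp_all add: Lam2_20_iff plus_plus_Lam2 minus_plus_Lam2 linear_pushes)
  have t3: "torsion_d a3 = (1/160) *\<^sub>R sigma_plus (excess F)" "torsion_delta a3 = 0"
    unfolding a3_def Theta1_torsion[OF Lam3_27D(1)[OF E3]] Lam3_27D(2)[OF E3] by (simp_all add:
        linear_pushes)
  have a4: "a4 = Theta2 (rho0 \<and>\<^sub>f ((-1/180) *\<^sub>R Y))"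
    unfolding a4_def hodge_plus_Lam3_8[OF Y'] by (simp add: linear_pushes)
  have Y'': "(-1/180) *\<^sub>R Y \<in> Lam 1" using Y by (simp only: Lam_scaleR)
  have t4: "torsion_d a4 = (1/10) *\<^sub>R (rho0 \<and>\<^sub>f Y)" "torsion_delta a4 = (1/6) *\<^sub>R contr 1 Y rho0"
    unfolding a4 Theta2_rho_wedge[OF Y''] by (simp_all add: linear_pushes)
  have t5: "torsion_d a5 = (1/160) *\<^sub>R hodge (sigma_plus (excess (hodge F)))" "torsion_delta a5 = 0"
    unfolding a5_def Theta2_hodge_plus[OF E5] by (simp_all add: linear_pushes)
  have "a6 \<in> W 6"
    unfolding W_6_iff
  proof (intro conjI)
    show "a6 \<in> torsion_space"
      unfolding a6_def using A W_1D(1) W_2D(1) W_3D(1) W_4D(1) W_5D(1) W subspace_torsion_space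
      by (intro subspace_diff subspace_add) auto
    have "160 *\<^sub>R torsion_d a6 = 160 *\<^sub>R F - 160 *\<^sub>R (torsion_d a1 + torsion_d a2 + torsion_d a3 +
        torsion_d a4 + torsion_d a5)"
      by (simp add: a6_def F_def linear_diff[OF linear_torsion_d] linear_add[OF linear_torsion_d]
          scaleR_diff_right)
    \<comment> \<open>The five values are the terms of \<open>Lam4_decomposition\<close>, divided by
      160.\<close>
    also have "\<dots> = 0"
      unfolding Lam4_decomposition[OF F] t1 t2 t3 t4 t5 by (simp add: X_def Y_def scaleR_add_right)
    finally show "torsion_d a6 = 0" by simp
    have "torsion_delta a6 = \<delta> - (torsion_delta a1 + torsion_delta a2 + torsion_delta a3 +
        torsion_delta a4 + torsion_delta a5)"
      by (simp add: a6_def \<delta>_def linear_diff[OF linear_torsion_delta] linear_add[OF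
          linear_torsion_delta])
    also have "\<dots> = 0"
      unfolding t1 t2 t3 t4 t5 by (simp add: \<mu>_def scaleR_diff_right)
    finally show "torsion_delta a6 = 0" .
  qed
  define a where "a k = (if k = 1 then a1 else if k = 2 then a2 else if k = 3 then a3 else if k = 4
      then a4
    else if k = 5 then a5 else a6)" for k :: nat
  have "{1..6} = {1, 2, 3, 4, 5, 6 :: nat}" by auto
  then have "A = sum a {1..6}"
    by (simp add: a_def a6_def)
  also have "\<dots> = sum a J"
  proof (rule sum.mono_neutral_right)
    show "\<forall>k\<in>{1..6} - J. a k = 0"
    proof
      fix k assume k: "k \<in> {1..6} - J"
      then have "1 \<le> k \<and> k \<le> 6 \<and> k \<noteq> 6" using J(2) by auto
      then consider "k = 1" | "k = 2" | "k = 3" | "k = 4" | "k = 5" by arith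
      then show "a k = 0"
        by cases (use k assms(4-8) ct in \<open>auto simp: a_def a1_def a2_def a3_def a4_def a5_def X_def
            Y_def \<mu>_def
          F_def[symmetric] \<delta>_def[symmetric] Theta_zero linear_pushes\<close>)
    qed
  qed (use J in auto)
  finally have "A = sum a J" .
  moreover have "a k \<in> W k" if "k \<in> J" for k
  proof -
    have "1 \<le> k \<and> k \<le> 6" using that J(1) by auto
    then consider "k = 1" | "k = 2" | "k = 3" | "k = 4" | "k = 5" | "k = 6" by arith
    then show ?thesis
      by cases (use W \<open>a6 \<in> W 6\<close> in \<open>simp_all add: a_def\<close>)
  qed
  ultimately show ?thesis by (auto simp: W_sum_def)
qed

section \<open>Pull-back\<close>

lemma linear_fold_ins: "linear (fold (\<lambda>i. ins (E i)) xs)"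
proof (induction xs)
  case (Cons x xs)
  then show ?case by (simp add: linear_compose[OF linear_ins, unfolded o_def])
qed (simp add: linear_id[unfolded id_def])

lemma fold_ins_ins:
  "fold (\<lambda>i. ins (E i)) xs (ins v \<alpha>) = (-1) ^ length xs *\<^sub>R ins v (fold (\<lambda>i. ins (E i)) xs \<alpha>)"
proof (induction xs arbitrary: \<alpha>)
  case (Cons x xs)
  show ?case
    using Cons[of "ins (E x) \<alpha>"] by (simp add: ins_ins_anticommute[of "E x" v] linear_neg[OF
        linear_fold_ins])
qed simp

lemma fold_ins_self:
  assumes "k \<in> set xs"
  shows "fold (\<lambda>i. ins (E i)) xs (ins (E k) \<alpha>) = 0"
proof -
  obtain ys zs where xs: "xs = ys @ k # zs" using assms by (auto dest: split_list)
  then show ?thesis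
    by (simp add: fold_ins_ins ins_scaleR_right linear_0[OF linear_fold_ins])
qed

text \<open>Moving \<open>E k\<close> to the first slot passes exactly the vectors with smaller
  index.\<close>

lemma fold_ins_insort:
  assumes "sorted xs" "distinct xs" "k \<notin> set xs"
  shows "fold (\<lambda>i. ins (E i)) (insort k xs) \<alpha> =
    shuffle_sign {k} (set xs) *\<^sub>R fold (\<lambda>i. ins (E i)) xs (ins (E k) \<alpha>)"
  using assms
proof (induction xs arbitrary: \<alpha>)
  case (Cons x xs)
  show ?case
  proof (cases "k \<le> x")
    case True
    then have none: "{(i, j). i \<in> {k} \<and> j \<in> set (x # xs) \<and> j < i} = {}"
      using Cons.prems by fastforce
    have "shuffle_sign {k} (set (x # xs)) = 1"
      unfolding shuffle_sign_def none by simp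
    then show ?thesis using True by simp
  next
    case False
    have sign: "shuffle_sign {k} (insert x (set xs)) = - shuffle_sign {k} (set xs)"
      using shuffle_sign_Un_right[of "{x}" "set xs" "{k}"] False Cons.prems
      by (simp add: shuffle_sign_singletons)
    show ?thesis
      using False Cons.IH[of "ins (E x) \<alpha>"] Cons.prems
      by (simp add: sign ins_ins_anticommute[of "E k" "E x"] linear_neg[OF linear_fold_ins])
  qed
qed simp

lemma linear_pull: "linear (pull E)"
  by (rule linearI)
    (simp_all add: pull_def vec_eq_iff linear_add[OF linear_fold_ins] linear_cmul[OF linear_fold_ins])

lemmas pull_add = linear_add[OF linear_pull]
  and pull_diff = linear_diff[OF linear_pull]
  and pull_minus = linear_neg[OF linear_pull]
  and pull_scaleR = linear_cmul[OF linear_pull]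
  and pull_sum = linear_sum[OF linear_pull]

lemma pull_empty [simp]: "pull E \<alpha> $ {} = \<alpha> $ {}"
  by (simp add: pull_def)

lemma pull_ins: "pull E (ins (E k) \<alpha>) = ins (axis k 1) (pull E \<alpha>)"
proof -
  have "pull E (ins (E k) \<alpha>) $ I = ins (axis k 1) (pull E \<alpha>) $ I" for I
  proof (cases "k \<in> I")
    case True
    then show ?thesis
      using fold_ins_self[of k "sorted_list_of_set I" E \<alpha>] by (simp add: pull_def ins_axis_nth)
  next
    case False
    have "sorted_list_of_set (insert k I) = insort k (sorted_list_of_set I)"
      using False by simp
    then show ?thesis
      using False fold_ins_insort[of "sorted_list_of_set I" k E \<alpha>] by (simp add: pull_def ins_axis_nth)
  qed
  then show ?thesis by (simp add: vec_eq_iff)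
qed

text \<open>Coefficients are reached by successive contractions. Identities of forms can thus be
  proved by induction on the index set, for all forms at once, as soon as both sides commute with
  contraction; the pull-back rules below are obtained in this way.\<close>

lemma nth_insert_eq_ins: "k \<notin> J \<Longrightarrow> \<alpha> $ insert k J = shuffle_sign {k} J * ins (axis k 1) \<alpha> $ J"
  by (simp add: ins_axis_nth)

lemma pull_covec_wedge: "pull E (covec i \<and>\<^sub>f \<beta>) = (\<Sum>a\<in>UNIV. E a $ i *\<^sub>R (covec a \<and>\<^sub>f pull E \<beta>))"
proof -
  have "pull E (covec i \<and>\<^sub>f \<beta>) $ I = (\<Sum>a\<in>UNIV. E a $ i *\<^sub>R (covec a \<and>\<^sub>f pull E \<beta>)) $ I" for I
    using finite[of I]
  proof (induction I arbitrary: \<beta> rule: finite_induct)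
    case empty
    then show ?case by (simp add: covec_wedge_nth)
  next
    case (insert k J)
    have "ins (axis k 1) (pull E (covec i \<and>\<^sub>f \<beta>)) =
        E k $ i *\<^sub>R pull E \<beta> - pull E (covec i \<and>\<^sub>f ins (E k) \<beta>)"
      by (simp add: ins_covec_wedge pull_diff pull_scaleR flip: pull_ins)
    moreover have "ins (axis k 1) (\<Sum>a\<in>UNIV. E a $ i *\<^sub>R (covec a \<and>\<^sub>f pull E \<beta>)) =
        E k $ i *\<^sub>R pull E \<beta> - (\<Sum>a\<in>UNIV. E a $ i *\<^sub>R (covec a \<and>\<^sub>f pull E (ins (E k) \<beta>)))"
    proof -
      have "ins (axis k 1) (\<Sum>a\<in>UNIV. E a $ i *\<^sub>R (covec a \<and>\<^sub>f pull E \<beta>)) =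
          (\<Sum>a\<in>UNIV. (if a = k then E k $ i *\<^sub>R pull E \<beta> else 0) - E a $ i *\<^sub>R (covec a \<and>\<^sub>f pull E
              (ins (E k) \<beta>)))"
        unfolding ins_sum_right
        by (intro sum.cong) (auto simp: ins_scaleR_right ins_covec_wedge pull_ins axis_nth_if
            scaleR_diff_right)
      then show ?thesis by (simp add: sum_subtractf)
    qed
    ultimately show ?case
      unfolding nth_insert_eq_ins[OF insert.hyps(2)]
      by (simp only: vector_minus_component insert.IH)
  qed
  then show ?thesis by (simp add: vec_eq_iff)
qed

lemma pull_pull: "pull A (pull E \<alpha>) = pull (\<lambda>j. \<Sum>i\<in>UNIV. A j $ i *\<^sub>R E i) \<alpha>"
proof -
  have "pull A (pull E \<alpha>) $ I = pull (\<lambda>j. \<Sum>i\<in>UNIV. A j $ i *\<^sub>R E i) \<alpha> $ I" for I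
    using finite[of I]
  proof (induction I arbitrary: \<alpha> rule: finite_induct)
    case (insert k J)
    let ?B = "\<lambda>j. \<Sum>i\<in>UNIV. A j $ i *\<^sub>R E i"
    have "ins (axis k 1) (pull A (pull E \<alpha>)) = pull A (ins (A k) (pull E \<alpha>))"
      by (rule pull_ins[symmetric])
    also have "ins (A k) (pull E \<alpha>) = pull E (ins (?B k) \<alpha>)"
      by (simp add: ins_eq_sum[of "A k"] ins_sum_left ins_scaleR_left pull_sum pull_scaleR pull_ins)
    finally show ?case
      unfolding nth_insert_eq_ins[OF insert.hyps(2)]
      by (simp only: insert.IH pull_ins[of ?B k])
  qed simp
  then show ?thesis by (simp add: vec_eq_iff)
qed

section \<open>Differentiation of pull-backs along a moving frame\<close>

lemma has_derivative_ins:
  assumes "(v has_derivative v') (at x)" "(\<alpha> has_derivative \<alpha>') (at x)"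
  shows "((\<lambda>y. ins (v y) (\<alpha> y)) has_derivative (\<lambda>h. ins (v x) (\<alpha>' h) + ins (v' h) (\<alpha> x))) (at x)"
  using bilinear_ins assms by (intro bounded_bilinear.FDERIV) (simp add: bilinear_conv_bounded_bilinear)

text \<open>The product rule: differentiating the frame vectors one slot at a time acts as a
  derivation on the form.\<close>

lemma has_derivative_pull:
  assumes E: "\<And>i. (E i has_derivative E' i) (at x)"
    and "(\<alpha> has_derivative \<alpha>') (at x)"
  shows "((\<lambda>y. pull (\<lambda>i. E i y) (\<alpha> y)) has_derivative
    (\<lambda>h. pull (\<lambda>i. E i x) (\<alpha>' h) +
      (\<Sum>i\<in>UNIV. covec i \<and>\<^sub>f pull (\<lambda>i. E i x) (ins (E' i h) (\<alpha> x))))) (at x)"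
proof -
  let ?P = "pull (\<lambda>i. E i x)"
  let ?D = "\<lambda>\<alpha>' \<alpha>\<^sub>0 h. ?P (\<alpha>' h) + (\<Sum>i\<in>UNIV. covec i \<and>\<^sub>f ?P (ins (E' i h) \<alpha>\<^sub>0))"
  have "((\<lambda>y. pull (\<lambda>i. E i y) (\<alpha> y) $ I) has_derivative (\<lambda>h. ?D \<alpha>' (\<alpha> x) h $ I)) (at x)" for I
    using finite[of I] assms(2)
  proof (induction I arbitrary: \<alpha> \<alpha>' rule: finite_induct)
    case empty
    then show ?case
      by (auto simp: covec_wedge_nth intro: bounded_linear.has_derivative[OF bounded_linear_vec_nth])
  next
    case (insert k J)
    let ?\<beta> = "\<lambda>y. ins (E k y) (\<alpha> y)"
    let ?\<beta>' = "\<lambda>h. ins (E k x) (\<alpha>' h) + ins (E' k h) (\<alpha> x)"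
    \<comment> \<open>The claimed derivative commutes with contraction; exchanging the two
      insertions produces the sign that the antiderivation rule asks for.\<close>
    have eq: "ins (axis k 1) (?D \<alpha>' (\<alpha> x) h) = ?D ?\<beta>' (?\<beta> x) h" for h
    proof -
      have "ins (axis k 1) (\<Sum>i\<in>UNIV. covec i \<and>\<^sub>f ?P (ins (E' i h) (\<alpha> x))) =
          (\<Sum>i\<in>UNIV. (if i = k then ?P (ins (E' k h) (\<alpha> x)) else 0) -
            covec i \<and>\<^sub>f ?P (ins (E k x) (ins (E' i h) (\<alpha> x))))"
        unfolding ins_sum_right
        by (intro sum.cong) (auto simp: ins_covec_wedge axis_nth_if pull_ins[of "\<lambda>i. E i x" k,
            symmetric])
      also have "\<dots> = ?P (ins (E' k h) (\<alpha> x)) +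
          (\<Sum>i\<in>UNIV. covec i \<and>\<^sub>f ?P (ins (E' i h) (ins (E k x) (\<alpha> x))))"
        by (simp add: sum.distrib ins_ins_anticommute[of "E k x"] pull_minus wedge_minus_right)
      finally show ?thesis
        by (simp add: ins_add_right pull_add pull_ins[of "\<lambda>i. E i x" k, symmetric])
    qed
    have "((\<lambda>y. pull (\<lambda>i. E i y) (?\<beta> y) $ J) has_derivative (\<lambda>h. ?D ?\<beta>' (?\<beta> x) h $ J)) (at x)"
      by (rule insert.IH[OF has_derivative_ins[OF E insert.prems]])
    then have "((\<lambda>y. shuffle_sign {k} J * pull (\<lambda>i. E i y) (?\<beta> y) $ J) has_derivative
        (\<lambda>h. shuffle_sign {k} J * ?D ?\<beta>' (?\<beta> x) h $ J)) (at x)"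
      by (rule has_derivative_mult_right)
    then show ?case
      unfolding nth_insert_eq_ins[OF insert.hyps(2)] eq pull_ins[symmetric] .
  qed
  then show ?thesis
    by (subst has_derivative_componentwise_within) (auto simp: Basis_vec_def inner_axis)
qed

section \<open>The Levi-Civita connection in an adapted frame\<close>

lemma sigma_1_eq: "sigma 1 \<alpha> \<beta> = (\<Sum>k\<in>UNIV. ins (axis k 1) \<alpha> \<and>\<^sub>f ins (axis k 1) \<beta>)"
proof -
  have "{S :: 8 set. card S = 1} = (\<lambda>k. {k}) ` UNIV"
    by (auto elim: card_1_singletonE)
  then have "sigma 1 \<alpha> \<beta> = (\<Sum>S\<in>(\<lambda>k. {k}) ` UNIV. ins_basis S \<alpha> \<and>\<^sub>f ins_basis S \<beta>)"
    by (simp add: sigma_def)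
  also have "\<dots> = (\<Sum>k\<in>UNIV. ins_basis {k} \<alpha> \<and>\<^sub>f ins_basis {k} \<beta>)"
    by (subst sum.reindex) auto
  finally show ?thesis by (simp add: ins_basis_def)
qed

lemma ins_covec_covec:
  "ins v (covec i \<and>\<^sub>f covec j) = v $ i *\<^sub>R covec j - v $ j *\<^sub>R covec i"
proof -
  have one: "ins v (axis {} 1) = 0"
    by (simp add: vec_eq_iff ins_def axis_def)
  have j: "covec j = covec j \<and>\<^sub>f axis {} 1" for j by simp
  have "ins v (covec j) = v $ j *\<^sub>R axis {} 1"
    by (subst j) (simp add: ins_covec_wedge one del: wedge_one)
  then show ?thesis by (simp add: ins_covec_wedge wedge_scaleR_right)
qed

lemma sigma_1_covec_covec:
  "sigma 1 (covec i \<and>\<^sub>f covec j) \<beta> = covec j \<and>\<^sub>f ins (axis i 1) \<beta> - covec i \<and>\<^sub>f ins (axis j 1) \<beta>"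
proof -
  have "sigma 1 (covec i \<and>\<^sub>f covec j) \<beta> =
      (\<Sum>k\<in>UNIV. (if k = i then covec j \<and>\<^sub>f ins (axis i 1) \<beta> else 0) -
        (if k = j then covec i \<and>\<^sub>f ins (axis j 1) \<beta> else 0))"
    unfolding sigma_1_eq ins_covec_covec
    by (intro sum.cong) (auto simp: axis_nth_if wedge_diff_left wedge_scaleR_left)
  then show ?thesis by (simp add: sum_subtractf)
qed

text \<open>The 2-form with coefficients \<open>w\<close> acts on forms as the derivation given by
  the skew matrix \<open>w\<close>. Pairs below the diagonal fold onto those above it, and the
  diagonal vanishes.\<close>

lemma sigma_1_skew:
  fixes w :: "8 \<Rightarrow> 8 \<Rightarrow> real"
  assumes skew: "\<And>i j. w i j + w j i = 0"
  shows "sigma 1 (\<Sum>(i, j) | i < j. w i j *\<^sub>R (covec i \<and>\<^sub>f covec j)) \<beta> =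
    - (\<Sum>i\<in>UNIV. \<Sum>j\<in>UNIV. w i j *\<^sub>R (covec i \<and>\<^sub>f ins (axis j 1) \<beta>))"
proof -
  let ?f = "\<lambda>(i, j). w i j *\<^sub>R (covec i \<and>\<^sub>f ins (axis j 1) \<beta>)"
  have w: "w j i = - w i j" for i j using skew[of i j] by simp
  have UNIV_split: "(UNIV :: (8 \<times> 8) set) = {(i, j). i < j} \<union> {(i, j). j < i} \<union> {(i, j). i = j}"
    by auto
  have "(\<Sum>i\<in>UNIV. \<Sum>j\<in>UNIV. w i j *\<^sub>R (covec i \<and>\<^sub>f ins (axis j 1) \<beta>)) = sum ?f UNIV"
    by (simp add: sum.cartesian_product flip: UNIV_Times_UNIV)
  also have "\<dots> = sum ?f {(i, j). i < j} + sum ?f {(i, j). j < i} + sum ?f {(i, j). i = j}"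
    unfolding UNIV_split by (subst sum.union_disjoint, simp, simp, force)+ (rule refl)
  also have "sum ?f {(i, j). i = j} = 0"
    using w[of i i for i] by (intro sum.neutral) (auto simp: equal_neg_zero)
  also have "sum ?f {(i, j). j < i} = (\<Sum>(i, j) | i < j. w j i *\<^sub>R (covec j \<and>\<^sub>f ins (axis i 1) \<beta>))"
    by (rule sum.reindex_bij_witness[of _ prod.swap prod.swap]) auto
  also have "sum ?f {(i, j). i < j} + \<dots> + 0 =
      - (\<Sum>(i, j) | i < j. w i j *\<^sub>R sigma 1 (covec i \<and>\<^sub>f covec j) \<beta>)"
    unfolding sigma_1_covec_covec add_0_right sum.distrib[symmetric] sum_negf[symmetric]
  proof (intro sum.cong refl, clarify)
    fix i j
    show "w i j *\<^sub>R (covec i \<and>\<^sub>f ins (axis j 1) \<beta>) + w j i *\<^sub>R (covec j \<and>\<^sub>f ins (axis i 1) \<beta>) =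
        - (w i j *\<^sub>R (covec j \<and>\<^sub>f ins (axis i 1) \<beta> - covec i \<and>\<^sub>f ins (axis j 1) \<beta>))"
      by (simp add: w[of i j] scaleR_diff_right)
  qed
  also have "(\<Sum>(i, j) | i < j. w i j *\<^sub>R sigma 1 (covec i \<and>\<^sub>f covec j) \<beta>) =
      sigma 1 (\<Sum>(i, j) | i < j. w i j *\<^sub>R (covec i \<and>\<^sub>f covec j)) \<beta>"
    by (simp add: linear_sum[OF linear_sigma_left] sigma_scaleR_left case_prod_beta)
  finally show ?thesis by simp
qed

text \<open>With M the matrix of the frame, orthonormality says that (transpose M) G is a left
  inverse of M, hence also a right inverse.\<close>

lemma frame_expand:
  fixes G :: "real^8^8" and E :: "8 \<Rightarrow> real^8"
  assumes sym: "transpose G = G" and orth: "\<And>i j. E i \<bullet> (G *v E j) = (if i = j then 1 else 0)"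
  shows "w = (\<Sum>j\<in>UNIV. (w \<bullet> (G *v E j)) *\<^sub>R E j)"
proof -
  define M :: "real^8^8" where "M = (\<chi> k i. E i $ k)"
  have "(transpose M ** (G ** M)) $ i $ j = mat 1 $ i $ j" for i j
    using orth[of i j]
    by (simp add: M_def matrix_matrix_mult_def transpose_def inner_vec_def matrix_vector_mult_def
        mat_def)
  then have "transpose M ** G ** M = mat 1"
    by (simp add: vec_eq_iff matrix_mul_assoc)
  then have M: "M ** (transpose M ** G) = mat 1"
    by (simp add: matrix_left_right_inverse)
  have comp: "((transpose M ** G) *v w) $ j = w \<bullet> (G *v E j)" for j
  proof -
    have "((transpose M ** G) *v w) $ j = (transpose M *v (G *v w)) $ j"
      by (simp only: matrix_vector_mul_assoc)
    also have "\<dots> = E j \<bullet> (G *v w)"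
      by (simp only: matrix_vector_mult_def[of "transpose M"] inner_vec_def) (simp add: M_def
          transpose_def)
    also have "\<dots> = (transpose G *v E j) \<bullet> w"
      by (simp add: transpose_matrix_vector dot_lmul_matrix)
    finally show ?thesis by (simp add: sym inner_commute)
  qed
  have "w = M *v ((transpose M ** G) *v w)"
    by (simp only: matrix_vector_mul_assoc M matrix_vector_mul_lid)
  then have "w $ k = (\<Sum>j\<in>UNIV. M $ k $ j * ((transpose M ** G) *v w) $ j)" for k
    by (metis (no_types) matrix_vector_mult_def vec_lambda_beta)
  then show ?thesis
    unfolding comp by (simp add: vec_eq_iff M_def mult.commute)
qed

definition christoffel_vec :: "(real^8 \<Rightarrow> real^8^8) \<Rightarrow> real^8 \<Rightarrow> real^8 \<Rightarrow> real^8 \<Rightarrow> real^8" where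
  "christoffel_vec G x v w = (\<chi> k. \<Sum>i\<in>UNIV. \<Sum>j\<in>UNIV. christoffel G x k i j * v $ i * w $ j)"

lemma nabla_vec_eq: "nabla_vec G Y x v = frechet_derivative Y (at x) v + christoffel_vec G x v (Y x)"
  by (simp add: nabla_vec_def christoffel_vec_def)

lemma linear_frechet_eq_sum:
  assumes "f differentiable at x"
  shows "frechet_derivative f (at x) v = (\<Sum>k\<in>UNIV. v $ k *\<^sub>R pd f x k)"
proof -
  have lin: "linear (frechet_derivative f (at x))"
    using assms by (rule linear_frechet_derivative)
  have "v = (\<Sum>k\<in>UNIV. v $ k *\<^sub>R axis k 1)"
    using basis_expansion[of v] by (simp add: scalar_mult_eq_scaleR)
  then have "frechet_derivative f (at x) v = frechet_derivative f (at x) (\<Sum>k\<in>UNIV. v $ k *\<^sub>R axis k 1)"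
    by simp
  then show ?thesis
    by (simp add: linear_sum[OF lin] linear_cmul[OF lin] pd_def)
qed

text \<open>Metric compatibility in matrix form: with C the matrix of Christoffel symbols in a
  coordinate direction, the derivative of G is (transpose C) G plus its transpose.\<close>

lemma metric_derivative:
  assumes "open S" "x \<in> S" "G differentiable at x" "\<And>y. y \<in> S \<Longrightarrow> transpose (G y) = G y"
    and inv: "invertible (G x)"
  shows "a \<bullet> (frechet_derivative G (at x) v *v b) =
    christoffel_vec G x v a \<bullet> (G x *v b) + christoffel_vec G x v b \<bullet> (G x *v a)"
proof -
  define C :: "8 \<Rightarrow> real^8^8" where "C k = (\<chi> l i. christoffel G x l k i)" for k
  have sym: "transpose (G x) = G x" by (rule assms(4)[OF assms(2)])
  have P: "pd G x k = transpose (C k) ** G x + transpose (transpose (C k) ** G x)" for k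
    using christoffel_metric[OF assms]
    by (simp add: vec_eq_iff matrix_matrix_mult_def transpose_def C_def sum.distrib)
  have chr: "christoffel_vec G x v w = (\<Sum>k\<in>UNIV. v $ k *\<^sub>R (C k *v w))" for w
    by (simp add: vec_eq_iff christoffel_vec_def C_def matrix_vector_mult_def sum_distrib_left mult_ac)
  have "a \<bullet> (pd G x k *v b) = (C k *v a) \<bullet> (G x *v b) + (C k *v b) \<bullet> (G x *v a)" for k
  proof -
    have *: "c \<bullet> ((transpose (C k) ** G x) *v d) = (C k *v c) \<bullet> (G x *v d)" for c d
      using dot_lmul_matrix[of c "transpose (C k)" "G x *v d"]
      by (simp add: matrix_vector_mul_assoc transpose_matrix_vector[symmetric])
    have "a \<bullet> (transpose (transpose (C k) ** G x) *v b) = b \<bullet> ((transpose (C k) ** G x) *v a)"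
      using dot_lmul_matrix[of b "transpose (C k) ** G x" a]
      by (simp only: transpose_matrix_vector inner_commute)
    then show ?thesis
      by (simp only: P matrix_vector_mult_add_rdistrib inner_add_right *)
  qed
  moreover have "frechet_derivative G (at x) v *v b = (\<Sum>k\<in>UNIV. v $ k *\<^sub>R (pd G x k *v b))"
  proof -
    have lin: "linear (\<lambda>A :: real^8^8. A *v b)"
      by (rule linearI) (simp_all add: matrix_vector_mult_add_rdistrib scaleR_matrix_vector_assoc)
    show ?thesis
      unfolding linear_frechet_eq_sum[OF assms(3)]
      by (simp add: linear_sum[OF lin] linear_cmul[OF lin])
  qed
  ultimately show ?thesis
    by (simp add: chr inner_sum_left inner_sum_right sum.distrib distrib_left)
qed


section \<open>Covariant derivative, differential and co-differential of rho in an adapted frame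
  field\<close>

context
  fixes G :: "real^8 \<Rightarrow> real^8^8" and S :: "(real^8) set" and x :: "real^8" and E :: "8 \<Rightarrow> real^8 \<Rightarrow>
      real^8"
    and \<rho> :: "real^8 \<Rightarrow> form"
  assumes S: "open S" "x \<in> S"
    and G: "G differentiable at x" "\<And>y. y \<in> S \<Longrightarrow> transpose (G y) = G y" "invertible (G x)"
    and E: "\<And>i. E i differentiable at x"
    and orth: "\<And>y i j. y \<in> S \<Longrightarrow> E i y \<bullet> (G y *v E j y) = (if i = j then 1 else 0)"
    and \<rho>: "\<rho> differentiable at x" "\<And>y. y \<in> S \<Longrightarrow> pull (\<lambda>i. E i y) (\<rho> y) = rho0"
begin

definition connection_coeff :: "real^8 \<Rightarrow> 8 \<Rightarrow> 8 \<Rightarrow> real" where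
  "connection_coeff v i j = nabla_vec G (E i) x v \<bullet> (G x *v E j x)"

lemma E_deriv: "(E i has_derivative frechet_derivative (E i) (at x)) (at x)"
  using E frechet_derivative_works by blast

text \<open>Differentiate g(E_i, E_j), which is constant near x; the derivative of G supplies the
  Christoffel terms of both covariant derivatives.\<close>

lemma connection_coeff_skew: "connection_coeff v i j + connection_coeff v j i = 0"
proof -
  have dG: "(G has_derivative frechet_derivative G (at x)) (at x)"
    using G(1) frechet_derivative_works by blast
  have mv: "bounded_bilinear (\<lambda>(A :: real^8^8) (b :: real^8). A *v b)"
    unfolding bilinear_conv_bounded_bilinear[symmetric] bilinear_def
    by (auto intro!: linearI simp: matrix_vector_mult_add_rdistrib matrix_vector_right_distrib
        scaleR_matrix_vector_assoc[symmetric] matrix_vector_mult_scaleR)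
  have "((\<lambda>y. E i y \<bullet> (G y *v E j y)) has_derivative
      (\<lambda>h. E i x \<bullet> (G x *v frechet_derivative (E j) (at x) h + frechet_derivative G (at x) h *v E j x) +
        frechet_derivative (E i) (at x) h \<bullet> (G x *v E j x))) (at x)"
    by (intro has_derivative_inner E_deriv bounded_bilinear.FDERIV[OF mv] dG)
  moreover have "((\<lambda>y. E i y \<bullet> (G y *v E j y)) has_derivative (\<lambda>h. 0)) (at x)"
    by (rule has_derivative_transform_within_open[OF has_derivative_const S])
      (simp add: orth)
  ultimately have "E i x \<bullet> (G x *v frechet_derivative (E j) (at x) v + frechet_derivative G (at x) v
      *v E j x) +
        frechet_derivative (E i) (at x) v \<bullet> (G x *v E j x) = 0"
    using has_derivative_unique by (metis (no_types, lifting))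
  moreover have "a \<bullet> (G x *v b) = b \<bullet> (G x *v a)" for a b
    using dot_lmul_matrix[of a "transpose (G x)" b] G(2)[OF S(2)]
    by (metis inner_commute transpose_matrix_vector)
  ultimately show ?thesis
    using metric_derivative[OF S G, of "E i x" v "E j x"]
    by (simp add: connection_coeff_def nabla_vec_eq inner_add_right inner_add_left
        matrix_vector_right_distrib)
qed

lemma nabla_vec_expand: "nabla_vec G (E i) x v = (\<Sum>j\<in>UNIV. connection_coeff v i j *\<^sub>R E j x)"
  unfolding connection_coeff_def by (rule frame_expand) (simp_all add: G S orth)

text \<open>Differentiating the constant pull-back of rho trades the derivative of rho for
  derivatives of the frame.\<close>

lemma pull_nabla_form:
  "pull (\<lambda>i. E i x) (nabla_form G \<rho> x v) =
    - (\<Sum>i\<in>UNIV. \<Sum>j\<in>UNIV. connection_coeff v i j *\<^sub>R (covec i \<and>\<^sub>f ins (axis j 1) rho0))"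
proof -
  let ?P = "pull (\<lambda>i. E i x)"
  have "(\<rho> has_derivative frechet_derivative \<rho> (at x)) (at x)"
    using \<rho>(1) frechet_derivative_works by blast
  note has_derivative_pull[OF E_deriv this]
  moreover have "((\<lambda>y. pull (\<lambda>i. E i y) (\<rho> y)) has_derivative (\<lambda>h. 0)) (at x)"
    by (rule has_derivative_transform_within_open[OF has_derivative_const S]) (simp add: \<rho>)
  ultimately have "(\<lambda>h. ?P (frechet_derivative \<rho> (at x) h) +
      (\<Sum>i\<in>UNIV. covec i \<and>\<^sub>f ?P (ins (frechet_derivative (E i) (at x) h) (\<rho> x)))) = (\<lambda>h. 0)"
    by (rule has_derivative_unique)
  from fun_cong[OF this, of v]
  have 1: "?P (frechet_derivative \<rho> (at x) v) =
      - (\<Sum>i\<in>UNIV. covec i \<and>\<^sub>f ?P (ins (frechet_derivative (E i) (at x) v) (\<rho> x)))"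
    by (simp add: eq_neg_iff_add_eq_0)
  \<comment> \<open>The coordinate derivative of the frame is its covariant derivative minus a
    Christoffel term.\<close>
  have 2: "frechet_derivative (E i) (at x) v =
      (\<Sum>j\<in>UNIV. connection_coeff v i j *\<^sub>R E j x) - christoffel_vec G x v (E i x)" for i
    using nabla_vec_expand[of i v] by (simp add: nabla_vec_eq algebra_simps)
  have 3: "?P (ins (frechet_derivative (E i) (at x) v) (\<rho> x)) =
      (\<Sum>j\<in>UNIV. connection_coeff v i j *\<^sub>R ins (axis j 1) rho0) - ?P (ins (christoffel_vec G x v (E
          i x)) (\<rho> x))" for i
    unfolding 2 ins_diff_left pull_diff
    by (simp add: ins_sum_left ins_scaleR_left pull_sum pull_scaleR pull_ins[of "\<lambda>i. E i x"] \<rho>(2)[OF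
        S(2)])
  \<comment> \<open>The Christoffel part of the covariant derivative of rho, expanded in the frame.
    Once reordered it is the Christoffel term of \<open>3\<close>, and the two cancel.\<close>
  let ?t = "\<lambda>a k i j. (christoffel G x k i j * v $ i * E a x $ j) *\<^sub>R (covec a \<and>\<^sub>f ?P (ins (axis k
      1) (\<rho> x)))"
  have "?P (\<Sum>k\<in>UNIV. \<Sum>i\<in>UNIV. \<Sum>j\<in>UNIV.
        (christoffel G x k i j * v $ i) *\<^sub>R (covec j \<and>\<^sub>f ins (axis k 1) (\<rho> x))) =
      (\<Sum>k\<in>UNIV. \<Sum>i\<in>UNIV. \<Sum>j\<in>UNIV. \<Sum>a\<in>UNIV. ?t a k i j)"
    by (simp add: pull_sum pull_scaleR pull_covec_wedge scaleR_sum_right)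
  also have "\<dots> = (\<Sum>k\<in>UNIV. \<Sum>i\<in>UNIV. \<Sum>a\<in>UNIV. \<Sum>j\<in>UNIV. ?t a k i j)"
    by (intro sum.cong refl sum.swap)
  also have "\<dots> = (\<Sum>k\<in>UNIV. \<Sum>a\<in>UNIV. \<Sum>i\<in>UNIV. \<Sum>j\<in>UNIV. ?t a k i j)"
    by (intro sum.cong refl sum.swap)
  also have "\<dots> = (\<Sum>a\<in>UNIV. \<Sum>k\<in>UNIV. \<Sum>i\<in>UNIV. \<Sum>j\<in>UNIV. ?t a k i j)"
    by (rule sum.swap)
  also have "\<dots> = (\<Sum>a\<in>UNIV. covec a \<and>\<^sub>f ?P (ins (christoffel_vec G x v (E a x)) (\<rho> x)))"
    unfolding ins_eq_sum[of "christoffel_vec G x v (E a x)" for a]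
    by (simp add: christoffel_vec_def pull_sum pull_scaleR
        wedge_sum_right wedge_scaleR_right scaleR_sum_left)
  finally show ?thesis
    unfolding nabla_form_def pull_diff 1 3 by (simp add: wedge_diff_right wedge_sum_right
        wedge_scaleR_right sum_subtractf)
qed

lemma pull_nabla_form_eq_sigma:
  "pull (\<lambda>i. E i x) (nabla_form G \<rho> x (E k x)) = sigma 1 (connection G E x $ k) rho0"
  unfolding pull_nabla_form
  using sigma_1_skew[of "connection_coeff (E k x)" rho0, OF connection_coeff_skew]
  by (simp add: connection_def connection_coeff_def)

lemma linear_nabla_form: "linear (nabla_form G \<rho> x)"
proof -
  have "linear (frechet_derivative \<rho> (at x))"
    using \<rho>(1) by (rule linear_frechet_derivative)
  then show ?thesis
    by (intro linearI) (simp_all add: nabla_form_def linear_add linear_cmul scaleR_add_left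
        sum.distrib distrib_left scaleR_diff_right scaleR_sum_right mult_ac)
qed

text \<open>Torsion-freeness: the Christoffel symbols are symmetric in the two indices in which the
  wedge product is antisymmetric.\<close>

lemma ext_d_eq: "ext_d \<rho> x = (\<Sum>i\<in>UNIV. covec i \<and>\<^sub>f nabla_form G \<rho> x (axis i 1))"
proof -
  let ?t = "\<lambda>k i j. christoffel G x k i j *\<^sub>R (covec i \<and>\<^sub>f covec j \<and>\<^sub>f ins (axis k 1) (\<rho> x))"
  have anti: "(\<Sum>i\<in>UNIV. \<Sum>j\<in>UNIV. ?t k i j) = 0" for k
  proof -
    have "(\<Sum>i\<in>UNIV. \<Sum>j\<in>UNIV. ?t k i j) = (\<Sum>j\<in>UNIV. \<Sum>i\<in>UNIV. ?t k i j)"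
      by (rule sum.swap)
    also have "\<dots> = (\<Sum>j\<in>UNIV. \<Sum>i\<in>UNIV. - ?t k j i)"
    proof (intro sum.cong refl)
      fix i j
      show "?t k i j = - ?t k j i"
        by (subst covec_wedge_anticommute)
          (simp only: christoffel_torsion_free[OF S G(1,2), of k i j] scaleR_minus_right)
    qed
    finally show ?thesis
      by (simp add: sum_negf eq_neg_iff_add_eq_0 flip: scaleR_2)
  qed
  have "(\<Sum>k\<in>UNIV. \<Sum>l\<in>UNIV. \<Sum>j\<in>UNIV. (christoffel G x k l j * axis i 1 $ l) *\<^sub>R
      (covec j \<and>\<^sub>f ins (axis k 1) (\<rho> x))) =
      (\<Sum>k\<in>UNIV. \<Sum>j\<in>UNIV. christoffel G x k i j *\<^sub>R (covec j \<and>\<^sub>f ins (axis k 1) (\<rho> x)))" for i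
  proof (rule sum.cong[OF refl])
    fix k
    have "(\<Sum>l\<in>UNIV. \<Sum>j\<in>UNIV. (christoffel G x k l j * axis i 1 $ l) *\<^sub>R
        (covec j \<and>\<^sub>f ins (axis k 1) (\<rho> x))) =
        (\<Sum>l\<in>UNIV. if l = i then \<Sum>j\<in>UNIV. christoffel G x k i j *\<^sub>R (covec j \<and>\<^sub>f ins (axis k 1) (\<rho>
            x)) else 0)"
      by (intro sum.cong) (auto simp: axis_nth_if)
    then show "(\<Sum>l\<in>UNIV. \<Sum>j\<in>UNIV. (christoffel G x k l j * axis i 1 $ l) *\<^sub>R
        (covec j \<and>\<^sub>f ins (axis k 1) (\<rho> x))) =
        (\<Sum>j\<in>UNIV. christoffel G x k i j *\<^sub>R (covec j \<and>\<^sub>f ins (axis k 1) (\<rho> x)))"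
      by simp
  qed
  then have "covec i \<and>\<^sub>f nabla_form G \<rho> x (axis i 1) = covec i \<and>\<^sub>f pd \<rho> x i -
      (\<Sum>k\<in>UNIV. \<Sum>j\<in>UNIV. ?t k i j)" for i
    by (simp add: nabla_form_def pd_def wedge_diff_right wedge_sum_right wedge_scaleR_right)
  then have "(\<Sum>i\<in>UNIV. covec i \<and>\<^sub>f nabla_form G \<rho> x (axis i 1)) =
      ext_d \<rho> x - (\<Sum>i\<in>UNIV. \<Sum>k\<in>UNIV. \<Sum>j\<in>UNIV. ?t k i j)"
    by (simp add: ext_d_def sum_subtractf)
  also have "(\<Sum>i\<in>UNIV. \<Sum>k\<in>UNIV. \<Sum>j\<in>UNIV. ?t k i j) = (\<Sum>k\<in>UNIV. \<Sum>i\<in>UNIV. \<Sum>j\<in>UNIV. ?t k i j)"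
    by (rule sum.swap)
  finally show ?thesis by (simp add: anti)
qed

lemma pull_ext_d:
  "pull (\<lambda>i. E i x) (ext_d \<rho> x) = (\<Sum>k\<in>UNIV. covec k \<and>\<^sub>f sigma 1 (connection G E x $ k) rho0)"
proof -
  let ?P = "pull (\<lambda>i. E i x)"
  have "?P (ext_d \<rho> x) = (\<Sum>i\<in>UNIV. \<Sum>a\<in>UNIV. E a x $ i *\<^sub>R (covec a \<and>\<^sub>f ?P (nabla_form G \<rho> x (axis i
      1))))"
    by (simp add: ext_d_eq pull_sum pull_covec_wedge)
  also have "\<dots> = (\<Sum>a\<in>UNIV. \<Sum>i\<in>UNIV. E a x $ i *\<^sub>R (covec a \<and>\<^sub>f ?P (nabla_form G \<rho> x (axis i 1))))"
    by (rule sum.swap)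
  also have "\<dots> = (\<Sum>a\<in>UNIV. covec a \<and>\<^sub>f ?P (nabla_form G \<rho> x (\<Sum>i\<in>UNIV. E a x $ i *\<^sub>R axis i 1)))"
    by (simp add: linear_sum[OF linear_nabla_form] linear_cmul[OF linear_nabla_form] pull_sum
        pull_scaleR
        wedge_sum_right wedge_scaleR_right)
  also have "\<dots> = (\<Sum>a\<in>UNIV. covec a \<and>\<^sub>f ?P (nabla_form G \<rho> x (E a x)))"
    using basis_expansion[of "E a x" for a] by (simp add: scalar_mult_eq_scaleR)
  finally show ?thesis by (simp add: pull_nabla_form_eq_sigma)
qed

lemma pull_codiff:
  "pull (\<lambda>i. E i x) (codiff G (\<lambda>i. E i x) \<rho> x) =
    - (\<Sum>k\<in>UNIV. ins (axis k 1) (sigma 1 (connection G E x $ k) rho0))"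
  by (simp add: codiff_def pull_minus pull_sum pull_ins[of "\<lambda>i. E i x"] pull_nabla_form_eq_sigma)

end

section \<open>Types of PSU(3)-structures\<close>

lemma W_6D: "A \<in> W 6 \<Longrightarrow> A \<in> torsion_space" "A \<in> W 6 \<Longrightarrow> torsion_d A = 0"
  "A \<in> W 6 \<Longrightarrow> torsion_delta A = 0"
  by (simp_all add: W_6_iff)

lemmas WD = W_1D W_2D W_3D W_4D W_5D W_6D

lemma W_torsion_space:
  assumes "A \<in> W k" "k \<in> {1, 2, 3, 4, 5, 6}"
  shows "A \<in> torsion_space"
  using assms WD by blast

text \<open>Every criterion, on each single summand contained in the corresponding type.\<close>

lemma W_torsion:
  assumes A: "A \<in> W k"
  shows "k \<in> {2, 3, 4, 5, 6} \<Longrightarrow> contr 3 rho0 (hodge (torsion_d A)) = 0"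
    and "k \<in> {1, 3, 4, 5, 6} \<Longrightarrow> 6 *\<^sub>R torsion_delta A = contr 1 (contr 2 (torsion_delta A) rho0) rho0"
    and "k \<in> {1, 2, 4, 5, 6} \<Longrightarrow> excess (torsion_d A) = 0"
    and "k \<in> {1, 2, 3, 5, 6} \<Longrightarrow> contr 3 rho0 (torsion_d A) = 0"
    and "k \<in> {1, 2, 3, 4, 6} \<Longrightarrow> excess (hodge (torsion_d A)) = 0"
    and "k \<in> {2, 4, 5, 6} \<Longrightarrow> sigma_minus (torsion_d A) = 0"
    and "k \<in> {1, 2, 3, 6} \<Longrightarrow> sigma_minus (hodge (torsion_d A)) = 0"
    and "k \<in> {1, 3, 5, 6} \<Longrightarrow> torsion_delta A = 0"
    and "k \<in> {1, 2, 6} \<Longrightarrow> 10 *\<^sub>R hodge (torsion_d A) = rho0 \<and>\<^sub>f contr 3 rho0 (hodge (torsion_d A))"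
    and "k \<in> {2, 4, 6} \<Longrightarrow> 10 *\<^sub>R torsion_d A = rho0 \<and>\<^sub>f contr 3 rho0 (torsion_d A)"
    and "k \<in> {2, 6} \<Longrightarrow> torsion_d A = 0"
proof -
  have L: "torsion_d A \<in> Lam 4" if "k \<in> {1, 2, 3, 4, 5, 6}"
    by (rule torsion_d_Lam[OF W_torsion_space[OF A that]])
  have zero: "excess 0 = 0" by (rule linear_0[OF linear_excess])
  show *: "k \<in> {2, 4, 5, 6} \<Longrightarrow> sigma_minus (torsion_d A) = 0"
    using A by (auto dest: WD simp: linear_pushes)
  show **: "k \<in> {1, 2, 3, 6} \<Longrightarrow> sigma_minus (hodge (torsion_d A)) = 0"
    using A by (auto dest: WD simp: linear_pushes)
  show delta: "k \<in> {1, 3, 5, 6} \<Longrightarrow> torsion_delta A = 0"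
    using A by (auto dest: WD)
  show "k \<in> {1, 2, 6} \<Longrightarrow> 10 *\<^sub>R hodge (torsion_d A) = rho0 \<and>\<^sub>f contr 3 rho0 (hodge (torsion_d A))"
    using A by (auto dest: WD(2-) simp: linear_pushes)
  show "k \<in> {2, 4, 6} \<Longrightarrow> 10 *\<^sub>R torsion_d A = rho0 \<and>\<^sub>f contr 3 rho0 (torsion_d A)"
    using A by (auto dest: WD simp: linear_pushes)
  show "k \<in> {2, 6} \<Longrightarrow> torsion_d A = 0"
    using A by (auto dest: WD)
  show "k \<in> {2, 3, 4, 5, 6} \<Longrightarrow> contr 3 rho0 (hodge (torsion_d A)) = 0"
    using A W_3D(4) minus_eq_0D(1)[OF L *] by auto
  show "k \<in> {1, 3, 4, 5, 6} \<Longrightarrow> 6 *\<^sub>R torsion_delta A = contr 1 (contr 2 (torsion_delta A) rho0) rho0"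
    using A W_4D(4) delta by auto
  show "k \<in> {1, 2, 4, 5, 6} \<Longrightarrow> excess (torsion_d A) = 0"
    using A hodge_eq_rho_wedgeD(2)[OF L W_1D(4)] minus_eq_0D(2)[OF L *] by auto
  show "k \<in> {1, 2, 3, 4, 6} \<Longrightarrow> excess (hodge (torsion_d A)) = 0"
    using A eq_rho_wedgeD(3)[OF L W_4D(3)] minus_hodge_eq_0D(2)[OF L **] by auto
  show "k \<in> {1, 2, 3, 5, 6} \<Longrightarrow> contr 3 rho0 (torsion_d A) = 0"
  proof -
    assume k: "k \<in> {1, 2, 3, 5, 6}"
    \<comment> \<open>On W_5 the dual of D need not be annihilated by sigma_-; Delta = 0 gives the
      contraction instead.\<close>
    have "contr 3 rho0 (torsion_d A) = 0" if "k = 5"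
      using contr_2_torsion_delta[of A] A that W_5D(1,2)[of A] by simp
    then show ?thesis
      using k minus_hodge_eq_0D(1)[OF L **] by auto
  qed
qed

text \<open>All criteria equate two linear maps, so they pass from the summands to their
  sum.\<close>

lemma W_sum_linear_eq:
  assumes "A \<in> W_sum J" "linear f" "linear g" "\<And>k B. k \<in> J \<Longrightarrow> B \<in> W k \<Longrightarrow> f B = g B"
  shows "f A = g A"
  using assms by (auto simp: W_sum_def linear_sum intro!: sum.cong)

lemmas linear_torsion_d' = linear_compose[OF _ linear_torsion_d, unfolded o_def]
  and linear_torsion_delta' = linear_compose[OF _ linear_torsion_delta, unfolded o_def]

text \<open>For the converse implications, each criterion is shown to force those conditions of
  \<open>W_sumI\<close> whose index is missing from the type.\<close>

lemma W_sum_iff: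
  assumes A: "A \<in> torsion_space"
  shows "A \<in> W_sum {2,3,4,5,6} \<longleftrightarrow> contr 3 rho0 (hodge (torsion_d A)) = 0" (is ?c1)
    and "A \<in> W_sum {1,3,4,5,6} \<longleftrightarrow> 6 *\<^sub>R torsion_delta A = contr 1 (contr 2 (torsion_delta A) rho0)
        rho0" (is ?c2)
    and "A \<in> W_sum {1,2,4,5,6} \<longleftrightarrow> excess (torsion_d A) = 0" (is ?c3)
    and "A \<in> W_sum {1,2,3,5,6} \<longleftrightarrow> contr 3 rho0 (torsion_d A) = 0" (is ?c4)
    and "A \<in> W_sum {1,2,3,4,6} \<longleftrightarrow> excess (hodge (torsion_d A)) = 0" (is ?c5)
    and "A \<in> W_sum {2,4,5,6} \<longleftrightarrow> sigma_minus (torsion_d A) = 0" (is ?c6)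
    and "A \<in> W_sum {1,2,3,6} \<longleftrightarrow> sigma_minus (hodge (torsion_d A)) = 0" (is ?c7)
    and "A \<in> W_sum {1,3,5,6} \<longleftrightarrow> torsion_delta A = 0" (is ?c8)
    and "A \<in> W_sum {1,2,6} \<longleftrightarrow> 10 *\<^sub>R hodge (torsion_d A) = rho0 \<and>\<^sub>f contr 3 rho0 (hodge (torsion_d
        A))" (is ?c9)
    and "A \<in> W_sum {2,4,6} \<longleftrightarrow> 10 *\<^sub>R torsion_d A = rho0 \<and>\<^sub>f contr 3 rho0 (torsion_d A)" (is ?c10)
    and "A \<in> W_sum {2,6} \<longleftrightarrow> torsion_d A = 0" (is ?c11)
    and "A \<in> W_sum {6} \<longleftrightarrow> torsion_d A = 0 \<and> torsion_delta A = 0" (is ?c12)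
proof -
  note L = torsion_d_Lam[OF A] and I = W_sumI[OF A] and ct = contr_2_torsion_delta[OF A]
  note lin = linear_intros' linear_excess' linear_torsion_d' linear_torsion_delta'
  have zero: "excess 0 = 0" by (rule linear_0[OF linear_excess])
  show ?c1
    by (rule iffI, erule W_sum_linear_eq, intro lin, intro lin, erule W_torsion(1)[rotated], assumption)
      (rule I, auto)
  show ?c2
    by (rule iffI, erule W_sum_linear_eq, intro lin, intro lin, erule W_torsion(2)[rotated], assumption)
      (rule I, auto)
  show ?c3
    by (rule iffI, erule W_sum_linear_eq, intro lin, intro lin, erule W_torsion(3)[rotated], assumption)
      (rule I, auto)
  show ?c4
    by (rule iffI, erule W_sum_linear_eq, intro lin, intro lin, erule W_torsion(4)[rotated], assumption)
      (rule I, auto)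
  show ?c5
    by (rule iffI, erule W_sum_linear_eq, intro lin, intro lin, erule W_torsion(5)[rotated], assumption)
      (rule I, auto)
  show ?c6
    by (rule iffI, erule W_sum_linear_eq, intro lin, intro lin, erule W_torsion(6)[rotated], assumption)
      (rule I, auto dest: minus_eq_0D[OF L])
  show ?c7
    by (rule iffI, erule W_sum_linear_eq, intro lin, intro lin, erule W_torsion(7)[rotated], assumption)
      (rule I, auto dest: minus_hodge_eq_0D[OF L])
  \<comment> \<open>Delta = 0 also removes the W_4 component, through
    \<open>contr_2_torsion_delta\<close>.\<close>
  show ?c8
    by (rule iffI, erule W_sum_linear_eq, intro lin, intro lin, erule W_torsion(8)[rotated], assumption)
      (rule I, use ct in auto)
  show ?c9
    by (rule iffI, erule W_sum_linear_eq, intro lin, intro lin, erule W_torsion(9)[rotated], assumption)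
      (rule I, auto dest: hodge_eq_rho_wedgeD[OF L])
  show ?c10
    by (rule iffI, erule W_sum_linear_eq, intro lin, intro lin, erule W_torsion(10)[rotated],
        assumption)
      (rule I, auto dest: eq_rho_wedgeD[OF L])
  show ?c11
    by (rule iffI, erule W_sum_linear_eq, intro lin, intro lin, erule W_torsion(11)[rotated],
        assumption)
      (rule I, auto simp: linear_pushes zero)
  show ?c12
    using A by (auto simp: W_sum_def W_6_iff)
qed


section \<open>Smooth adapted frames\<close>

text \<open>On an open set derivatives depend only on the values there; this carries formulas for a
  derivative that hold only on \<open>S\<close> through the recursion of
  \<open>Ck_on\<close>.\<close>

lemma Ck_on_cong:
  assumes "open S" "\<And>x. x \<in> S \<Longrightarrow> f x = g x" "Ck_on k S f"
  shows "Ck_on k S g"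
  using assms(2,3)
proof (induction k arbitrary: f g)
  case 0
  then show ?case by (simp cong: continuous_on_cong)
next
  case (Suc k)
  have D: "(g has_derivative frechet_derivative f (at x)) (at x)" if "x \<in> S" for x
  proof (rule has_derivative_transform_within_open[OF _ assms(1) that])
    show "(f has_derivative frechet_derivative f (at x)) (at x)"
      using Suc.prems(2) that by (simp flip: frechet_derivative_works)
  qed (use Suc.prems(1) in auto)
  then have "frechet_derivative f (at x) b = frechet_derivative g (at x) b" if "x \<in> S" for x b
    using frechet_derivative_at[OF D[OF that]] by metis
  then have "Ck_on k S (\<lambda>x. frechet_derivative g (at x) b)" if "b \<in> Basis" for b
    using Suc.IH[of "\<lambda>x. frechet_derivative f (at x) b" "\<lambda>x. frechet_derivative g (at x) b"]
        Suc.prems(2) that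
    by simp
  with D show ?case by (auto simp: differentiable_def)
qed

lemma Ck_on_sum_scaleR:
  assumes "open S" "finite I" "\<And>i. i \<in> I \<Longrightarrow> Ck_on k S (f i)"
  shows "Ck_on k S (\<lambda>x. \<Sum>i\<in>I. c i *\<^sub>R f i x)"
  using assms(3)
proof (induction k arbitrary: f)
  case 0
  then show ?case by (auto intro!: continuous_on_sum continuous_on_scaleR continuous_on_const)
next
  case (Suc k)
  have D: "((\<lambda>x. \<Sum>i\<in>I. c i *\<^sub>R f i x) has_derivative
      (\<lambda>h. \<Sum>i\<in>I. c i *\<^sub>R frechet_derivative (f i) (at x) h)) (at x)" if "x \<in> S" for x
    using Suc.prems that
    by (intro has_derivative_sum has_derivative_scaleR_right) (simp flip: frechet_derivative_works)
  have "Ck_on k S (\<lambda>x. frechet_derivative (\<lambda>x. \<Sum>i\<in>I. c i *\<^sub>R f i x) (at x) b)" if b: "b \<in> Basis" for b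
  proof (rule Ck_on_cong[OF assms(1)])
    show "Ck_on k S (\<lambda>x. \<Sum>i\<in>I. c i *\<^sub>R frechet_derivative (f i) (at x) b)"
      using Suc.prems b by (intro Suc.IH) auto
    fix x assume "x \<in> S"
    show "(\<Sum>i\<in>I. c i *\<^sub>R frechet_derivative (f i) (at x) b) =
        frechet_derivative (\<lambda>x. \<Sum>i\<in>I. c i *\<^sub>R f i x) (at x) b"
      by (rule fun_cong[OF frechet_derivative_at[OF D[OF \<open>x \<in> S\<close>]]])
  qed
  with D show ?case by (auto simp: differentiable_def)
qed

lemma smooth_on_differentiable: "smooth_on S f \<Longrightarrow> x \<in> S \<Longrightarrow> f differentiable at x"
  unfolding smooth_on_def using Ck_on.simps(2)[of 0 S f] by metis

text \<open>Changes a given local frame field by a constant matrix; that matrix takes one adapted frame at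
  \<open>x\<close> to another, so it lies in the isotropy group of \<^const>\<open>rho0\<close>.\<close>

lemma adapted_frame_extends:
  assumes E: "adapted_frame_field G \<rho> U E" and x: "x \<in> U" and F: "adapted_frame (G x) (\<rho> x) F"
    and sym: "\<And>y. y \<in> U \<Longrightarrow> transpose (G y) = G y"
  obtains E' where "adapted_frame_field G \<rho> U E'" "\<And>i. E' i x = F i"
proof -
  define a where "a j i = F j \<bullet> (G x *v E i x)" for i j
  define E' where "E' j y = (\<Sum>i\<in>UNIV. a j i *\<^sub>R E i y)" for j y
  have U: "open U" and smooth: "\<And>i. smooth_on U (E i)"
    and frame: "\<And>y. y \<in> U \<Longrightarrow> adapted_frame (G y) (\<rho> y) (\<lambda>i. E i y)"
    using E by (auto simp: adapted_frame_field_def)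
  have orth: "E i y \<bullet> (G y *v E j y) = (if i = j then 1 else 0)" if "y \<in> U" for i j y
    using frame[OF that] by (simp add: adapted_frame_def)
  have E'x: "E' j x = F j" for j
    unfolding E'_def a_def
    using frame_expand[of "G x" "\<lambda>i. E i x" "F j"] sym[OF x] orth[OF x] by simp
  have inner: "E' i y \<bullet> (G y *v E' j y) = (\<Sum>k\<in>UNIV. a i k * a j k)" if "y \<in> U" for i j y
  proof -
    have lin: "linear ((*v) (G y))" by (rule matrix_vector_mul_linear)
    have "E' i y \<bullet> (G y *v E' j y) = (\<Sum>k\<in>UNIV. \<Sum>l\<in>UNIV. a i k * a j l * (E k y \<bullet> (G y *v E l y)))"
      unfolding E'_def
      by (simp add: linear_sum[OF lin] linear_cmul[OF lin] inner_sum_left inner_sum_right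
          sum_distrib_left mult_ac)
        (rule sum.swap)
    also have "\<dots> = (\<Sum>k\<in>UNIV. a i k * a j k)"
      by (simp add: orth[OF that] if_distrib cong: if_cong)
    finally show ?thesis .
  qed
  have pull_E': "pull (\<lambda>i. E' i y) (\<rho> y) = pull (\<lambda>j. \<chi> i. a j i) rho0" if "y \<in> U" for y
    using pull_pull[of "\<lambda>j. \<chi> i. a j i" "\<lambda>i. E i y" "\<rho> y"] frame[OF that]
    by (simp add: adapted_frame_def E'_def)
  have det_E': "det (\<chi> k i. E' i y $ k) = det (\<chi> k i. E i y $ k) * det (\<chi> i j. a j i)" for y
  proof -
    have "(\<chi> k i. E' i y $ k) = (\<chi> k i. E i y $ k) ** (\<chi> i j. a j i)"
      by (simp add: vec_eq_iff matrix_matrix_mult_def E'_def mult.commute)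
    then show ?thesis by (simp add: det_mul)
  qed
  have F': "F i \<bullet> (G x *v F j) = (if i = j then 1 else 0)" "0 < det (\<chi> k i. F i $ k)" "pull F (\<rho> x)
      = rho0" for i j
    using F by (simp_all add: adapted_frame_def)
  have det_pos: "0 < det (\<chi> k i. E i y $ k)" if "y \<in> U" for y
    using frame[OF that] by (simp add: adapted_frame_def)
  \<comment> \<open>The three conditions on the matrix \<open>a\<close> are read off at
    \<open>x\<close>, where the new frame is \<open>F\<close>. They do not involve the point, so
    they yield adaptedness on all of \<open>U\<close>.\<close>
  have "0 < det (\<chi> i j. a j i)"
    using F'(2) det_E'[of x] det_pos[OF x] by (simp add: E'x zero_less_mult_iff)
  moreover have "(\<Sum>k\<in>UNIV. a i k * a j k) = (if i = j then 1 else 0)" for i j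
    using inner[OF x, of i j] by (simp add: E'x F')
  moreover have "pull (\<lambda>j. \<chi> i. a j i) rho0 = rho0"
    using pull_E'[OF x] by (simp add: E'x F')
  ultimately have "adapted_frame (G y) (\<rho> y) (\<lambda>i. E' i y)" if "y \<in> U" for y
    using that by (simp add: adapted_frame_def inner pull_E' det_E' det_pos)
  moreover have "smooth_on U (E' i)" for i
    using smooth by (auto simp: smooth_on_def E'_def[abs_def] intro!: Ck_on_sum_scaleR[OF U])
  ultimately have "adapted_frame_field G \<rho> U E'"
    using U by (simp add: adapted_frame_field_def)
  then show thesis using that E'x by blast
qed

section \<open>From the intrinsic torsion of frame fields to the pointwise criteria\<close>

lemma connection_Lam: "connection G E x $ k \<in> Lam 2"
proof -
  have "covec i \<and>\<^sub>f covec j \<in> Lam 2" for i j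
    by (rule wedge_Lam[OF covec_Lam covec_Lam]) simp
  then show ?thesis
    by (auto simp: connection_def intro!: Lam_sum Lam_scaleR)
qed

lemma torsion_intrinsic_torsion:
  assumes G: "smooth_on V G" "\<And>y. y \<in> V \<Longrightarrow> transpose (G y) = G y" "\<And>y v. y \<in> V \<Longrightarrow> v \<noteq> 0 \<Longrightarrow> 0 < v \<bullet> (G y
      *v v)"
    and \<rho>: "smooth_on V \<rho>" and U: "U \<subseteq> V" and E: "adapted_frame_field G \<rho> U E" and x: "x \<in> U"
  shows "intrinsic_torsion G E x \<in> torsion_space"
    and "torsion_d (intrinsic_torsion G E x) = pull (\<lambda>i. E i x) (ext_d \<rho> x)"
    and "torsion_delta (intrinsic_torsion G E x) = pull (\<lambda>i. E i x) (codiff G (\<lambda>i. E i x) \<rho> x)"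
proof -
  have xV: "x \<in> V" using U x by blast
  have "open U" using E by (simp add: adapted_frame_field_def)
  \<comment> \<open>Positive definiteness gives the invertibility used in raising indices.\<close>
  have "\<forall>v. G x *v v = 0 \<longrightarrow> v = 0"
    using G(3)[OF xV] by (metis inner_zero_right less_irrefl)
  then have "invertible (G x)"
    by (simp add: invertible_left_inverse matrix_left_invertible_ker)
  note ctx = \<open>open U\<close> x smooth_on_differentiable[OF G(1) xV] G(2)[OF subsetD[OF U]] this
  have E1: "E i differentiable at x" for i
    using E x by (auto simp: adapted_frame_field_def intro: smooth_on_differentiable)
  have E2: "E i y \<bullet> (G y *v E j y) = (if i = j then 1 else 0)" "pull (\<lambda>i. E i y) (\<rho> y) = rho0" if "y
      \<in> U" for i j y
    using E that by (auto simp: adapted_frame_field_def adapted_frame_def)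
  note \<rho>' = smooth_on_differentiable[OF \<rho> xV]
  have sigma: "sigma 1 (intrinsic_torsion G E x $ k) rho0 = sigma 1 (connection G E x $ k) rho0" for k
    by (simp add: intrinsic_torsion_def sigma_1_pr_m connection_Lam)
  show "intrinsic_torsion G E x \<in> torsion_space"
    by (simp add: torsion_space_def intrinsic_torsion_def pr_m_Lam2_20 connection_Lam)
  show "torsion_d (intrinsic_torsion G E x) = pull (\<lambda>i. E i x) (ext_d \<rho> x)"
    unfolding torsion_d_def sigma by (rule pull_ext_d[OF ctx E1 E2(1) \<rho>' E2(2), symmetric])
  show "torsion_delta (intrinsic_torsion G E x) = pull (\<lambda>i. E i x) (codiff G (\<lambda>i. E i x) \<rho> x)"
    unfolding torsion_delta_def sigma by (rule pull_codiff[OF ctx E1 E2(1) \<rho>' E2(2), symmetric])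
qed

text \<open>\<open>of_type\<close> tests smooth frame fields, \<open>everywhere\<close> single
  frames. A frame field restricts to a frame at each point; conversely every adapted frame extends
  to an adapted frame field, where the torsion is defined.\<close>

lemma of_type_iff_everywhere:
  assumes psu3: "psu3_structure M \<A> g \<rho>"
    and P: "\<And>A. A \<in> torsion_space \<Longrightarrow> A \<in> W_sum J \<longleftrightarrow> P (torsion_d A) (torsion_delta A)"
  shows "of_type \<A> g \<rho> J \<longleftrightarrow> everywhere \<A> g \<rho> P"
proof -
  have fields: "smooth_on (img c) (g c)" "\<And>y. y \<in> img c \<Longrightarrow> transpose (g c y) = g c y"
    "\<And>y v. y \<in> img c \<Longrightarrow> v \<noteq> 0 \<Longrightarrow> 0 < v \<bullet> (g c y *v v)" "smooth_on (img c) (\<rho> c)" if "c \<in> \<A>" for c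
    using psu3 that by (auto simp: psu3_structure_def riemannian_metric_def differential_form_def)
  have iff: "intrinsic_torsion (g c) E x \<in> W_sum J \<longleftrightarrow>
      P (pull (\<lambda>i. E i x) (ext_d (\<rho> c) x)) (pull (\<lambda>i. E i x) (codiff (g c) (\<lambda>i. E i x) (\<rho> c) x))"
    if "c \<in> \<A>" "U \<subseteq> img c" "adapted_frame_field (g c) (\<rho> c) U E" "x \<in> U" for c U E x
    using torsion_intrinsic_torsion[OF fields[OF that(1)] that(2-4)] P by simp
  show ?thesis
  proof
    assume type: "of_type \<A> g \<rho> J"
    show "everywhere \<A> g \<rho> P"
      unfolding everywhere_def
    proof (intro ballI allI impI)
      fix c x F assume c: "c \<in> \<A>" and x: "x \<in> img c" and F: "adapted_frame (g c x) (\<rho> c x) F"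
      obtain U E where U: "x \<in> U" "U \<subseteq> img c" "adapted_frame_field (g c) (\<rho> c) U E"
        using psu3 c x unfolding psu3_structure_def by blast
      obtain E' where E': "adapted_frame_field (g c) (\<rho> c) U E'" "\<And>i. E' i x = F i"
        using adapted_frame_extends[OF U(3,1) F] fields(2)[OF c] U(2) by blast
      have "intrinsic_torsion (g c) E' x \<in> W_sum J"
        using type c U E' unfolding of_type_def by blast
      then show "P (pull F (ext_d (\<rho> c) x)) (pull F (codiff (g c) F (\<rho> c) x))"
        using iff[OF c U(2) E'(1) U(1)] by (simp add: E'(2))
    qed
  next
    assume ev: "everywhere \<A> g \<rho> P"
    show "of_type \<A> g \<rho> J"
      unfolding of_type_def
    proof (intro ballI allI impI)
      fix c U E x assume c: "c \<in> \<A>" and U: "U \<subseteq> img c \<and> adapted_frame_field (g c) (\<rho> c) U E" and x: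
          "x \<in> U"
      then have "adapted_frame (g c x) (\<rho> c x) (\<lambda>i. E i x)" "x \<in> img c"
        by (auto simp: adapted_frame_field_def)
      then show "intrinsic_torsion (g c) E x \<in> W_sum J"
        using iff[OF c _ _ x] U ev c unfolding everywhere_def by blast
    qed
  qed
qed

theorem theorem4p2:
  fixes M :: "'a topology" and \<A> :: "'a chart set"
    and g :: "'a chart \<Rightarrow> real^8 \<Rightarrow> real^8^8" and \<rho> :: "'a chart \<Rightarrow> real^8 \<Rightarrow> form"
  assumes "psu3_structure M \<A> g \<rho>"
  shows "(of_type \<A> g \<rho> {2,3,4,5,6} \<longleftrightarrow>
           everywhere \<A> g \<rho> (\<lambda>d\<rho> \<delta>\<rho>. contr 3 rho0 (hodge d\<rho>) = 0)) \<and>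
    (of_type \<A> g \<rho> {1,3,4,5,6} \<longleftrightarrow>
           everywhere \<A> g \<rho> (\<lambda>d\<rho> \<delta>\<rho>. 6 *\<^sub>R \<delta>\<rho> = contr 1 (contr 2 \<delta>\<rho> rho0) rho0)) \<and>
    (of_type \<A> g \<rho> {1,2,4,5,6} \<longleftrightarrow>
           everywhere \<A> g \<rho> (\<lambda>d\<rho> \<delta>\<rho>.
             sigma_minus (10 *\<^sub>R d\<rho> - hodge (rho0 \<and>\<^sub>f contr 3 rho0 (hodge d\<rho>))) = 0)) \<and>
    (of_type \<A> g \<rho> {1,2,3,5,6} \<longleftrightarrow>
           everywhere \<A> g \<rho> (\<lambda>d\<rho> \<delta>\<rho>. contr 2 \<delta>\<rho> rho0 = 0)) \<and>
    (of_type \<A> g \<rho> {1,2,3,5,6} \<longleftrightarrow>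
           everywhere \<A> g \<rho> (\<lambda>d\<rho> \<delta>\<rho>. contr 3 rho0 d\<rho> = 0)) \<and>
    (of_type \<A> g \<rho> {1,2,3,4,6} \<longleftrightarrow>
           everywhere \<A> g \<rho> (\<lambda>d\<rho> \<delta>\<rho>.
             sigma_minus (10 *\<^sub>R hodge d\<rho> - hodge (rho0 \<and>\<^sub>f contr 3 rho0 d\<rho>)) = 0)) \<and>
    (of_type \<A> g \<rho> {2,4,5,6} \<longleftrightarrow>
           everywhere \<A> g \<rho> (\<lambda>d\<rho> \<delta>\<rho>. sigma_minus d\<rho> = 0)) \<and>
    (of_type \<A> g \<rho> {1,2,3,6} \<longleftrightarrow>
           everywhere \<A> g \<rho> (\<lambda>d\<rho> \<delta>\<rho>. sigma_minus (hodge d\<rho>) = 0)) \<and>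
    (of_type \<A> g \<rho> {1,3,5,6} \<longleftrightarrow>
           everywhere \<A> g \<rho> (\<lambda>d\<rho> \<delta>\<rho>. \<delta>\<rho> = 0)) \<and>
    (of_type \<A> g \<rho> {1,2,6} \<longleftrightarrow>
           everywhere \<A> g \<rho> (\<lambda>d\<rho> \<delta>\<rho>. 10 *\<^sub>R hodge d\<rho> = rho0 \<and>\<^sub>f contr 3 rho0 (hodge d\<rho>))) \<and>
    (of_type \<A> g \<rho> {2,4,6} \<longleftrightarrow>
           everywhere \<A> g \<rho> (\<lambda>d\<rho> \<delta>\<rho>. 10 *\<^sub>R d\<rho> = rho0 \<and>\<^sub>f contr 3 rho0 d\<rho>)) \<and>
    (of_type \<A> g \<rho> {2,6} \<longleftrightarrow>
           everywhere \<A> g \<rho> (\<lambda>d\<rho> \<delta>\<rho>. d\<rho> = 0)) \<and>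
    (of_type \<A> g \<rho> {6} \<longleftrightarrow>
           everywhere \<A> g \<rho> (\<lambda>d\<rho> \<delta>\<rho>. d\<rho> = 0 \<and> \<delta>\<rho> = 0))"
proof -
  note iff = of_type_iff_everywhere[OF assms]
  \<comment> \<open>The criterion of (5) is \<open>excess\<close> of the dual, since the Hodge
    operator is an involution on 4-forms in dimension 8.\<close>
  have hodge_excess: "sigma_minus (10 *\<^sub>R hodge (torsion_d A) - hodge (rho0 \<and>\<^sub>f contr 3 rho0
      (torsion_d A))) =
      excess (hodge (torsion_d A))" if "A \<in> torsion_space" for A
    by (simp add: excess_def hodge_hodge_Lam4 torsion_d_Lam that)
  show ?thesis
    by (intro conjI iff)
      (simp_all add: W_sum_iff hodge_excess contr_2_torsion_delta flip: excess_def)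
qed

end
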